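(* Let $d,n_S\ge1$, $\sigma>0$, $r>0$, let $X_S\in\mathbb{R}^{n_S\times d}$ be fixed with $\hat\Sigma_S:=X_S^\top X_S/n_S$ invertible, and let $\Sigma_T\in\mathbb{R}^{d\times d}$ be symmetric positive semidefinite. Observations are $\mathbf{y}_S=X_S\boldsymbol{\beta}^*+\mathbf{z}$, $\mathbf{z}\sim\mathcal{N}(0,\sigma^2I_{n_S})$, with $\boldsymbol{\beta}^*\in\mathcal{B}:=\{\boldsymbol{\beta}:\|\boldsymbol{\beta}\|_2\le r\}$. For an estimator $\hat{\boldsymbol{\beta}}$ (a measurable map $\mathbb{R}^{n_S}\to\mathbb{R}^d$) define $L_{\mathcal{B}}(\hat{\boldsymbol{\beta}}):=\max_{\boldsymbol{\beta}^*\in\mathcal{B}}\mathbb{E}_{\mathbf{z}}\|\Sigma_T^{1/2}(\hat{\boldsymbol{\beta}}(\mathbf{y}_S)-\boldsymbol{\beta}^* )\|_2^2$, and let $R_L(\mathcal{B}):=\inf_{A\in\mathbb{R}^{d\times n_S}}L_{\mathcal{B}}(\mathbf{y}_S\mapsto A\mathbf{y}_S)$ and $R_N(\mathcal{B}):=\inf_{\hat{\boldsymbol{\beta}}}L_{\mathcal{B}}(\hat{\boldsymbol{\beta}})$ (infimum over all measurable estimators). Let $\hat{\boldsymbol{\beta}}_{\mathrm{SS}}:=\frac1{n_S}\hat\Sigma_S^{-1}X_S^\top\mathbf{y}_S$ and let $(C^*,\tau^* )$ be an optimal solution of $$\min_{C\in\mathbb{R}^{d\times d},\,\tau\in\mathbb{R}}\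 r^2\tau+\frac{\sigma^2}{n_S}\operatorname{Tr}\big(\Sigma_T^{1/2}C\hat\Sigma_S^{-1}C^\top\Sigma_T^{1/2}\big)\quad\text{s.t.}\quad (C-I)^\top\Sigma_T(C-I)\preceq\tau I .$$ Set $\hat{\boldsymbol{\beta}}_{\mathrm{MM}}:=C^*\hat{\boldsymbol{\beta}}_{\mathrm{SS}}$. Then $L_{\mathcal{B}}(\hat{\boldsymbol{\beta}}_{\mathrm{MM}})=R_L(\mathcal{B})$. Moreover, if $\hat\Sigma_S$ and $\Sigma_T$ commute, or if $\Sigma_T$ has rank $1$, then $L_{\mathcal{B}}(\hat{\boldsymbol{\beta}}_{\mathrm{MM}})\le 1.25\,R_N(\mathcal{B})$.
   Context: $X_S$ is treated as fixed (deterministic); expectations are over the Gaussian noise only. $\preceq$ is the Loewner order on symmetric matrices. *)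

theory Defs
  imports "HOL-Probability.Probability"
begin

definition psd :: "real^'d^'d \<Rightarrow> bool" where
  "psd M \<longleftrightarrow> transpose M = M \<and> (\<forall>x. 0 \<le> x \<bullet> (M *v x))"

definition loewner_le :: "real^'d^'d \<Rightarrow> real^'d^'d \<Rightarrow> bool" where
  "loewner_le A B \<longleftrightarrow> psd (B - A)"

definition psd_sqrt :: "real^'d^'d \<Rightarrow> real^'d^'d" where
  "psd_sqrt M = (THE S. psd S \<and> S ** S = M)"

definition gauss_noise :: "real \<Rightarrow> (real^'n) measure" where
  "gauss_noise \<sigma> = density lborel (\<lambda>z. ennreal (\<Prod>i\<in>UNIV. normal_density 0 \<sigma> (z $ i)))"

definition risk_L ::
  "real^'d^'d \<Rightarrow> real^'d^'n \<Rightarrow> real \<Rightarrow> real \<Rightarrow> (real^'n \<Rightarrow> real^'d) \<Rightarrow> ennreal" where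
  "risk_L SigT X \<sigma> r est =
     (SUP \<beta>\<in>{\<beta>::real^'d. norm \<beta> \<le> r}.
        \<integral>\<^sup>+ z. ennreal ((norm (psd_sqrt SigT *v (est (X *v \<beta> + z) - \<beta>)))\<^sup>2) \<partial>(gauss_noise \<sigma>))"

definition R_L :: "real^'d^'d \<Rightarrow> real^'d^'n \<Rightarrow> real \<Rightarrow> real \<Rightarrow> ennreal" where
  "R_L SigT X \<sigma> r = (INF A\<in>(UNIV :: (real^'n^'d) set). risk_L SigT X \<sigma> r (\<lambda>y. A *v y))"

definition R_N :: "real^'d^'d \<Rightarrow> real^'d^'n \<Rightarrow> real \<Rightarrow> real \<Rightarrow> ennreal" where
  "R_N SigT X \<sigma> r = (INF est\<in>(borel_measurable borel :: (real^'n \<Rightarrow> real^'d) set).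
                          risk_L SigT X \<sigma> r est)"

definition sample_cov :: "real^'d^'n \<Rightarrow> real^'d^'d" where
  "sample_cov X = (1 / real CARD('n)) *\<^sub>R (transpose X ** X)"

definition beta_SS :: "real^'d^'n \<Rightarrow> real^'n \<Rightarrow> real^'d" where
  "beta_SS X y = (1 / real CARD('n)) *\<^sub>R (matrix_inv (sample_cov X) *v (transpose X *v y))"

definition mm_objective ::
  "real^'d^'d \<Rightarrow> real^'d^'n \<Rightarrow> real \<Rightarrow> real \<Rightarrow> real^'d^'d \<Rightarrow> real \<Rightarrow> real" where
  "mm_objective SigT X \<sigma> r C \<tau> =
     r\<^sup>2 * \<tau> + \<sigma>\<^sup>2 / real CARD('n) *
       trace (psd_sqrt SigT ** C ** matrix_inv (sample_cov X) ** transpose C ** psd_sqrt SigT)"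

definition mm_feasible :: "real^'d^'d \<Rightarrow> real^'d^'d \<Rightarrow> real \<Rightarrow> bool" where
  "mm_feasible SigT C \<tau> \<longleftrightarrow>
     loewner_le (transpose (C - mat 1) ** SigT ** (C - mat 1)) (\<tau> *\<^sub>R mat 1)"

end

theory Submission
  imports Defs
begin

text \<open>
  A linear estimator \<open>A y\<close> has worst case risk \<open>r\<^sup>2 \<tau> + \<sigma>\<^sup>2 |\<Sigma>\<^sub>T\<^sup>1\<^sup>/\<^sup>2 A|\<^sup>2\<close>, where \<open>\<tau>\<close> is the largest eigenvalue
  of the bias form of \<open>C = A X\<close>. For fixed \<open>C\<close> the variance is minimised by \<open>C\<close> applied to the least squares
  estimator, so the convex program computes the linear minimax risk.

  For the comparison with all estimators, the ball contains hyperrectangles (in the commuting case) or a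
  segment (in the rank one case) on which the linear minimax risk is already that of the ball, and there
  the problem splits into independent bounded normal means. So everything reduces to the
  theorem of Donoho, Liu and MacGibbon: if \<open>\<bar>\<theta>\<bar> \<le> \<kappa>\<close> is observed with standard normal noise, then the
  minimax risk is at least \<open>4/5\<close> of the linear minimax risk \<open>\<kappa>\<^sup>2 / (1 + \<kappa>\<^sup>2)\<close>. The true infimum of the ratio is
  about \<open>0.8022\<close>, near \<open>\<kappa>\<^sup>2 = 2.6\<close>, so the margin is a quarter of a percent. It is certified by explicit priors
  whose Bayes risk has a closed form lower bound: two points for small \<open>\<kappa>\<close>, then three, four, five and nine points.
  From \<open>\<kappa>\<^sup>2 = 16\<close> on, the nine-point prior on \<open>[-4, 4]\<close> already has Bayes risk above \<open>4/5\<close>.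
\<close>

section \<open>Gaussian noise\<close>

text \<open>The pair (\<open>Cs\<close>, \<open>\<tau>s\<close>) is an arbitrary optimum, neither
  diagonal nor of rank one in general, so the comparison uses its objective value alone: it is
  enough to exhibit one feasible pair whose objective, times 4/5, lies below the risk of every
  estimator. In both special cases that pair comes with its hardest subproblem, the two forming a
  saddle point. The obstacle is the quarter of a percent, which must survive for all
  \<open>\<kappa>\<close> and not just at finitely many. Rescaling one prior from
  \<open>\<kappa>^2 = u0\<close> to \<open>u1\<close> loses the factor
  \<open>u0 (1 + u1) / (u1 (1 + u0))\<close>; near 2.6 this alone would force steps below 0.03. The
  three-point priors are therefore treated by concavity in \<open>\<kappa>^2\<close> with the tilted
  masses held fixed, which allows longer steps; further up there is room for rescaling. Bayes risks
  enter through bounds that hold pointwise in the observation and in the guess, so an estimator may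
  depend on the whole observation in \<open>real^'n\<close>.\<close>

lemma prod_UNIV_Basis:
  fixes z :: "real^'n"
  shows "(\<Prod>i\<in>UNIV. g (z $ i)) = (\<Prod>b\<in>Basis. g (z \<bullet> b))"
proof -
  have "(\<Prod>b\<in>Basis. g (z \<bullet> b)) = (\<Prod>b\<in>(\<lambda>i::'n. axis i (1::real)) ` UNIV. g (z \<bullet> b))"
    by (rule prod.cong) (auto simp: Basis_vec_def)
  also have "\<dots> = (\<Prod>i\<in>UNIV. g (z $ i))"
    by (subst prod.reindex) (auto simp: inj_on_def axis_eq_axis inner_axis)
  finally show ?thesis by simp
qed

lemma emeasure_gauss_noise_box:
  assumes "0 < \<sigma>" and A: "\<And>b. b \<in> Basis \<Longrightarrow> A b \<in> sets (borel::real measure)"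
  shows "emeasure (gauss_noise \<sigma>) {z::real^'n. \<forall>b\<in>Basis. z \<bullet> b \<in> A b}
       = (\<Prod>b\<in>Basis. emeasure (density lborel (normal_density 0 \<sigma>)) (A b))"
proof -
  let ?S = "{z::real^'n. \<forall>b\<in>Basis. z \<bullet> b \<in> A b}"
  have S: "?S \<in> sets borel"
  proof -
    have "?S = (\<Inter>b\<in>Basis. (\<lambda>z. z \<bullet> b) -` A b)" by auto
    also have "\<dots> \<in> sets borel"
      using A by (intro sets.finite_INT measurable_sets_borel[OF _ A]) auto
    finally show ?thesis .
  qed
  have "emeasure (gauss_noise \<sigma>) ?S
      = (\<integral>\<^sup>+z. ennreal (\<Prod>i\<in>UNIV. normal_density 0 \<sigma> (z $ i)) * indicator ?S z \<partial>lborel)"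
    unfolding gauss_noise_def using S by (subst emeasure_density) auto
  also have "\<dots> = (\<integral>\<^sup>+z. (\<Prod>b\<in>Basis. ennreal (normal_density 0 \<sigma> (z \<bullet> b)) * indicator (A b) (z \<bullet> b)) \<partial>(lborel::(real^'n) measure))"
  proof (rule nn_integral_cong)
    fix z :: "real^'n"
    have "indicator ?S z = (\<Prod>b\<in>Basis. indicator (A b) (z \<bullet> b) :: ennreal)"
      by (auto simp: indicator_def prod_zero_iff)
    thus "ennreal (\<Prod>i\<in>UNIV. normal_density 0 \<sigma> (z $ i)) * indicator ?S z
        = (\<Prod>b\<in>Basis. ennreal (normal_density 0 \<sigma> (z \<bullet> b)) * indicator (A b) (z \<bullet> b))"
      by (simp add: prod_UNIV_Basis prod.distrib prod_ennreal)
  qed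
  also have "\<dots> = (\<Prod>b\<in>(Basis::(real^'n) set). \<integral>\<^sup>+x. ennreal (normal_density 0 \<sigma> x) * indicator (A b) x \<partial>lborel)"
    using A by (intro nn_integral_lborel_prod) auto
  also have "\<dots> = (\<Prod>b\<in>Basis. emeasure (density lborel (normal_density 0 \<sigma>)) (A b))"
    using A by (intro prod.cong refl) (simp add: emeasure_density)
  finally show ?thesis .
qed

lemma sets_gauss_noise [measurable_cong, simp]: "sets (gauss_noise \<sigma>) = sets borel"
  by (simp add: gauss_noise_def)

lemma space_gauss_noise [simp]: "space (gauss_noise \<sigma>) = UNIV"
  by (simp add: gauss_noise_def)

text \<open>Independence of the coordinates, in the product measure form from which
  \<open>indep_vars\<close> can be read off. It follows from agreement on boxes.\<close>

lemma distr_gauss_noise_coordinates: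
  assumes "0 < \<sigma>"
  shows "distr (gauss_noise \<sigma> :: (real^'n) measure) (\<Pi>\<^sub>M b\<in>Basis. borel) (\<lambda>z. \<lambda>b\<in>Basis. z \<bullet> b)
       = (\<Pi>\<^sub>M b\<in>Basis. density lborel (normal_density 0 \<sigma>))"
proof -
  interpret product_prob_space "\<lambda>b::real^'n. density lborel (normal_density 0 \<sigma>)" Basis
    using assms by (intro product_prob_spaceI prob_space_normal_density)
  have meas: "(\<lambda>z::real^'n. \<lambda>b\<in>Basis. z \<bullet> b) \<in> measurable (gauss_noise \<sigma>) (\<Pi>\<^sub>M b\<in>Basis. borel)"
    by (intro measurable_restrict) simp
  show ?thesis
  proof (rule PiM_eqI)
    fix A :: "real^'n \<Rightarrow> real set"
    assume "\<And>b. b \<in> Basis \<Longrightarrow> A b \<in> sets (density lborel (\<lambda>x. ennreal (normal_density 0 \<sigma> x)))"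
    hence A: "\<And>b. b \<in> Basis \<Longrightarrow> A b \<in> sets borel" by simp
    have "(\<lambda>z::real^'n. \<lambda>b\<in>Basis. z \<bullet> b) -` Pi\<^sub>E Basis A = {z. \<forall>b\<in>Basis. z \<bullet> b \<in> A b}"
      by (auto simp: PiE_iff)
    moreover have "Pi\<^sub>E Basis A \<in> sets (Pi\<^sub>M Basis (\<lambda>b::real^'n. borel))"
      using A by (intro sets_PiM_I_finite) auto
    ultimately show "emeasure (distr (gauss_noise \<sigma>) (Pi\<^sub>M Basis (\<lambda>b. borel)) (\<lambda>z. \<lambda>b\<in>Basis. z \<bullet> b)) (Pi\<^sub>E Basis A)
        = (\<Prod>b\<in>Basis. emeasure (density lborel (\<lambda>x. ennreal (normal_density 0 \<sigma> x))) (A b))"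
      by (simp add: emeasure_distr[OF meas] emeasure_gauss_noise_box[OF assms A])
  next
    show "sets (distr (gauss_noise \<sigma>) (Pi\<^sub>M Basis (\<lambda>b. borel)) (\<lambda>z::real^'n. \<lambda>b\<in>Basis. z \<bullet> b))
        = sets (Pi\<^sub>M Basis (\<lambda>b. density lborel (\<lambda>x. ennreal (normal_density 0 \<sigma> x))))"
      by (simp, rule sets_PiM_cong) auto
  qed simp
qed

lemma prob_space_gauss_noise:
  assumes "0 < \<sigma>"
  shows "prob_space (gauss_noise \<sigma> :: (real^'n) measure)"
proof
  have "emeasure (gauss_noise \<sigma>) {z::real^'n. \<forall>b\<in>Basis. z \<bullet> b \<in> UNIV} = 1"
    using assms prob_space.emeasure_space_1[OF prob_space_normal_density[of \<sigma> 0]]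
    by (subst emeasure_gauss_noise_box) auto
  thus "emeasure (gauss_noise \<sigma> :: (real^'n) measure) (space (gauss_noise \<sigma>)) = 1" by simp
qed

text \<open>A linear form is a sum of independent centred normals, whose variances add up to
  \<open>\<sigma>\<^sup>2\<close> times the squared norm of \<open>a\<close>.\<close>

lemma distributed_gauss_noise_inner:
  fixes a :: "real^'n"
  assumes "0 < \<sigma>" and "a \<noteq> 0"
  shows "distributed (gauss_noise \<sigma>) lborel (\<lambda>z. a \<bullet> z) (normal_density 0 (\<sigma> * norm a))"
proof -
  let ?N = "density lborel (\<lambda>x. ennreal (normal_density 0 \<sigma> x))"
  interpret prob_space "gauss_noise \<sigma> :: (real^'n) measure"
    by (rule prob_space_gauss_noise) fact
  \<comment> \<open>Coordinates with zero coefficient are dropped, because a degenerate normal has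
    no density; \<open>a \<noteq> 0\<close> keeps the index set nonempty.\<close>
  define J where "J = {b\<in>Basis. a \<bullet> b \<noteq> 0}"
  have J: "finite J" "J \<subseteq> Basis" by (auto simp: J_def)
  have "J \<noteq> {}"
    using \<open>a \<noteq> 0\<close> euclidean_all_zero_iff[of a] by (auto simp: J_def)
  have coord: "distr (gauss_noise \<sigma>) borel (\<lambda>z. z \<bullet> b) = ?N" if "b \<in> Basis" for b :: "real^'n"
  proof -
    have "distr (gauss_noise \<sigma>) borel (\<lambda>z. z \<bullet> b)
        = distr (distr (gauss_noise \<sigma>) (\<Pi>\<^sub>M b\<in>Basis. borel) (\<lambda>z::real^'n. \<lambda>b\<in>Basis. z \<bullet> b)) borel (\<lambda>f. f b)"
      using that by (subst distr_distr) (auto intro!: measurable_restrict simp: o_def)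
    also have "\<dots> = distr (\<Pi>\<^sub>M b\<in>Basis. ?N) ?N (\<lambda>f. f b)"
      unfolding distr_gauss_noise_coordinates[OF \<open>0 < \<sigma>\<close>] by (rule distr_cong) auto
    also have "\<dots> = ?N"
      using that \<open>0 < \<sigma>\<close> by (intro distr_PiM_component prob_space_normal_density)
    finally show ?thesis .
  qed
  have indep: "indep_vars (\<lambda>_. borel) (\<lambda>b z. z \<bullet> b) (Basis :: (real^'n) set)"
    by (subst indep_vars_iff_distr_eq_PiM')
       (auto simp: coord distr_gauss_noise_coordinates[OF \<open>0 < \<sigma>\<close>] cong: PiM_cong)
  have "indep_vars (\<lambda>_. borel) (\<lambda>b z. (a \<bullet> b) * (z \<bullet> b)) J"
    by (rule indep_vars_compose2[OF indep_vars_subset[OF indep J(2)]]) simp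
  moreover have "distributed (gauss_noise \<sigma>) lborel (\<lambda>z. (a \<bullet> b) * (z \<bullet> b))
      (normal_density 0 (\<bar>a \<bullet> b\<bar> * \<sigma>))" if "b \<in> J" for b
  proof -
    have "distributed (gauss_noise \<sigma>) lborel (\<lambda>z::real^'n. z \<bullet> b) (normal_density 0 \<sigma>)"
      using coord[of b] that J by (auto simp: distributed_def cong: distr_cong)
    from normal_density_affine[OF this \<open>0 < \<sigma>\<close>, of "a \<bullet> b" 0] that show ?thesis
      by (simp add: J_def)
  qed
  ultimately have "distributed (gauss_noise \<sigma>) lborel (\<lambda>z. \<Sum>b\<in>J. (a \<bullet> b) * (z \<bullet> b))
      (normal_density (\<Sum>b\<in>J. 0) (sqrt (\<Sum>b\<in>J. (\<bar>a \<bullet> b\<bar> * \<sigma>)\<^sup>2)))"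
    using J \<open>J \<noteq> {}\<close> \<open>0 < \<sigma>\<close> by (intro sum_indep_normal) (auto simp: J_def)
  moreover have "(\<Sum>b\<in>J. (a \<bullet> b) * (z \<bullet> b)) = a \<bullet> z" for z
    unfolding euclidean_inner[of a z] J_def by (rule sum.mono_neutral_left) auto
  moreover have "sqrt (\<Sum>b\<in>J. (\<bar>a \<bullet> b\<bar> * \<sigma>)\<^sup>2) = \<sigma> * norm a"
  proof -
    have "(\<Sum>b\<in>J. (\<bar>a \<bullet> b\<bar> * \<sigma>)\<^sup>2) = (\<Sum>b\<in>Basis. (\<bar>a \<bullet> b\<bar> * \<sigma>)\<^sup>2)"
      unfolding J_def by (rule sum.mono_neutral_left) auto
    also have "\<dots> = \<sigma>\<^sup>2 * (a \<bullet> a)"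
      by (simp add: euclidean_inner[of a a] power_mult_distrib sum_distrib_left power2_eq_square mult_ac)
    finally show ?thesis
      using \<open>0 < \<sigma>\<close> by (simp add: real_sqrt_mult norm_eq_sqrt_inner)
  qed
  ultimately show ?thesis by simp
qed

text \<open>Cameron-Martin formula. It puts the observations for all parameters on one noise
  measure, so that the integrands for different atoms of a prior can be compared pointwise.\<close>

lemma nn_integral_gauss_noise_shift:
  fixes h :: "real^'n"
  assumes "0 < \<sigma>" and [measurable]: "F \<in> borel_measurable borel"
  shows "(\<integral>\<^sup>+z. F (h + z) \<partial>(gauss_noise \<sigma>))
       = (\<integral>\<^sup>+y. ennreal (exp (h \<bullet> y / \<sigma>\<^sup>2 - h \<bullet> h / (2 * \<sigma>\<^sup>2))) * F y \<partial>(gauss_noise \<sigma>))"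
proof -
  let ?p = "\<lambda>z::real^'n. \<Prod>i\<in>UNIV. normal_density 0 \<sigma> (z $ i)"
  have shift: "?p (y - h) = ?p y * exp (h \<bullet> y / \<sigma>\<^sup>2 - h \<bullet> h / (2 * \<sigma>\<^sup>2))" for y
  proof -
    have "normal_density 0 \<sigma> (s - t) = normal_density 0 \<sigma> s * exp (t * s / \<sigma>\<^sup>2 - t * t / (2 * \<sigma>\<^sup>2))" for s t
      using assms(1) unfolding normal_density_def
      by (simp add: exp_add[symmetric] field_simps power2_eq_square)
    hence "?p (y - h) = ?p y * exp (\<Sum>i\<in>UNIV. h $ i * y $ i / \<sigma>\<^sup>2 - h $ i * h $ i / (2 * \<sigma>\<^sup>2))"
      by (simp add: prod.distrib exp_sum)
    thus ?thesis
      by (simp add: inner_vec_def sum_subtractf sum_divide_distrib)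
  qed
  have [measurable]: "?p \<in> borel_measurable borel" by measurable
  have "(\<integral>\<^sup>+z. F (h + z) \<partial>(gauss_noise \<sigma>)) = (\<integral>\<^sup>+z. ennreal (?p z) * F (h + z) \<partial>lborel)"
    unfolding gauss_noise_def by (subst nn_integral_density) auto
  also have "\<dots> = (\<integral>\<^sup>+z. ennreal (?p (h + z - h)) * F (h + z) \<partial>lborel)" by simp
  also have "\<dots> = (\<integral>\<^sup>+y. ennreal (?p (y - h)) * F y \<partial>(distr lborel borel ((+) h)))"
    by (subst nn_integral_distr) auto
  also have "\<dots> = (\<integral>\<^sup>+y. ennreal (?p (y - h)) * F y \<partial>lborel)"
    by (simp only: lborel_distr_plus)
  also have "\<dots> = (\<integral>\<^sup>+y. ennreal (?p y) * (ennreal (exp (h \<bullet> y / \<sigma>\<^sup>2 - h \<bullet> h / (2 * \<sigma>\<^sup>2))) * F y) \<partial>lborel)"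
    unfolding shift by (intro nn_integral_cong) (simp add: ennreal_mult'' mult_ac)
  also have "\<dots> = (\<integral>\<^sup>+y. ennreal (exp (h \<bullet> y / \<sigma>\<^sup>2 - h \<bullet> h / (2 * \<sigma>\<^sup>2))) * F y \<partial>(gauss_noise \<sigma>))"
    unfolding gauss_noise_def by (subst nn_integral_density) auto
  finally show ?thesis .
qed

text \<open>Squared bias plus variance: the cross term has a vanishing first moment. The case
  \<open>a = 0\<close> is separate because \<open>a \<bullet> z\<close> then has no density.\<close>

lemma nn_integral_gauss_noise_affine_square:
  fixes a :: "real^'n"
  assumes "0 < \<sigma>"
  shows "(\<integral>\<^sup>+z. ennreal ((m + a \<bullet> z)\<^sup>2) \<partial>(gauss_noise \<sigma>)) = ennreal (m\<^sup>2 + \<sigma>\<^sup>2 * (norm a)\<^sup>2)"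
proof (cases "a = 0")
  case True
  thus ?thesis
    using prob_space.emeasure_space_1[OF prob_space_gauss_noise[OF assms, where 'n='n]] by simp
next
  case False
  let ?s = "\<sigma> * norm a"
  have s: "0 < ?s" using assms False by simp
  have "has_bochner_integral lborel (\<lambda>x. normal_density 0 ?s x * m\<^sup>2) (1 * m\<^sup>2)"
    using s by (intro has_bochner_integral_mult_left) (simp_all add: has_bochner_integral_iff)
  moreover have "has_bochner_integral lborel (\<lambda>x. (normal_density 0 ?s x * x) * (2 * m)) (0 * (2 * m))"
    using normal_moment_nz_1[OF s, of 0] by (intro has_bochner_integral_mult_left) simp_all
  moreover have "has_bochner_integral lborel (\<lambda>x. normal_density 0 ?s x * (x - 0) ^ (2 * 1)) (?s\<^sup>2)"
    using normal_moment_even[OF s, of 0 1] by (simp add: fact_numeral numeral_2_eq_2)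
  ultimately have "has_bochner_integral lborel
      (\<lambda>x. normal_density 0 ?s x * m\<^sup>2 + (normal_density 0 ?s x * x) * (2 * m) + normal_density 0 ?s x * (x - 0) ^ (2 * 1))
      (1 * m\<^sup>2 + 0 * (2 * m) + ?s\<^sup>2)"
    by (intro has_bochner_integral_add)
  hence "has_bochner_integral lborel (\<lambda>x. normal_density 0 ?s x * (m + x)\<^sup>2) (m\<^sup>2 + ?s\<^sup>2)"
    by (simp add: power2_eq_square algebra_simps)
  hence I: "(\<integral>\<^sup>+x. ennreal (normal_density 0 ?s x * (m + x)\<^sup>2) \<partial>lborel) = ennreal (m\<^sup>2 + ?s\<^sup>2)"
    by (subst nn_integral_eq_integral) (auto simp: has_bochner_integral_iff)
  have "(\<integral>\<^sup>+z. ennreal ((m + a \<bullet> z)\<^sup>2) \<partial>(gauss_noise \<sigma>))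
      = (\<integral>\<^sup>+x. ennreal (normal_density 0 ?s x) * ennreal ((m + x)\<^sup>2) \<partial>lborel)"
    by (rule distributed_nn_integral[OF distributed_gauss_noise_inner[OF assms False], symmetric]) simp
  also have "\<dots> = ennreal (m\<^sup>2 + ?s\<^sup>2)"
    unfolding I[symmetric] by (simp add: ennreal_mult')
  finally show ?thesis by (simp add: power_mult_distrib)
qed

section \<open>The bounded normal mean\<close>

text \<open>A finitely supported prior on \<open>[-1, 1]\<close> whose Bayes risk, for the observation
  \<open>\<kappa> b + Z\<close> with standard normal \<open>Z\<close>, is at least \<open>c\<close>. Up to the standard normal density of \<open>z\<close>, the
  right-hand side of the pointwise bound is the joint density times the quadratic loss of the guess \<open>d\<close>.\<close>

definition bayes_bound :: "real \<Rightarrow> real \<Rightarrow> nat \<Rightarrow> (nat \<Rightarrow> real) \<Rightarrow> (nat \<Rightarrow> real) \<Rightarrow> bool" where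
  "bayes_bound \<kappa> c n w b \<longleftrightarrow>
     (\<forall>j<n. 0 \<le> w j \<and> \<bar>b j\<bar> \<le> 1) \<and> (\<Sum>j<n. w j) = 1 \<and>
     (\<exists>l\<in>borel_measurable borel.
        (\<forall>z d. l z \<le> (\<Sum>j<n. w j * (d - b j)\<^sup>2 * exp (\<kappa> * b j * z - \<kappa>\<^sup>2 * (b j)\<^sup>2 / 2))) \<and>
        ennreal c \<le> (\<integral>\<^sup>+z. ennreal (std_normal_density z) * ennreal (l z) \<partial>lborel))"

text \<open>The atoms lie on a segment through \<open>m\<close> in direction \<open>x\<close>, and
  their likelihood ratios depend on the observation only through its projection on \<open>x\<close>.
  Since the certificate bounds the loss for every guess \<open>d\<close> at each \<open>z\<close>,
  the guess may be \<open>G y / q\<close> with \<open>y\<close> the full observation. The number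
  \<open>q\<close> is the size of the target per unit of \<open>b\<close>.\<close>

lemma bayes_bound_gauss_noise:
  fixes x :: "real^'n"
  assumes \<sigma>: "0 < \<sigma>" and "x \<noteq> 0" and g[measurable]: "g \<in> borel_measurable borel"
    and bb: "bayes_bound (norm x / \<sigma>) c n w b"
  shows "ennreal (q\<^sup>2 * c) \<le>
    (\<Sum>j<n. ennreal (w j) * (\<integral>\<^sup>+z. ennreal ((g (m + b j *\<^sub>R x + z) - q * b j)\<^sup>2) \<partial>(gauss_noise \<sigma>)))"
proof (cases "q = 0")
  case True
  thus ?thesis by simp
next
  case False
  define \<kappa> where "\<kappa> = norm x / \<sigma>"
  have "0 < \<kappa>" using assms by (simp add: \<kappa>_def)
  from bb obtain l where w: "\<And>j. j < n \<Longrightarrow> 0 \<le> w j"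
    and l[measurable]: "l \<in> borel_measurable borel"
    and le: "\<And>z d. l z \<le> (\<Sum>j<n. w j * (d - b j)\<^sup>2 * exp (\<kappa> * b j * z - \<kappa>\<^sup>2 * (b j)\<^sup>2 / 2))"
    and c: "ennreal c \<le> (\<integral>\<^sup>+z. ennreal (std_normal_density z) * ennreal (l z) \<partial>lborel)"
    unfolding bayes_bound_def \<kappa>_def by blast
  \<comment> \<open>Of norm \<open>1 / \<sigma>\<close>, so that \<open>x' \<bullet> y\<close> is
    standard normal under the noise and takes the place of \<open>z\<close>.\<close>
  define x' where "x' = (1 / (\<sigma> * norm x)) *\<^sub>R x"
  have x': "norm x' = 1 / \<sigma>" "x' \<noteq> 0"
    using assms by (simp_all add: x'_def)
  define E where "E j y = exp (\<kappa> * b j * (x' \<bullet> y) - \<kappa>\<^sup>2 * (b j)\<^sup>2 / 2)" for j and y :: "real^'n"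
  have E_eq: "exp ((b j *\<^sub>R x) \<bullet> y / \<sigma>\<^sup>2 - (b j *\<^sub>R x) \<bullet> (b j *\<^sub>R x) / (2 * \<sigma>\<^sup>2)) = E j y" for j y
    using assms unfolding E_def x'_def \<kappa>_def
    by (simp add: field_simps power2_eq_square dot_square_norm)
  define G where "G y = g (m + y)" for y
  have [measurable]: "G \<in> borel_measurable borel" "\<And>j. E j \<in> borel_measurable borel"
    unfolding G_def E_def by measurable
  have "ennreal (q\<^sup>2 * c) = ennreal (q\<^sup>2) * ennreal c"
    by (simp add: ennreal_mult')
  also have "\<dots> \<le> ennreal (q\<^sup>2) * (\<integral>\<^sup>+z. ennreal (std_normal_density z) * ennreal (l z) \<partial>lborel)"
    by (intro mult_left_mono c) simp
  also have "(\<integral>\<^sup>+z. ennreal (std_normal_density z) * ennreal (l z) \<partial>lborel)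
      = (\<integral>\<^sup>+y. ennreal (l (x' \<bullet> y)) \<partial>(gauss_noise \<sigma>))"
    using distributed_gauss_noise_inner[OF \<sigma> x'(2)] \<sigma> x'(1)
    by (intro distributed_nn_integral) auto
  also have "ennreal (q\<^sup>2) * \<dots> = (\<integral>\<^sup>+y. ennreal (q\<^sup>2 * l (x' \<bullet> y)) \<partial>(gauss_noise \<sigma>))"
    by (subst nn_integral_cmult[symmetric]) (auto simp: ennreal_mult')
  also have "\<dots> \<le> (\<integral>\<^sup>+y. (\<Sum>j<n. ennreal (w j) * (ennreal (E j y) * ennreal ((G y - q * b j)\<^sup>2))) \<partial>(gauss_noise \<sigma>))"
  proof (rule nn_integral_mono)
    fix y :: "real^'n"
    have "q\<^sup>2 * l (x' \<bullet> y) \<le> q\<^sup>2 * (\<Sum>j<n. w j * (G y / q - b j)\<^sup>2 * E j y)"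
      unfolding E_def by (intro mult_left_mono le) simp
    also have "\<dots> = (\<Sum>j<n. w j * (E j y * (G y - q * b j)\<^sup>2))"
    proof -
      have "q\<^sup>2 * (G y / q - b j)\<^sup>2 = (G y - q * b j)\<^sup>2" for j
        using False by (simp add: power_mult_distrib[symmetric] right_diff_distrib)
      hence "(\<Sum>j<n. w j * (E j y * (G y - q * b j)\<^sup>2)) = (\<Sum>j<n. w j * (E j y * (q\<^sup>2 * (G y / q - b j)\<^sup>2)))"
        by presburger
      thus ?thesis by (simp add: sum_distrib_left mult_ac)
    qed
    finally have "ennreal (q\<^sup>2 * l (x' \<bullet> y)) \<le> ennreal (\<Sum>j<n. w j * (E j y * (G y - q * b j)\<^sup>2))"
      by (rule ennreal_leI)
    also have "\<dots> = (\<Sum>j<n. ennreal (w j) * (ennreal (E j y) * ennreal ((G y - q * b j)\<^sup>2)))"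
      using w by (subst sum_ennreal[symmetric]) (auto simp: ennreal_mult' E_def)
    finally show "ennreal (q\<^sup>2 * l (x' \<bullet> y)) \<le> \<dots>" .
  qed
  also have "\<dots> = (\<Sum>j<n. ennreal (w j) * (\<integral>\<^sup>+y. ennreal (E j y) * ennreal ((G y - q * b j)\<^sup>2) \<partial>(gauss_noise \<sigma>)))"
    by (simp add: nn_integral_sum nn_integral_cmult)
  also have "\<dots> = (\<Sum>j<n. ennreal (w j) * (\<integral>\<^sup>+z. ennreal ((G (b j *\<^sub>R x + z) - q * b j)\<^sup>2) \<partial>(gauss_noise \<sigma>)))"
    unfolding E_eq[symmetric]
    by (intro sum.cong refl arg_cong2[where f="(*)"] nn_integral_gauss_noise_shift[OF \<sigma>, symmetric]) measurable
  finally show ?thesis by (simp add: G_def add.assoc)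
qed

text \<open>Shrinking the locations by \<open>\<kappa>0 / \<kappa>\<close> leaves the signals
  \<open>\<kappa> b\<close>, and hence all likelihoods, unchanged, while the loss shrinks by the
  square of that factor.\<close>

lemma bayes_bound_rescale:
  assumes bb: "bayes_bound \<kappa>0 c n w b" and \<kappa>: "0 < \<kappa>0" "\<kappa>0 \<le> \<kappa>"
  shows "bayes_bound \<kappa> ((\<kappa>0 / \<kappa>)\<^sup>2 * c) n w (\<lambda>j. \<kappa>0 / \<kappa> * b j)"
proof -
  define \<rho> where "\<rho> = \<kappa>0 / \<kappa>"
  have \<rho>: "0 < \<rho>" "\<rho> \<le> 1" "\<kappa> * \<rho> = \<kappa>0" using \<kappa> by (auto simp: \<rho>_def)
  from bb obtain l where w: "\<And>j. j < n \<Longrightarrow> 0 \<le> w j \<and> \<bar>b j\<bar> \<le> 1" "(\<Sum>j<n. w j) = 1"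
    and l[measurable]: "l \<in> borel_measurable borel"
    and le: "\<And>z d. l z \<le> (\<Sum>j<n. w j * (d - b j)\<^sup>2 * exp (\<kappa>0 * b j * z - \<kappa>0\<^sup>2 * (b j)\<^sup>2 / 2))"
    and c: "ennreal c \<le> (\<integral>\<^sup>+z. ennreal (std_normal_density z) * ennreal (l z) \<partial>lborel)"
    unfolding bayes_bound_def by blast
  have "\<bar>\<rho> * b j\<bar> \<le> 1" if "j < n" for j
    using w(1)[OF that] \<rho> by (simp add: abs_mult mult_le_one)
  moreover have "\<rho>\<^sup>2 * l z \<le> (\<Sum>j<n. w j * (d - \<rho> * b j)\<^sup>2 * exp (\<kappa> * (\<rho> * b j) * z - \<kappa>\<^sup>2 * (\<rho> * b j)\<^sup>2 / 2))" for z d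
  proof -
    have "\<rho>\<^sup>2 * l z \<le> \<rho>\<^sup>2 * (\<Sum>j<n. w j * (d / \<rho> - b j)\<^sup>2 * exp (\<kappa>0 * b j * z - \<kappa>0\<^sup>2 * (b j)\<^sup>2 / 2))"
      by (intro mult_left_mono le) simp
    also have "\<dots> = (\<Sum>j<n. w j * (d - \<rho> * b j)\<^sup>2 * exp (\<kappa>0 * b j * z - \<kappa>0\<^sup>2 * (b j)\<^sup>2 / 2))"
    proof -
      have "\<rho>\<^sup>2 * (d / \<rho> - b j)\<^sup>2 = (d - \<rho> * b j)\<^sup>2" for j
        using \<rho> by (simp add: power_mult_distrib[symmetric] right_diff_distrib)
      hence "(\<Sum>j<n. w j * (d - \<rho> * b j)\<^sup>2 * exp (\<kappa>0 * b j * z - \<kappa>0\<^sup>2 * (b j)\<^sup>2 / 2))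
          = (\<Sum>j<n. w j * (\<rho>\<^sup>2 * (d / \<rho> - b j)\<^sup>2) * exp (\<kappa>0 * b j * z - \<kappa>0\<^sup>2 * (b j)\<^sup>2 / 2))"
        by presburger
      thus ?thesis by (simp add: sum_distrib_left mult_ac)
    qed
    finally show ?thesis
      unfolding \<rho>(3)[symmetric] by (simp add: power_mult_distrib mult_ac)
  qed
  moreover have "ennreal (\<rho>\<^sup>2 * c) \<le> (\<integral>\<^sup>+z. ennreal (std_normal_density z) * ennreal (\<rho>\<^sup>2 * l z) \<partial>lborel)"
  proof -
    have "ennreal (\<rho>\<^sup>2 * c) \<le> ennreal (\<rho>\<^sup>2) * (\<integral>\<^sup>+z. ennreal (std_normal_density z) * ennreal (l z) \<partial>lborel)"
      using c by (simp add: ennreal_mult' mult_left_mono)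
    also have "\<dots> = (\<integral>\<^sup>+z. ennreal (std_normal_density z) * ennreal (\<rho>\<^sup>2 * l z) \<partial>lborel)"
      by (subst nn_integral_cmult[symmetric]) (auto simp: ennreal_mult' ennreal_mult'' mult_ac)
    finally show ?thesis .
  qed
  ultimately show ?thesis
    using w unfolding bayes_bound_def \<rho>_def[symmetric]
    by (intro conjI bexI[of _ "\<lambda>z. \<rho>\<^sup>2 * l z"]) auto
qed

section \<open>Gaussian integrals and closed-form Bayes risk bounds\<close>

text \<open>Completing the square: up to a constant the integrand is the normal density with mean
  \<open>f / (1 + s)\<close> and variance \<open>1 / (1 + s)\<close>.\<close>

lemma std_normal_exp_integral:
  assumes "0 < 1 + s"
  shows "has_bochner_integral lborel (\<lambda>z. std_normal_density z * (exp (- s * z\<^sup>2 / 2) * exp (f * z)))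
           (exp (f\<^sup>2 / (2 * (1 + s))) / sqrt (1 + s))"
proof -
  define \<tau> where "\<tau> = 1 / sqrt (1 + s)"
  have \<tau>: "0 < \<tau>" "\<tau>\<^sup>2 = 1 / (1 + s)"
    using assms by (simp_all add: \<tau>_def power_divide)
  have eq: "exp (f\<^sup>2 / (2 * (1 + s))) / sqrt (1 + s) * normal_density (f / (1 + s)) \<tau> z
      = std_normal_density z * (exp (- s * z\<^sup>2 / 2) * exp (f * z))" for z
  proof -
    have "f\<^sup>2 / (2 * (1 + s)) + (- (z - f / (1 + s))\<^sup>2 / (2 * \<tau>\<^sup>2)) = - z\<^sup>2 / 2 + (- s * z\<^sup>2 / 2 + f * z)"
    proof -
      define \<mu> where "\<mu> = f / (1 + s)"
      have f: "f = (1 + s) * \<mu>" using assms by (simp add: \<mu>_def)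
      have "f\<^sup>2 / (2 * (1 + s)) = (1 + s) * \<mu>\<^sup>2 / 2"
      proof -
        have "(t * \<mu>)\<^sup>2 / (2 * t) = t * \<mu>\<^sup>2 / 2" if "t \<noteq> 0" for t
          using that by (simp add: field_simps power2_eq_square)
        from this[of "1 + s"] show ?thesis using assms unfolding f by (simp only: less_imp_neq[THEN not_sym] not_False_eq_True)
      qed
      moreover have "(z - \<mu>)\<^sup>2 / (2 * \<tau>\<^sup>2) = (1 + s) * (z - \<mu>)\<^sup>2 / 2"
        unfolding \<tau>(2) by simp
      ultimately have "f\<^sup>2 / (2 * (1 + s)) + (- (z - f / (1 + s))\<^sup>2 / (2 * \<tau>\<^sup>2))
          = (1 + s) * \<mu>\<^sup>2 / 2 - (1 + s) * (z - \<mu>)\<^sup>2 / 2"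
        unfolding \<mu>_def[symmetric] by (simp only: minus_divide_left[symmetric] add_uminus_conv_diff)
      also have "\<dots> = - z\<^sup>2 / 2 + (- s * z\<^sup>2 / 2 + (1 + s) * \<mu> * z)"
        by (simp add: field_simps power2_eq_square)
      finally show ?thesis by (simp add: f[symmetric])
    qed
    hence "exp (f\<^sup>2 / (2 * (1 + s))) * exp (- (z - f / (1 + s))\<^sup>2 / (2 * \<tau>\<^sup>2))
        = exp (- z\<^sup>2 / 2) * (exp (- s * z\<^sup>2 / 2) * exp (f * z))"
      by (simp only: exp_add[symmetric])
    moreover have "sqrt (2 * pi * \<tau>\<^sup>2) = sqrt (2 * pi) / sqrt (1 + s)"
      unfolding \<tau>(2) by (simp add: real_sqrt_divide real_sqrt_mult)
    ultimately show ?thesis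
      using assms by (simp add: normal_density_def real_sqrt_mult field_simps)
  qed
  have "has_bochner_integral lborel (normal_density (f / (1 + s)) \<tau>) 1"
    using \<tau> by (simp add: has_bochner_integral_iff)
  from has_bochner_integral_mult_right[OF this, of "exp (f\<^sup>2 / (2 * (1 + s))) / sqrt (1 + s)"]
  show ?thesis unfolding eq by simp
qed

lemma std_normal_cosh_integral:
  assumes "0 < 1 + s"
  shows "has_bochner_integral lborel (\<lambda>z. std_normal_density z * (exp (- s * z\<^sup>2 / 2) * cosh (f * z)))
           (exp (f\<^sup>2 / (2 * (1 + s))) / sqrt (1 + s))"
proof -
  have "has_bochner_integral lborel
     (\<lambda>z. (1/2) * (std_normal_density z * (exp (- s * z\<^sup>2 / 2) * exp (f * z))
          + std_normal_density z * (exp (- s * z\<^sup>2 / 2) * exp ((- f) * z))))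
     ((1/2) * (exp (f\<^sup>2 / (2 * (1 + s))) / sqrt (1 + s) + exp ((- f)\<^sup>2 / (2 * (1 + s))) / sqrt (1 + s)))"
    by (intro has_bochner_integral_mult_right has_bochner_integral_add std_normal_exp_integral assms)
  thus ?thesis
    by (simp add: cosh_def algebra_simps)
qed

text \<open>\<open>f\<close> may take negative values, as the certificates \<open>l\<close> below
  can do; \<open>ennreal\<close> cuts them off at 0, which only enlarges the right-hand
  side.\<close>

lemma ennreal_integral_le_nn_integral:
  assumes "has_bochner_integral M f I"
  shows "ennreal I \<le> (\<integral>\<^sup>+x. ennreal (f x) \<partial>M)"
proof -
  have f: "integrable M f" "I = integral\<^sup>L M f"
    using assms by (auto simp: has_bochner_integral_iff)
  have int: "integrable M (\<lambda>x. max 0 (f x))"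
    using f by (intro integrable_max) auto
  have "I \<le> (\<integral>x. max 0 (f x) \<partial>M)"
    unfolding f(2) using f(1) int by (intro integral_mono) auto
  hence "ennreal I \<le> ennreal (\<integral>x. max 0 (f x) \<partial>M)"
    by (rule ennreal_leI)
  also have "\<dots> = (\<integral>\<^sup>+x. ennreal (max 0 (f x)) \<partial>M)"
    using int by (subst nn_integral_eq_integral) auto
  also have "\<dots> = (\<integral>\<^sup>+x. ennreal (f x) \<partial>M)"
    by (intro nn_integral_cong) (auto simp: max_def ennreal_neg)
  finally show ?thesis .
qed

text \<open>An atom \<open>(a, b)\<close> of the list is the location \<open>b\<close> with the tilted mass \<open>a\<close>; its prior mass is
  proportional to \<open>a exp (\<kappa>\<^sup>2 b\<^sup>2 / 2)\<close>. Tilting makes the marginal density \<open>\<phi> (z) \<Sum> a exp (b \<kappa> z)\<close>.\<close>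

lemma bayes_boundI:
  fixes ps :: "(real \<times> real) list" and \<kappa> :: real
  defines "Z \<equiv> \<Sum>(a, b)\<leftarrow>ps. a * exp (\<kappa>\<^sup>2 * b\<^sup>2 / 2)"
  assumes ps: "\<And>a b. (a, b) \<in> set ps \<Longrightarrow> 0 \<le> a \<and> \<bar>b\<bar> \<le> 1" and Z: "0 < Z"
    and l[measurable]: "l \<in> borel_measurable borel"
    and le: "\<And>z d. l z \<le> (\<Sum>(a, b)\<leftarrow>ps. a * (d - b)\<^sup>2 * exp (b * (\<kappa> * z)))"
    and int: "has_bochner_integral lborel (\<lambda>z. std_normal_density z * l z) I" and I: "c * Z \<le> I"
  shows "\<exists>n w b. bayes_bound \<kappa> c n w b"
proof -
  define n where "n = length ps"
  define a b where "a j = fst (ps ! j)" and "b j = snd (ps ! j)" for j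
  define w where "w j = a j * exp (\<kappa>\<^sup>2 * (b j)\<^sup>2 / 2) / Z" for j
  have sum_ps: "(\<Sum>(a, b)\<leftarrow>ps. F a b) = (\<Sum>j<n. F (a j) (b j))" for F :: "real \<Rightarrow> real \<Rightarrow> real"
    by (simp add: sum_list_sum_nth n_def a_def b_def case_prod_beta atLeast0LessThan)
  have ab: "0 \<le> a j" "\<bar>b j\<bar> \<le> 1" if "j < n" for j
    using ps[of "a j" "b j"] that by (auto simp: a_def b_def n_def)
  have "(\<Sum>j<n. w j) = 1"
    using Z by (simp add: w_def sum_divide_distrib[symmetric] Z_def sum_ps)
  moreover have "l z / Z \<le> (\<Sum>j<n. w j * (d - b j)\<^sup>2 * exp (\<kappa> * b j * z - \<kappa>\<^sup>2 * (b j)\<^sup>2 / 2))" for z d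
  proof -
    have "l z / Z \<le> (\<Sum>j<n. a j * (d - b j)\<^sup>2 * exp (b j * (\<kappa> * z))) / Z"
      using le[of z d] Z by (intro divide_right_mono) (auto simp: sum_ps)
    also have "\<dots> = (\<Sum>j<n. w j * (d - b j)\<^sup>2 * exp (\<kappa> * b j * z - \<kappa>\<^sup>2 * (b j)\<^sup>2 / 2))"
      unfolding sum_divide_distrib w_def exp_diff by (intro sum.cong) (auto simp: mult_ac)
    finally show ?thesis .
  qed
  moreover have "ennreal c \<le> (\<integral>\<^sup>+z. ennreal (std_normal_density z) * ennreal (l z / Z) \<partial>lborel)"
  proof -
    have "ennreal c \<le> ennreal (I / Z)"
      using I Z by (intro ennreal_leI) (simp add: field_simps)
    also have "\<dots> \<le> (\<integral>\<^sup>+z. ennreal (std_normal_density z * l z / Z) \<partial>lborel)"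
      using Z by (intro ennreal_integral_le_nn_integral has_bochner_integral_divide_zero int)
    also have "\<dots> = (\<integral>\<^sup>+z. ennreal (std_normal_density z) * ennreal (l z / Z) \<partial>lborel)"
      by (simp add: ennreal_mult'[symmetric])
    finally show ?thesis .
  qed
  moreover have "\<forall>j<n. 0 \<le> w j \<and> \<bar>b j\<bar> \<le> 1"
    using ab Z by (auto simp: w_def)
  ultimately have "bayes_bound \<kappa> c n w b"
    unfolding bayes_bound_def by (intro conjI bexI[of _ "\<lambda>z. l z / Z"]) auto
  thus ?thesis by blast
qed

text \<open>The posterior variance weighted with the marginal density is \<open>N / W\<close>. Replacing \<open>1 / W\<close> by the
  lower bound \<open>2 p - p\<^sup>2 W\<close>, with \<open>p\<close> a multiple of \<open>q\<close>, gives an integral in closed form.\<close>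

lemma bayes_bound_cauchy_schwarz:
  fixes ps :: "(real \<times> real) list" and \<kappa> :: real
  defines "Z \<equiv> \<Sum>(a, b)\<leftarrow>ps. a * exp (\<kappa>\<^sup>2 * b\<^sup>2 / 2)"
  assumes ps: "\<And>a b. (a, b) \<in> set ps \<Longrightarrow> 0 \<le> a \<and> \<bar>b\<bar> \<le> 1" and Z: "0 < Z"
    and meas[measurable]: "W \<in> borel_measurable borel" "N \<in> borel_measurable borel" "q \<in> borel_measurable borel"
    and W: "\<And>x. 0 < W x" and N: "\<And>x. N x = W'' x * W x - (W' x)\<^sup>2" "\<And>x. 0 \<le> N x"
    and eq: "\<And>x d. (\<Sum>(a, b)\<leftarrow>ps. a * (d - b)\<^sup>2 * exp (b * x)) = W x * d\<^sup>2 - 2 * W' x * d + W'' x"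
    and int1: "has_bochner_integral lborel (\<lambda>z. std_normal_density z * (q z * N (\<kappa> * z))) I1"
    and int2: "has_bochner_integral lborel (\<lambda>z. std_normal_density z * ((q z)\<^sup>2 * (N (\<kappa> * z) * W (\<kappa> * z)))) I2"
    and I: "0 < I2" "c * Z * I2 \<le> I1\<^sup>2"
  shows "\<exists>n w b. bayes_bound \<kappa> c n w b"
proof -
  \<comment> \<open>This maximises \<open>2 p I1 - p\<^sup>2 I2\<close>, and the maximum is
    \<open>I1\<^sup>2 / I2\<close>.\<close>
  define p where "p = I1 / I2"
  define l where "l z = N (\<kappa> * z) * (2 * (p * q z) - (p * q z)\<^sup>2 * W (\<kappa> * z))" for z
  show ?thesis
  proof (rule bayes_boundI[where ps=ps and l=l and I="I1\<^sup>2 / I2"])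
    show "l \<in> borel_measurable borel" unfolding l_def by measurable
    show "0 < (\<Sum>(a, b)\<leftarrow>ps. a * exp (\<kappa>\<^sup>2 * b\<^sup>2 / 2))" using Z by (simp add: Z_def)
    show "c * (\<Sum>(a, b)\<leftarrow>ps. a * exp (\<kappa>\<^sup>2 * b\<^sup>2 / 2)) \<le> I1\<^sup>2 / I2"
      using I by (simp add: Z_def field_simps)
    have "has_bochner_integral lborel
       (\<lambda>z. (2 * p) * (std_normal_density z * (q z * N (\<kappa> * z)))
           - p\<^sup>2 * (std_normal_density z * ((q z)\<^sup>2 * (N (\<kappa> * z) * W (\<kappa> * z)))))
       ((2 * p) * I1 - p\<^sup>2 * I2)"
      by (intro has_bochner_integral_diff has_bochner_integral_mult_right int1 int2)
    moreover have "(2 * p) * I1 - p\<^sup>2 * I2 = I1\<^sup>2 / I2"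
      using I by (simp add: p_def field_simps power2_eq_square)
    ultimately show "has_bochner_integral lborel (\<lambda>z. std_normal_density z * l z) (I1\<^sup>2 / I2)"
      by (simp add: l_def algebra_simps power_mult_distrib)
    fix z d
    let ?x = "\<kappa> * z"
    have "l z * W ?x \<le> N ?x"
    proof -
      have "N ?x - l z * W ?x = N ?x * (1 - p * q z * W ?x)\<^sup>2"
        by (simp add: l_def power2_eq_square algebra_simps)
      also have "\<dots> \<ge> 0" using N(2) by simp
      finally show ?thesis by simp
    qed
    \<comment> \<open>Completing the square in \<open>d\<close>; the minimiser \<open>W' / W\<close>
      is the posterior mean.\<close>
    also have "N ?x \<le> (W ?x * d\<^sup>2 - 2 * W' ?x * d + W'' ?x) * W ?x"
    proof -
      have "(W ?x * d\<^sup>2 - 2 * W' ?x * d + W'' ?x) * W ?x - N ?x = (W ?x * d - W' ?x)\<^sup>2"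
        by (simp add: N(1) power2_eq_square algebra_simps)
      also have "\<dots> \<ge> 0" by simp
      finally show ?thesis by simp
    qed
    finally have "l z \<le> W ?x * d\<^sup>2 - 2 * W' ?x * d + W'' ?x"
      using W[of ?x] by simp
    thus "l z \<le> (\<Sum>(a, b)\<leftarrow>ps. a * (d - b)\<^sup>2 * exp (b * (\<kappa> * z)))" by (simp only: eq)
  qed (use ps in blast)
qed

lemma std_normal_cosh_sum_integral:
  fixes cs :: "(real \<times> real) list"
  assumes "0 < 1 + s"
  shows "has_bochner_integral lborel
      (\<lambda>z. std_normal_density z * (exp (- s * z\<^sup>2 / 2) * (\<Sum>(c, f)\<leftarrow>cs. c * cosh (f * (\<kappa> * z)))))
      ((\<Sum>(c, f)\<leftarrow>cs. c * exp (f\<^sup>2 * \<kappa>\<^sup>2 / (2 * (1 + s)))) / sqrt (1 + s))"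
proof (induction cs)
  case Nil
  show ?case by (simp add: has_bochner_integral_zero)
next
  case (Cons p cs)
  obtain c f where p: "p = (c, f)" by (cases p)
  have "has_bochner_integral lborel
      (\<lambda>z. c * (std_normal_density z * (exp (- s * z\<^sup>2 / 2) * cosh ((f * \<kappa>) * z))))
      (c * (exp ((f * \<kappa>)\<^sup>2 / (2 * (1 + s))) / sqrt (1 + s)))"
    by (intro has_bochner_integral_mult_right std_normal_cosh_integral assms)
  from has_bochner_integral_add[OF this Cons.IH] show ?case
    by (simp add: p algebra_simps add_divide_distrib power_mult_distrib)
qed

lemma cosh_mult_cosh: "cosh x * cosh y = (cosh (x + y) + cosh (x - y)) / 2" for x y :: real
  by (simp add: cosh_add cosh_diff)

lemma exp_eq_cosh_sinh: "exp x = cosh x + sinh x" "exp (- x) = cosh x - sinh x" for x :: real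
  by (simp_all add: cosh_def sinh_def field_simps)

lemma gauss_square: "(exp (- s * z\<^sup>2 / 2))\<^sup>2 = exp (- (2 * s) * z\<^sup>2 / 2)" for s z :: real
  by (simp add: power2_eq_square exp_add[symmetric])

section \<open>Explicit families of priors\<close>

text \<open>Since \<open>cosh\<^sup>2 - sinh\<^sup>2 = 1\<close>, the weighted posterior variance is
  \<open>1 / cosh\<close>, and \<open>exp (- z\<^sup>2 / 2)\<close> imitates its shape. With this
  weight and its square the integrals have precision 2 and 3; hence \<open>sqrt 3\<close>, and the
  exponent 2/3 as 1/2 + 1/6.\<close>

lemma two_point_bayes_bound:
  assumes "c * exp (2 * \<kappa>\<^sup>2 / 3) \<le> sqrt 3 / 2"
  shows "\<exists>n w b. bayes_bound \<kappa> c n w b"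
proof (rule bayes_bound_cauchy_schwarz[where ps="[(1/2, 1), (1/2, -1)]" and q="\<lambda>z. exp (- 1 * z\<^sup>2 / 2)"
      and W=cosh and W'=sinh and W''=cosh and N="\<lambda>_. 1"])
  show "has_bochner_integral lborel (\<lambda>z. std_normal_density z * (exp (- 1 * z\<^sup>2 / 2) * 1)) (1 / sqrt 2)"
    using std_normal_cosh_sum_integral[of 1 \<kappa> "[(1, 0)]"] by simp
  show "has_bochner_integral lborel
      (\<lambda>z. std_normal_density z * ((exp (- 1 * z\<^sup>2 / 2))\<^sup>2 * (1 * cosh (\<kappa> * z)))) (exp (\<kappa>\<^sup>2 / 6) / sqrt 3)"
    unfolding gauss_square using std_normal_cosh_sum_integral[of 2 \<kappa> "[(1, 1)]"] by simp
  have "exp (2 * \<kappa>\<^sup>2 / 3) = exp (\<kappa>\<^sup>2 / 2) * exp (\<kappa>\<^sup>2 / 6)"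
    by (simp add: exp_add[symmetric])
  hence "c * exp (\<kappa>\<^sup>2 / 2) * exp (\<kappa>\<^sup>2 / 6) / sqrt 3 \<le> 1 / 2"
    using assms by (simp add: field_simps)
  thus "c * (\<Sum>(a, b)\<leftarrow>[(1 / 2, 1), (1 / 2, - 1)]. a * exp (\<kappa>\<^sup>2 * b\<^sup>2 / 2)) * (exp (\<kappa>\<^sup>2 / 6) / sqrt 3) \<le> (1 / sqrt 2)\<^sup>2"
    by (simp add: power_divide)
  show "(\<Sum>(a, b)\<leftarrow>[(1 / 2, 1), (1 / 2, - 1)]. a * (d - b)\<^sup>2 * exp (b * x)) = cosh x * d\<^sup>2 - 2 * sinh x * d + cosh x" for x d :: real
    by (simp add: exp_eq_cosh_sinh power2_eq_square algebra_simps)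
  show "cosh \<in> borel_measurable (borel :: real measure)"
    by (intro borel_measurable_continuous_onI continuous_intros)
  show "1 = cosh x * cosh x - (sinh x)\<^sup>2" for x :: real
    using cosh_square_eq[of x] by (simp add: power2_eq_square)
qed (auto)

text \<open>Tilted mass 1 at 0 and \<open>k / 2\<close> at each end. The Gaussian weight has
  parameter 3/4, so a term \<open>cosh (f x)\<close> integrates to
  \<open>exp (f\<^sup>2 u / (2 P)) / sqrt P\<close>, with \<open>P = 7/4\<close> for
  \<open>N\<close> and \<open>P = 5/2\<close> for \<open>N W\<close>. The hypothesis
  \<open>c\<close> is the Cauchy-Schwarz condition with one factor \<open>k\<close>
  cancelled.\<close>

lemma three_point_bayes_bound:
  fixes \<kappa> u :: real
  defines "u \<equiv> \<kappa>\<^sup>2"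
  assumes k: "0 < k" and c: "c * (1 + k * exp (u / 2)) * (3 / 2 * k + (1 + k\<^sup>2) * exp (u / 5) + k / 2 * exp (4 * u / 5)) / sqrt (5 / 2)
      \<le> k * (k + exp (2 * u / 7))\<^sup>2 * (4 / 7)"
  shows "\<exists>n w b. bayes_bound \<kappa> c n w b"
proof (rule bayes_bound_cauchy_schwarz[where ps="[(1, 0), (k/2, 1), (k/2, -1)]" and q="\<lambda>z. exp (- (3/4) * z\<^sup>2 / 2)"
      and W="\<lambda>x. 1 + k * cosh x" and W'="\<lambda>x. k * sinh x" and W''="\<lambda>x. k * cosh x" and N="\<lambda>x. k * (k + cosh x)"])
  show "has_bochner_integral lborel
      (\<lambda>z. std_normal_density z * (exp (- (3/4) * z\<^sup>2 / 2) * (k * (k + cosh (\<kappa> * z)))))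
      (k * (k + exp (2 * u / 7)) / sqrt (7 / 4))"
    using std_normal_cosh_sum_integral[of "3/4" \<kappa> "[(k\<^sup>2, 0), (k, 1)]"]
    by (simp add: u_def algebra_simps power2_eq_square)
  have NW: "k * (k + cosh x) * (1 + k * cosh x)
      = (\<Sum>(c, f)\<leftarrow>[(3 / 2 * k\<^sup>2, 0), (k * (1 + k\<^sup>2), 1), (k\<^sup>2 / 2, 2)]. c * cosh (f * x))" for x
  proof -
    have "k * (k + cosh x) * (1 + k * cosh x) = 3 / 2 * k\<^sup>2 + k * (1 + k\<^sup>2) * cosh x + k\<^sup>2 / 2 * cosh (2 * x)"
      unfolding cosh_double_cosh by (simp add: field_simps power2_eq_square)
    thus ?thesis by simp
  qed
  show "has_bochner_integral lborel
      (\<lambda>z. std_normal_density z * ((exp (- (3/4) * z\<^sup>2 / 2))\<^sup>2 * (k * (k + cosh (\<kappa> * z)) * (1 + k * cosh (\<kappa> * z)))))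
      (k * (3 / 2 * k + (1 + k\<^sup>2) * exp (u / 5) + k / 2 * exp (4 * u / 5)) / sqrt (5 / 2))"
    unfolding gauss_square NW
    using std_normal_cosh_sum_integral[of "2 * (3/4)" \<kappa> "[(3 / 2 * k\<^sup>2, 0), (k * (1 + k\<^sup>2), 1), (k\<^sup>2 / 2, 2)]"]
    by (simp add: u_def algebra_simps power2_eq_square)
  have pos: "0 < 3 / 2 * k + (1 + k\<^sup>2) * exp (u / 5) + k / 2 * exp (4 * u / 5)"
    using k by (intro add_pos_pos mult_pos_pos) auto
  thus "0 < k * (3 / 2 * k + (1 + k\<^sup>2) * exp (u / 5) + k / 2 * exp (4 * u / 5)) / sqrt (5 / 2)"
    using k by simp
  show "c * (\<Sum>(a, b)\<leftarrow>[(1, 0), (k / 2, 1), (k / 2, - 1)]. a * exp (\<kappa>\<^sup>2 * b\<^sup>2 / 2))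
      * (k * (3 / 2 * k + (1 + k\<^sup>2) * exp (u / 5) + k / 2 * exp (4 * u / 5)) / sqrt (5 / 2))
      \<le> (k * (k + exp (2 * u / 7)) / sqrt (7 / 4))\<^sup>2"
    using mult_left_mono[OF c, of k] k
    by (simp add: u_def[symmetric] power_mult_distrib power_divide power2_eq_square[of k] mult_ac)
  show "(\<Sum>(a, b)\<leftarrow>[(1, 0), (k / 2, 1), (k / 2, - 1)]. a * (d - b)\<^sup>2 * exp (b * x))
      = (1 + k * cosh x) * d\<^sup>2 - 2 * (k * sinh x) * d + k * cosh x" for x d
    by (simp add: exp_eq_cosh_sinh power2_eq_square algebra_simps)
  show "(\<lambda>x. 1 + k * cosh x) \<in> borel_measurable borel" "(\<lambda>x. k * (k + cosh x)) \<in> borel_measurable borel"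
    by (intro borel_measurable_continuous_onI continuous_intros)+
  show "k * (k + cosh x) = k * cosh x * (1 + k * cosh x) - (k * sinh x)\<^sup>2" for x
    using cosh_square_eq[of x] by (simp add: power2_eq_square algebra_simps)
  show "0 < 1 + k * cosh x" "0 \<le> k * (k + cosh x)" for x
    using k cosh_real_pos[of x] by (simp_all add: add_pos_pos)
qed (use k in \<open>auto simp: add_pos_pos\<close>)

text \<open>Tilted mass 1/2 at each end and \<open>A / 2\<close> at each of 1/4 and -1/4. Turning
  products of hyperbolic cosines into sums makes \<open>N\<close> and \<open>N W\<close>
  combinations of \<open>cosh (f x)\<close> with nonnegative coefficients. The Gaussian weight has
  parameter 4/5, which gives the precisions 9/5 and 13/5.\<close>

lemma four_point_bayes_bound:
  fixes \<kappa> u :: real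
  defines "u \<equiv> \<kappa>\<^sup>2"
  assumes A: "0 < A"
    and c: "c * (exp (u / 2) + A * exp (u / 32))
      * ((A\<^sup>2 / 16 + 1 + 17 * A\<^sup>2 / 32) * exp (5 * u / 26) + (A * (A\<^sup>2 / 16 + 1) + 17 * A / 32) * exp (5 * u / 416)
         + 9 * A / 64 * exp (405 * u / 416) + 25 * A / 64 * exp (245 * u / 416)
         + 9 * A\<^sup>2 / 64 * exp (45 * u / 104) + 25 * A\<^sup>2 / 64 * exp (5 * u / 104)) / sqrt (13 / 5)
      \<le> (A\<^sup>2 / 16 + 1 + 9 * A / 32 * exp (125 * u / 288) + 25 * A / 32 * exp (5 * u / 32))\<^sup>2 * (5 / 9)"
  shows "\<exists>n w b. bayes_bound \<kappa> c n w b"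
proof -
  define N where "N x = A\<^sup>2 / 16 + 1 + 9 * A / 32 * cosh (5 / 4 * x) + 25 * A / 32 * cosh (3 / 4 * x)" for x
  define W where "W x = cosh x + A * cosh (1 / 4 * x)" for x
  define I2 where "I2 = (A\<^sup>2 / 16 + 1 + 17 * A\<^sup>2 / 32) * exp (5 * u / 26) + (A * (A\<^sup>2 / 16 + 1) + 17 * A / 32) * exp (5 * u / 416)
         + 9 * A / 64 * exp (405 * u / 416) + 25 * A / 64 * exp (245 * u / 416)
         + 9 * A\<^sup>2 / 64 * exp (45 * u / 104) + 25 * A\<^sup>2 / 64 * exp (5 * u / 104)"
  have "0 < I2"
    unfolding I2_def using A by (intro add_pos_pos mult_pos_pos) auto
  show ?thesis
  proof (rule bayes_bound_cauchy_schwarz[where ps="[(1/2, 1), (1/2, -1), (A/2, 1/4), (A/2, -1/4)]"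
        and q="\<lambda>z. exp (- (4/5) * z\<^sup>2 / 2)" and W=W and N=N and W'="\<lambda>x. sinh x + A / 4 * sinh (1 / 4 * x)"
        and W''="\<lambda>x. cosh x + A / 16 * cosh (1 / 4 * x)"])
    show "has_bochner_integral lborel
        (\<lambda>z. std_normal_density z * (exp (- (4/5) * z\<^sup>2 / 2) * N (\<kappa> * z)))
        ((A\<^sup>2 / 16 + 1 + 9 * A / 32 * exp (125 * u / 288) + 25 * A / 32 * exp (5 * u / 32)) / sqrt (9 / 5))"
      using std_normal_cosh_sum_integral[of "4/5" \<kappa> "[(A\<^sup>2 / 16 + 1, 0), (9 * A / 32, 5/4), (25 * A / 32, 3/4)]"]
      by (simp add: u_def N_def algebra_simps power_divide)
    have NW: "N x * W x = (\<Sum>(c, f)\<leftarrow>[(A\<^sup>2 / 16 + 1 + 17 * A\<^sup>2 / 32, 1), (A * (A\<^sup>2 / 16 + 1) + 17 * A / 32, 1/4),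
        (9 * A / 64, 9/4), (25 * A / 64, 7/4), (9 * A\<^sup>2 / 64, 3/2), (25 * A\<^sup>2 / 64, 1/2)]. c * cosh (f * x))" for x
    proof -
      have "N x * W x = (A\<^sup>2 / 16 + 1) * cosh x + (A\<^sup>2 / 16 + 1) * A * cosh (1 / 4 * x)
          + 9 * A / 32 * (cosh (5 / 4 * x) * cosh x) + 9 * A\<^sup>2 / 32 * (cosh (5 / 4 * x) * cosh (1 / 4 * x))
          + 25 * A / 32 * (cosh x * cosh (3 / 4 * x)) + 25 * A\<^sup>2 / 32 * (cosh (3 / 4 * x) * cosh (1 / 4 * x))"
        by (simp add: N_def W_def algebra_simps add_divide_distrib power2_eq_square)
      also have "\<dots> = (A\<^sup>2 / 16 + 1) * cosh x + (A\<^sup>2 / 16 + 1) * A * cosh (1 / 4 * x)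
          + 9 * A / 32 * ((cosh (9 / 4 * x) + cosh (1 / 4 * x)) / 2) + 9 * A\<^sup>2 / 32 * ((cosh (3 / 2 * x) + cosh x) / 2)
          + 25 * A / 32 * ((cosh (7 / 4 * x) + cosh (1 / 4 * x)) / 2) + 25 * A\<^sup>2 / 32 * ((cosh x + cosh (1 / 2 * x)) / 2)"
        unfolding cosh_mult_cosh by simp
      finally show ?thesis by (simp add: algebra_simps add_divide_distrib)
    qed
    show "has_bochner_integral lborel
        (\<lambda>z. std_normal_density z * ((exp (- (4/5) * z\<^sup>2 / 2))\<^sup>2 * (N (\<kappa> * z) * W (\<kappa> * z)))) (I2 / sqrt (13 / 5))"
      unfolding gauss_square NW
      using std_normal_cosh_sum_integral[of "2 * (4/5)" \<kappa> "[(A\<^sup>2 / 16 + 1 + 17 * A\<^sup>2 / 32, 1), (A * (A\<^sup>2 / 16 + 1) + 17 * A / 32, 1/4),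
        (9 * A / 64, 9/4), (25 * A / 64, 7/4), (9 * A\<^sup>2 / 64, 3/2), (25 * A\<^sup>2 / 64, 1/2)]"]
      by (simp add: u_def I2_def power_divide add.assoc mult.commute[of "\<kappa>\<^sup>2" 5])
    show "0 < I2 / sqrt (13 / 5)" using \<open>0 < I2\<close> by simp
    show "c * (\<Sum>(a, b)\<leftarrow>[(1/2, 1), (1/2, -1), (A/2, 1/4), (A/2, -1/4)]. a * exp (\<kappa>\<^sup>2 * b\<^sup>2 / 2)) * (I2 / sqrt (13 / 5))
       \<le> ((A\<^sup>2 / 16 + 1 + 9 * A / 32 * exp (125 * u / 288) + 25 * A / 32 * exp (5 * u / 32)) / sqrt (9 / 5))\<^sup>2"
      using c unfolding I2_def[symmetric] by (simp add: u_def[symmetric] power_divide)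
    show "(\<Sum>(a, b)\<leftarrow>[(1/2, 1), (1/2, -1), (A/2, 1/4), (A/2, -1/4)]. a * (d - b)\<^sup>2 * exp (b * x))
        = W x * d\<^sup>2 - 2 * (sinh x + A / 4 * sinh (1 / 4 * x)) * d + (cosh x + A / 16 * cosh (1 / 4 * x))" for x d
    proof -
      define C S C' S' where "C = cosh x" and "S = sinh x" and "C' = cosh (1 / 4 * x)" and "S' = sinh (1 / 4 * x)"
      have "exp (1 * x) = C + S" "exp (- 1 * x) = C - S" "exp (1 / 4 * x) = C' + S'" "exp (- 1 / 4 * x) = C' - S'"
        using exp_eq_cosh_sinh[of x] exp_eq_cosh_sinh[of "1 / 4 * x"] by (simp_all add: C_def S_def C'_def S'_def)
      note e = this
      show ?thesis
        unfolding W_def list.map sum_list.Cons sum_list.Nil prod.case e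
          C_def[symmetric] S_def[symmetric] C'_def[symmetric] S'_def[symmetric]
        by (simp add: algebra_simps power2_eq_square add_divide_distrib diff_divide_distrib)
    qed
    show "W \<in> borel_measurable borel" "N \<in> borel_measurable borel"
      unfolding W_def N_def by (intro borel_measurable_continuous_onI continuous_intros)+
    show "N x = (cosh x + A / 16 * cosh (1 / 4 * x)) * W x - (sinh x + A / 4 * sinh (1 / 4 * x))\<^sup>2" for x
    proof -
      define C S C' S' where "C = cosh x" and "S = sinh x" and "C' = cosh (1 / 4 * x)" and "S' = sinh (1 / 4 * x)"
      have sums: "cosh (5 / 4 * x) = C * C' + S * S'" "cosh (3 / 4 * x) = C * C' - S * S'"
        using cosh_add[of x "1 / 4 * x"] cosh_diff[of x "1 / 4 * x"] by (simp_all add: C_def S_def C'_def S'_def mult_ac)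
      have squares: "C * C = S * S + 1" "C' * C' = S' * S' + 1" "C * (C * v) = S * (S * v) + v" "C' * (C' * v) = S' * (S' * v) + v" for v
        using cosh_square_eq[of x] cosh_square_eq[of "1 / 4 * x"]
        by (simp_all add: C_def S_def C'_def S'_def power2_eq_square mult.assoc[symmetric] distrib_right)
      show ?thesis
        unfolding N_def W_def sums C_def[symmetric] S_def[symmetric] C'_def[symmetric] S'_def[symmetric]
        by (simp add: algebra_simps power2_eq_square add_divide_distrib diff_divide_distrib squares)
    qed
    show "0 < W x" "0 \<le> N x" for x
      using A cosh_real_pos[of x] cosh_real_pos[of "1 / 4 * x"] cosh_real_pos[of "5 / 4 * x"] cosh_real_pos[of "3 / 4 * x"]
      unfolding W_def N_def by (auto intro!: add_pos_pos add_nonneg_nonneg mult_nonneg_nonneg)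
  qed (use A in \<open>auto simp: add_pos_pos\<close>)
qed

text \<open>If the marginal is a Gaussian times the square of \<open>H\<close>, then \<open>N / W = 2 (H H'' - H'\<^sup>2)\<close> exactly.\<close>

lemma squared_marginal_bayes_bound:
  fixes \<kappa> c0 c1 :: real
  defines "y \<equiv> exp (\<kappa>\<^sup>2 / 32)"
  assumes c0: "0 \<le> c0" and c1: "0 \<le> c1"
    and c: "c * (c0\<^sup>2 + c1\<^sup>2 / 2 + 1 / 2 + (2 * c0 * c1 + c1) * y + (2 * c0 + c1\<^sup>2 / 2) * y ^ 4 + c1 * y ^ 9 + y ^ 16 / 2)
      \<le> 1 / 2 + c1\<^sup>2 / 8 + (c0 * c1 / 8 + 9 * c1 / 16) * y + c0 / 2 * y ^ 4 + c1 / 16 * y ^ 9"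
  shows "\<exists>n w b. bayes_bound \<kappa> c n w b"
proof -
  \<comment> \<open>The atoms are the product-to-sum expansion of the square of
    \<open>H = c0 + c1 cosh (x / 4) + cosh (x / 2)\<close> with \<open>x = \<kappa> z\<close>;
    \<open>cs\<close> expands \<open>2 (H H'' - H'\<^sup>2)\<close> in the same way.\<close>
  define ps where "ps = [(c0\<^sup>2 + c1\<^sup>2 / 2 + 1 / 2, 0), ((2 * c0 * c1 + c1) / 2, 1/4), ((2 * c0 * c1 + c1) / 2, -1/4),
     ((2 * c0 + c1\<^sup>2 / 2) / 2, 1/2), ((2 * c0 + c1\<^sup>2 / 2) / 2, -1/2), (c1 / 2, 3/4), (c1 / 2, -3/4), (1/4, 1), (1/4, -1 :: real)]"
  define cs where "cs = [(1 / 2 + c1\<^sup>2 / 8, 0), (c0 * c1 / 8 + 9 * c1 / 16, 1/4), (c0 / 2, 1/2), (c1 / 16, 3/4 :: real)]"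
  define l where "l z = (\<Sum>(a, f)\<leftarrow>cs. a * cosh (f * (\<kappa> * z)))" for z
  \<comment> \<open>A location \<open>j / 4\<close> contributes
    \<open>exp (\<kappa>\<^sup>2 j\<^sup>2 / 32)\<close>, hence the square powers 1, 4, 9, 16 of
    \<open>y\<close>.\<close>
  have pow: "exp (\<kappa>\<^sup>2 / 8) = y ^ 4" "exp (9 * \<kappa>\<^sup>2 / 32) = y ^ 9" "exp (\<kappa>\<^sup>2 / 2) = y ^ 16"
    by (simp_all add: y_def exp_of_nat_mult[symmetric])
  have Z: "(\<Sum>(a, b)\<leftarrow>ps. a * exp (\<kappa>\<^sup>2 * b\<^sup>2 / 2))
      = c0\<^sup>2 + c1\<^sup>2 / 2 + 1 / 2 + (2 * c0 * c1 + c1) * y + (2 * c0 + c1\<^sup>2 / 2) * y ^ 4 + c1 * y ^ 9 + y ^ 16 / 2"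
    by (simp add: ps_def power_divide pow y_def[symmetric] mult.commute[of "\<kappa>\<^sup>2"] field_simps)
  have y: "0 < y" by (simp add: y_def)
  show ?thesis
  proof (rule bayes_boundI[where ps=ps and l=l])
    show "0 \<le> a \<and> \<bar>b\<bar> \<le> 1" if "(a, b) \<in> set ps" for a b
    proof -
      have "\<forall>p\<in>set ps. 0 \<le> fst p \<and> \<bar>snd p\<bar> \<le> 1"
        using c0 c1 by (simp add: ps_def)
      thus ?thesis using that by force
    qed
    show "0 < (\<Sum>(a, b)\<leftarrow>ps. a * exp (\<kappa>\<^sup>2 * b\<^sup>2 / 2))"
      unfolding Z using c0 c1 y by (intro add_nonneg_pos add_nonneg_nonneg mult_nonneg_nonneg) auto
    show "l \<in> borel_measurable borel"
      unfolding l_def cs_def by (intro borel_measurable_continuous_onI) (auto intro!: continuous_intros)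
    show "has_bochner_integral lborel (\<lambda>z. std_normal_density z * l z)
        (1 / 2 + c1\<^sup>2 / 8 + (c0 * c1 / 8 + 9 * c1 / 16) * y + c0 / 2 * y ^ 4 + c1 / 16 * y ^ 9)"
      using std_normal_cosh_sum_integral[of 0 \<kappa> cs] unfolding l_def[symmetric]
      by (simp add: cs_def power_divide pow y_def[symmetric] add.assoc)
    show "c * (\<Sum>(a, b)\<leftarrow>ps. a * exp (\<kappa>\<^sup>2 * b\<^sup>2 / 2))
       \<le> 1 / 2 + c1\<^sup>2 / 8 + (c0 * c1 / 8 + 9 * c1 / 16) * y + c0 / 2 * y ^ 4 + c1 / 16 * y ^ 9"
      unfolding Z by (rule c)
    fix z d
    define t where "t = \<kappa> * z / 4"
    define C S where "C = cosh t" and "S = sinh t"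
    have CS: "C * C = S * S + 1" "C * (C * x) = S * (S * x) + x" for x
      using cosh_square_eq[of t] by (simp_all add: C_def S_def power2_eq_square mult.assoc[symmetric] distrib_right)
    have e2: "cosh (2 * t) = 1 + 2 * S\<^sup>2" "sinh (2 * t) = 2 * S * C"
      by (simp_all add: C_def S_def cosh_double sinh_double cosh_square_eq)
    have e3: "cosh (3 * t) = C * (1 + 4 * S\<^sup>2)" "sinh (3 * t) = S * (3 + 4 * S\<^sup>2)"
      using cosh_add[of t "2 * t"] sinh_add[of t "2 * t"] unfolding e2
      by (simp_all add: C_def[symmetric] S_def[symmetric] power2_eq_square algebra_simps CS)
    have e4: "cosh (4 * t) = 1 + 8 * S\<^sup>2 + 8 * S ^ 4" "sinh (4 * t) = 4 * S * C * (1 + 2 * S\<^sup>2)"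
      using cosh_double[of "2 * t"] sinh_double[of "2 * t"] unfolding e2
      by (simp_all add: power2_eq_square power4_eq_xxxx algebra_simps CS)
    have args: "1 / 4 * (\<kappa> * z) = t" "1 / 2 * (\<kappa> * z) = 2 * t" "3 / 4 * (\<kappa> * z) = 3 * t" "1 * (\<kappa> * z) = 4 * t"
      "- 1 / 4 * (\<kappa> * z) = - t" "- 1 / 2 * (\<kappa> * z) = - (2 * t)" "- 3 / 4 * (\<kappa> * z) = - (3 * t)" "- 1 * (\<kappa> * z) = - (4 * t)"
      by (simp_all add: t_def)
    \<comment> \<open>\<open>H'\<close> is the derivative of \<open>H\<close> in
      \<open>x = 4 t\<close>. The marginal factor \<open>H\<^sup>2\<close> has derivative
      \<open>2 H H'\<close>, so the optimal guess is \<open>2 H' / H\<close> and the excess over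
      \<open>l\<close> is a perfect square.\<close>
    define H H' where "H = c0 + c1 * C + 1 + 2 * S\<^sup>2" and "H' = c1 * S / 4 + S * C"
    have "(\<Sum>(a, b)\<leftarrow>ps. a * (d - b)\<^sup>2 * exp (b * (\<kappa> * z))) =
       (c0\<^sup>2 + c1\<^sup>2 / 2 + 1 / 2) * d\<^sup>2
       + (2 * c0 * c1 + c1) * (cosh t * (d\<^sup>2 + 1 / 16) - d / 2 * sinh t)
       + (2 * c0 + c1\<^sup>2 / 2) * (cosh (2 * t) * (d\<^sup>2 + 1 / 4) - d * sinh (2 * t))
       + c1 * (cosh (3 * t) * (d\<^sup>2 + 9 / 16) - 3 / 2 * d * sinh (3 * t))
       + (cosh (4 * t) * (d\<^sup>2 + 1) - 2 * d * sinh (4 * t)) / 2"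
      unfolding ps_def list.map sum_list.Cons sum_list.Nil prod.case args exp_eq_cosh_sinh
      by (simp add: algebra_simps power2_eq_square add_divide_distrib diff_divide_distrib)
    moreover have "l z = 1 / 2 + c1\<^sup>2 / 8 + (c0 * c1 / 8 + 9 * c1 / 16) * cosh t + c0 / 2 * cosh (2 * t) + c1 / 16 * cosh (3 * t)"
      unfolding l_def cs_def list.map sum_list.Cons sum_list.Nil prod.case args by simp
    ultimately have "(\<Sum>(a, b)\<leftarrow>ps. a * (d - b)\<^sup>2 * exp (b * (\<kappa> * z))) - l z = (H * d - 2 * H')\<^sup>2"
      unfolding e2 e3 e4 C_def[symmetric] S_def[symmetric] H_def H'_def
      by (simp add: algebra_simps power2_eq_square power4_eq_xxxx add_divide_distrib diff_divide_distrib CS)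
    thus "l z \<le> (\<Sum>(a, b)\<leftarrow>ps. a * (d - b)\<^sup>2 * exp (b * (\<kappa> * z)))"
      using zero_le_power2[of "H * d - 2 * H'"] by linarith
  qed
qed

section \<open>Convexity and rational bounds for the exponential\<close>

lemma convex_on_le_0:
  fixes f :: "real \<Rightarrow> real"
  assumes "convex_on {a..b} f" "f a \<le> 0" "f b \<le> 0" "a \<le> x" "x \<le> b"
  shows "f x \<le> 0"
proof (cases "a = b")
  case True
  thus ?thesis using assms by simp
next
  case False
  define t where "t = (x - a) / (b - a)"
  have "0 \<le> t" "t \<le> 1" "t * (b - a) = x - a"
    using assms False by (auto simp: t_def)
  hence t: "0 \<le> t" "t \<le> 1" "x = (1 - t) * a + t * b"
    by (auto simp: algebra_simps)
  have "f ((1 - t) *\<^sub>R a + t *\<^sub>R b) \<le> (1 - t) * f a + t * f b"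
    using assms t by (intro convex_onD) auto
  also have "\<dots> \<le> 0"
    using assms t by (intro add_nonpos_nonpos mult_nonneg_nonpos) auto
  finally show ?thesis using t by simp
qed

lemma convex_on_exp_linear:
  fixes p q :: real
  assumes "0 \<le> p"
  shows "convex_on {a..b} (\<lambda>u. p * exp (q * u))"
  by (rule f''_ge0_imp_convex[where f'="\<lambda>u. p * q * exp (q * u)" and f''="\<lambda>u. p * q\<^sup>2 * exp (q * u)"])
     (use assms in \<open>auto intro!: derivative_eq_intros simp: power2_eq_square\<close>)

text \<open>Taylor polynomial of degree 7 in Horner form, cheap to evaluate at rational
  points.\<close>

definition exp_taylor :: "real \<Rightarrow> real" where
  "exp_taylor a = 1 + a * (1 + a / 2 * (1 + a / 3 * (1 + a / 4 * (1 + a / 5 * (1 + a / 6 * (1 + a / 7))))))"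

text \<open>The intermediate point of the remainder satisfies
  \<open>exp t \<le> exp 1 \<le> 3\<close>, and \<open>8! / 3 = 13440\<close>.\<close>

lemma exp_taylor_bounds:
  assumes "0 \<le> a" "a \<le> 1"
  shows "exp_taylor a \<le> exp a" "exp a \<le> exp_taylor a + a ^ 8 / 13440"
proof -
  obtain t where t: "\<bar>t\<bar> \<le> \<bar>a\<bar>" "exp a = (\<Sum>m<8. a ^ m / fact m) + exp t / fact 8 * a ^ 8"
    using Maclaurin_exp_le[of a 8] by blast
  have sum: "(\<Sum>m<8. a ^ m / fact m) = exp_taylor a"
    by (simp add: exp_taylor_def eval_nat_numeral algebra_simps)
  have "exp t \<le> exp 1" using t(1) assms by simp
  hence "exp t \<le> 3" using exp_le by linarith
  hence "exp t / fact 8 * a ^ 8 \<le> 3 / fact 8 * a ^ 8"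
    using assms by (intro mult_right_mono divide_right_mono) auto
  also have "\<dots> = a ^ 8 / 13440" by (simp add: fact_numeral)
  finally show "exp a \<le> exp_taylor a + a ^ 8 / 13440" using t(2) sum by simp
  show "exp_taylor a \<le> exp a" using t(2) sum assms by simp
qed

text \<open>Larger arguments are written as \<open>n a\<close> with \<open>a\<close> in the unit
  interval, where the Taylor bound is sharp.\<close>

lemma exp_multiple_bounds:
  assumes "0 \<le> a" "a \<le> 1" "0 \<le> L" "L \<le> exp_taylor a" "exp_taylor a + a ^ 8 / 13440 \<le> U"
  shows "L ^ n \<le> exp (real n * a)" "exp (real n * a) \<le> U ^ n"
  using exp_taylor_bounds[OF assms(1,2)] assms unfolding exp_of_nat_mult
  by (auto intro!: power_mono)

lemma bayes_bound_mono:
  assumes "bayes_bound \<kappa> c n w b" "c' \<le> c"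
  shows "bayes_bound \<kappa> c' n w b"
proof -
  have "ennreal c' \<le> ennreal c" by (rule ennreal_leI) fact
  thus ?thesis using assms(1) unfolding bayes_bound_def by (meson order_trans)
qed

text \<open>A prior for \<open>\<kappa>\<^sup>2 = u0\<close> is, after rescaling, also a prior for every larger \<open>\<kappa>\<close>, so one prior serves a whole range.\<close>

lemma bayes_bound_extend:
  assumes "\<exists>n w b. bayes_bound (sqrt u0) (4 / 5 * u1 / ((1 + u1) * u0)) n w b"
    and u: "u0 \<le> \<kappa>\<^sup>2" "\<kappa>\<^sup>2 \<le> u1" and "0 \<le> \<kappa>" and "0 < u0"
  shows "\<exists>n w b. bayes_bound \<kappa> (4 / 5 / (1 + \<kappa>\<^sup>2)) n w b"
proof -
  obtain n w b where bb: "bayes_bound (sqrt u0) (4 / 5 * u1 / ((1 + u1) * u0)) n w b"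
    using assms(1) by blast
  have "sqrt u0 \<le> \<kappa>" using u(1) \<open>0 \<le> \<kappa>\<close> by (simp add: real_le_lsqrt)
  have "0 < \<kappa>\<^sup>2" using u \<open>0 < u0\<close> by linarith
  have "4 / 5 / (1 + \<kappa>\<^sup>2) \<le> (sqrt u0 / \<kappa>)\<^sup>2 * (4 / 5 * u1 / ((1 + u1) * u0))"
  proof -
    \<comment> \<open>In signal units the rescaled prior keeps its Bayes risk, while the target, 4/5
      of \<open>\<kappa>\<^sup>2 / (1 + \<kappa>\<^sup>2)\<close>, increases. So the right end
      \<open>u1\<close> is the worst point and fixes the constant.\<close>
    have "\<kappa>\<^sup>2 / (1 + \<kappa>\<^sup>2) \<le> u1 / (1 + u1)"
    proof -
      have "0 < 1 + \<kappa>\<^sup>2" "0 < 1 + u1" using u \<open>0 < \<kappa>\<^sup>2\<close> by linarith+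
      thus ?thesis using u by (simp add: pos_divide_le_eq pos_le_divide_eq algebra_simps)
    qed
    hence "4 / 5 * (\<kappa>\<^sup>2 / (1 + \<kappa>\<^sup>2)) / \<kappa>\<^sup>2 \<le> 4 / 5 * (u1 / (1 + u1)) / \<kappa>\<^sup>2"
      by (intro divide_right_mono mult_left_mono) auto
    hence "4 / 5 / (1 + \<kappa>\<^sup>2) \<le> 4 / 5 * (u1 / (1 + u1)) / \<kappa>\<^sup>2"
      using \<open>0 < \<kappa>\<^sup>2\<close> by simp
    also have "\<dots> = (sqrt u0 / \<kappa>)\<^sup>2 * (4 / 5 * u1 / ((1 + u1) * u0))"
      using \<open>0 < u0\<close> by (simp add: power_divide)
    finally show ?thesis .
  qed
  from bayes_bound_mono[OF bayes_bound_rescale[OF bb _ \<open>sqrt u0 \<le> \<kappa>\<close>] this] \<open>0 < u0\<close> show ?thesis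
    by auto
qed

section \<open>Ranges of the two- and three-point priors\<close>

text \<open>The two-point condition compares a convex exponential with a linear function of
  \<open>\<kappa>\<^sup>2\<close>, so checking 0 and the right end suffices. At the right end the
  roundings 1.732 of \<open>sqrt 3\<close> and 2.6825 of \<open>exp (74 / 75)\<close> leave a margin
  of about 0.002.\<close>

lemma two_point_cover:
  assumes "\<kappa>\<^sup>2 \<le> 37 / 25"
  shows "\<exists>n w b. bayes_bound \<kappa> (4 / 5 / (1 + \<kappa>\<^sup>2)) n w b"
proof (rule two_point_bayes_bound)
  have r: "1732 / 1000 \<le> sqrt 3" by (rule real_le_rsqrt) (simp add: power2_eq_square)
  have "1 * exp (2 / 3 * \<kappa>\<^sup>2) + (- (5 / 8 * (1732 / 1000)) * (1 + \<kappa>\<^sup>2)) \<le> 0"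
  proof (rule convex_on_le_0[where a=0 and b="37/25" and f="\<lambda>u. 1 * exp (2 / 3 * u) + (- (5 / 8 * (1732 / 1000)) * (1 + u))"])
    show "convex_on {0..37 / 25} (\<lambda>u::real. 1 * exp (2 / 3 * u) + (- (5 / 8 * (1732 / 1000)) * (1 + u)))"
      by (rule f''_ge0_imp_convex[where f'="\<lambda>u. 2 / 3 * exp (2 / 3 * u) - 5 / 8 * (1732 / 1000)"
            and f''="\<lambda>u. 4 / 9 * exp (2 / 3 * u)"]) (auto intro!: derivative_eq_intros)
    have "exp (real 1 * (74 / 75)) \<le> (26825 / 10000) ^ 1"
      by (rule exp_multiple_bounds(2)[where L=0]) (simp_all add: exp_taylor_def power_divide)
    thus "1 * exp (2 / 3 * (37 / 25)) + (- (5 / 8 * (1732 / 1000)) * (1 + 37 / 25)) \<le> (0::real)"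
      by simp
  qed (use assms in auto)
  hence "exp (2 * \<kappa>\<^sup>2 / 3) \<le> 5 / 8 * (1732 / 1000) * (1 + \<kappa>\<^sup>2)"
    by simp
  also have "\<dots> \<le> 5 / 8 * sqrt 3 * (1 + \<kappa>\<^sup>2)"
    using r by (intro mult_right_mono) auto
  finally have "exp (2 * \<kappa>\<^sup>2 / 3) \<le> 5 / 8 * sqrt 3 * (1 + \<kappa>\<^sup>2)" .
  moreover have "0 < 1 + \<kappa>\<^sup>2" by (simp add: add_pos_nonneg)
  ultimately show "4 / 5 / (1 + \<kappa>\<^sup>2) * exp (2 * \<kappa>\<^sup>2 / 3) \<le> sqrt 3 / 2"
    by (simp add: field_simps)
qed

text \<open>The factor \<open>1581138 / 1000000\<close> is a lower bound of \<open>sqrt (5 / 2)\<close>.\<close>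

definition three_point_gap :: "real \<Rightarrow> real \<Rightarrow> real" where
  "three_point_gap k u = 1581138 / 1000000 * (5 / 7) * (1 + u) * k * (k + exp (2 * u / 7))\<^sup>2
     - (1 + k * exp (u / 2)) * (3 / 2 * k + (1 + k\<^sup>2) * exp (u / 5) + k / 2 * exp (4 * u / 5))"

text \<open>The hypotheses round the powers of an exponential step by step, which keeps the numerals short. The
  instances below come from a numerical optimisation over the prior (\<open>k\<close>, \<open>A\<close>, or \<open>p\<close> and \<open>q\<close>) and the grid.\<close>

lemma three_point_node:
  assumes u: "0 \<le> u" "u \<le> 10" and k: "0 < k"
    and L: "0 \<le> La" "La \<le> exp_taylor (u / 14)" "0 \<le> Lb" "Lb \<le> La ^ 4"
    and U: "exp_taylor (u / 10) + (u / 10) ^ 8 / 13440 \<le> Ua" "Ua ^ 2 \<le> Ub" "Ub ^ 2 * Ua \<le> Uc" "Ub ^ 4 \<le> Ud"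
    and num: "(1 + k * Uc) * (3 / 2 * k + (1 + k\<^sup>2) * Ub + k / 2 * Ud)
      \<le> 1581138 / 1000000 * (5 / 7) * (1 + u) * k * (k + Lb)\<^sup>2"
  shows "0 \<le> three_point_gap k u"
proof -
  define y where "y = exp (u / 10)"
  have y: "0 < y" "y \<le> Ua"
    using exp_taylor_bounds[of "u / 10"] u U(1) by (auto simp: y_def)
  have y2: "y ^ 2 \<le> Ub"
    using power_mono[OF y(2), of 2] U(2) y(1) by linarith
  have Ub: "0 \<le> Ub" using y2 zero_less_power[OF y(1), of 2] by linarith
  have "(y ^ 2) ^ 2 * y \<le> Ub ^ 2 * Ua"
    using y y2 Ub by (intro mult_mono power_mono) auto
  hence y5: "y ^ 5 \<le> Uc"
    using U(3) power_add[of y 4 1] by (simp add: power_mult[symmetric])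
  have y8: "y ^ 8 \<le> Ud"
    using power_mono[OF y2, of 4] U(4) y(1) by (simp add: power_mult[symmetric])
  have "La ^ 4 \<le> exp (real 4 * (u / 14))"
    using exp_multiple_bounds(1)[of "u / 14" La _ 4] u L by auto
  hence l4: "Lb \<le> exp (2 * u / 7)" using L(4) by simp
  have e: "exp (u / 2) = y ^ 5" "exp (u / 5) = y ^ 2" "exp (4 * u / 5) = y ^ 8"
    by (simp_all add: y_def exp_of_nat_mult[symmetric])
  have "(1 + k * exp (u / 2)) * (3 / 2 * k + (1 + k\<^sup>2) * exp (u / 5) + k / 2 * exp (4 * u / 5))
      \<le> (1 + k * Uc) * (3 / 2 * k + (1 + k\<^sup>2) * Ub + k / 2 * Ud)"
    unfolding e using y2 y5 y8 k y(1) order_trans[OF zero_le_power y5]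
    by (intro mult_mono add_mono mult_left_mono) (auto intro!: add_nonneg_nonneg)
  also note num
  also have "1581138 / 1000000 * (5 / 7) * (1 + u) * k * (k + Lb)\<^sup>2
      \<le> 1581138 / 1000000 * (5 / 7) * (1 + u) * k * (k + exp (2 * u / 7))\<^sup>2"
    using l4 u k L by (intro mult_left_mono power_mono add_mono) auto
  finally show ?thesis by (simp add: three_point_gap_def)
qed

text \<open>For fixed \<open>k\<close>, the gap times \<open>exp (- 4 u / 7)\<close> is concave, so it suffices to check the endpoints.\<close>

lemma three_point_interval:
  assumes ends: "0 \<le> three_point_gap k u0" "0 \<le> three_point_gap k u1"
    and \<kappa>: "u0 \<le> \<kappa>\<^sup>2" "\<kappa>\<^sup>2 \<le> u1" and "0 \<le> u0" and k: "0 < k"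
    and uk: "u1 \<le> 5 / 2 \<or> k \<le> 5 / 7 \<and> u1 \<le> 22 / 5"
  shows "\<exists>n w b. bayes_bound \<kappa> (4 / 5 / (1 + \<kappa>\<^sup>2)) n w b"
proof -
  define R :: real where "R = 1581138 / 1000000 * (5 / 7)"
  \<comment> \<open>\<open>f\<close> is minus the scaled gap. Its exponentials have nonnegative
    coefficients and are convex; only \<open>g\<close>, which carries the factor
    \<open>1 + u\<close>, calls for a second derivative.\<close>
  define g where "g u = - ((1 + u) * (1 + k * exp (- (2 * u / 7)))\<^sup>2)" for u
  define f where "f u = R * k * g u + (3 / 2 * k) * exp (- 4 / 7 * u) + (1 + k\<^sup>2) * exp (- 13 / 35 * u)
     + k / 2 * exp (8 / 35 * u) + (3 / 2 * k\<^sup>2) * exp (- 1 / 14 * u) + (k * (1 + k\<^sup>2)) * exp (9 / 70 * u)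
     + (k\<^sup>2 / 2) * exp (51 / 70 * u)" for u
  have f_eq: "f u = - exp (- 4 / 7 * u) * three_point_gap k u" for u
  proof -
    have "exp (- 4 / 7 * u) * exp (2 * u / 7) = exp (- (2 * u / 7))"
      "exp (- 4 / 7 * u) * (exp (2 * u / 7) * exp (2 * u / 7)) = 1"
      "exp (- 4 / 7 * u) * exp (u / 5) = exp (- 13 / 35 * u)"
      "exp (- 4 / 7 * u) * exp (4 * u / 5) = exp (8 / 35 * u)"
      "exp (- 4 / 7 * u) * exp (u / 2) = exp (- 1 / 14 * u)"
      "exp (- 4 / 7 * u) * (exp (u / 2) * exp (u / 5)) = exp (9 / 70 * u)"
      "exp (- 4 / 7 * u) * (exp (u / 2) * exp (4 * u / 5)) = exp (51 / 70 * u)"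
      "exp (- 4 / 7 * u) = exp (- (2 * u / 7)) * exp (- (2 * u / 7))"
      by (simp_all add: exp_add[symmetric])
    note e = this
    have "- exp (- 4 / 7 * u) * three_point_gap k u
       = - (R * k * (1 + u) * (k\<^sup>2 * exp (- 4 / 7 * u) + 2 * k * (exp (- 4 / 7 * u) * exp (2 * u / 7))
            + exp (- 4 / 7 * u) * (exp (2 * u / 7) * exp (2 * u / 7))))
         + (3 / 2 * k) * exp (- 4 / 7 * u) + (1 + k\<^sup>2) * (exp (- 4 / 7 * u) * exp (u / 5))
         + k / 2 * (exp (- 4 / 7 * u) * exp (4 * u / 5)) + (3 / 2 * k\<^sup>2) * (exp (- 4 / 7 * u) * exp (u / 2))
         + (k * (1 + k\<^sup>2)) * (exp (- 4 / 7 * u) * (exp (u / 2) * exp (u / 5)))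
         + (k\<^sup>2 / 2) * (exp (- 4 / 7 * u) * (exp (u / 2) * exp (4 * u / 5)))"
      unfolding three_point_gap_def R_def[symmetric]
      by (simp add: algebra_simps power2_eq_square add_divide_distrib diff_divide_distrib)
    also have "\<dots> = f u"
      unfolding e(1-7) f_def g_def by (subst e(8)) (simp add: algebra_simps power2_eq_square e(8))
    finally show ?thesis by simp
  qed
  have "convex_on {u0..u1} g"
  proof (rule f''_ge0_imp_convex)
    let ?y = "\<lambda>u. k * exp (- (2 * u / 7))"
    show "(g has_real_derivative - (1 + ?y u)\<^sup>2 + (1 + u) * (4 / 7) * (?y u * (1 + ?y u))) (at u)" for u
      unfolding g_def by (auto intro!: derivative_eq_intros simp: power2_eq_square algebra_simps add_divide_distrib)
    show "((\<lambda>u. - (1 + ?y u)\<^sup>2 + (1 + u) * (4 / 7) * (?y u * (1 + ?y u))) has_real_derivative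
        8 / 49 * ?y u * ((6 - u) - ?y u * (2 * u - 5))) (at u)" for u
      by (auto intro!: derivative_eq_intros simp: power2_eq_square algebra_simps add_divide_distrib diff_divide_distrib)
    show "0 \<le> 8 / 49 * ?y u * ((6 - u) - ?y u * (2 * u - 5))" if "u \<in> {u0..u1}" for u
    proof -
      have u: "0 \<le> u" "u \<le> u1" using that \<open>0 \<le> u0\<close> by auto
      have "?y u * (2 * u - 5) \<le> 6 - u"
      \<comment> \<open>For \<open>u \<le> 5/2\<close> the left side is nonpositive whatever
        \<open>k\<close> is. Beyond that, \<open>k \<le> 5/7\<close> and
        \<open>exp (- (2 u / 7)) \<le> 7/12\<close> reduce the claim to
        \<open>5/12 (2 u - 5) \<le> 6 - u\<close>, true up to 97/22. This is the origin of the
        hypothesis \<open>uk\<close> and its bound 22/5.\<close>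
      proof (cases "u \<le> 5 / 2")
        case True
        hence "?y u * (2 * u - 5) \<le> 0" using k by (intro mult_nonneg_nonpos) auto
        thus ?thesis using True by linarith
      next
        case False
        with uk u have k67: "k \<le> 5 / 7" and u92: "u \<le> 22 / 5" by auto
        have "exp (- (2 * u / 7)) \<le> 1 / (1 + 2 * u / 7)"
          using exp_ge_add_one_self[of "2 * u / 7"] u by (simp add: exp_minus field_simps)
        also have "\<dots> \<le> 7 / 12" using False by (simp add: field_simps)
        finally have "?y u \<le> 5 / 7 * (7 / 12)"
          using k k67 by (intro mult_mono) auto
        hence "?y u * (2 * u - 5) \<le> 5 / 12 * (2 * u - 5)"
          using False by (intro mult_right_mono) auto
        also have "\<dots> \<le> 6 - u" using u92 by simp
        finally show ?thesis .
      qed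
      thus ?thesis using k by (intro mult_nonneg_nonneg) auto
    qed
  qed simp
  hence "convex_on {u0..u1} (\<lambda>u. R * k * g u)"
    using k by (intro convex_on_cmul) (auto simp: R_def)
  hence "convex_on {u0..u1} f"
    unfolding f_def using k by (intro convex_on_add convex_on_exp_linear) auto
  hence "f (\<kappa>\<^sup>2) \<le> 0"
    by (rule convex_on_le_0) (use ends \<kappa> in \<open>auto simp: f_eq\<close>)
  hence gap: "0 \<le> three_point_gap k (\<kappa>\<^sup>2)"
    by (simp add: f_eq mult_le_0_iff zero_le_mult_iff)
  have sq: "1581138 / 1000000 \<le> sqrt (5 / 2)" by (rule real_le_rsqrt) (simp add: power2_eq_square)
  have pos: "0 < 1 + \<kappa>\<^sup>2" by (simp add: add_pos_nonneg)
  show ?thesis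
  proof (rule three_point_bayes_bound[OF k])
    let ?D = "(1 + k * exp (\<kappa>\<^sup>2 / 2)) * (3 / 2 * k + (1 + k\<^sup>2) * exp (\<kappa>\<^sup>2 / 5) + k / 2 * exp (4 * \<kappa>\<^sup>2 / 5))"
    let ?N = "k * (k + exp (2 * \<kappa>\<^sup>2 / 7))\<^sup>2"
    have "?D \<le> 1581138 / 1000000 * (5 / 7 * (1 + \<kappa>\<^sup>2) * ?N)"
      using gap unfolding three_point_gap_def diff_ge_0_iff_ge by (simp only: mult_ac)
    also have "\<dots> \<le> sqrt (5 / 2) * (5 / 7 * (1 + \<kappa>\<^sup>2) * ?N)"
      using sq k by (intro mult_right_mono) auto
    finally have "?D / sqrt (5 / 2) \<le> 5 / 7 * (1 + \<kappa>\<^sup>2) * ?N"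
      by (simp add: pos_divide_le_eq mult_ac)
    hence "4 / 5 / (1 + \<kappa>\<^sup>2) * (?D / sqrt (5 / 2)) \<le> 4 / 5 / (1 + \<kappa>\<^sup>2) * (5 / 7 * (1 + \<kappa>\<^sup>2) * ?N)"
      using pos by (intro mult_left_mono) auto
    also have "\<dots> = ?N * (4 / 7)" using pos by simp
    finally show "4 / 5 / (1 + \<kappa>\<^sup>2) * (1 + k * exp (\<kappa>\<^sup>2 / 2)) * (3 / 2 * k + (1 + k\<^sup>2) * exp (\<kappa>\<^sup>2 / 5) + k / 2 * exp (4 * \<kappa>\<^sup>2 / 5)) / sqrt (5 / 2)
       \<le> ?N * (4 / 7)" by (simp only: mult.assoc times_divide_eq_right)
  qed
qed

text \<open>At a node \<open>u\<close>, \<open>La\<close> and \<open>Lb\<close> bound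
  \<open>exp (u / 14)\<close> and \<open>exp (2 u / 7)\<close> from below; \<open>Ua\<close> to
  \<open>Ud\<close> bound \<open>exp (u / 10)\<close>, \<open>exp (u / 5)\<close>,
  \<open>exp (u / 2)\<close> and \<open>exp (4 u / 5)\<close> from above. Neighbouring intervals
  share a node and its numerals but not \<open>k\<close>, so each inner node is checked once for
  either side.\<close>

lemma three_point_ends_1:
  "0 \<le> three_point_gap (109 / 100) (37 / 25)" "0 \<le> three_point_gap (109 / 100) (41 / 20)"
  by (rule three_point_node[where La="11115042 / 10000000" and Lb="1526315 / 1000000" and Ua="11595129 / 10000000"
      and Ub="1344471 / 1000000" and Uc="2095939 / 1000000" and Ud="326743 / 100000"];
      simp add: exp_taylor_def power_divide)
    (rule three_point_node[where La="11576922 / 10000000" and Lb="1796273 / 1000000" and Ua="12275251 / 10000000"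
        and Ub="1506818 / 1000000" and Uc="2787097 / 1000000" and Ud="515518 / 100000"];
      simp add: exp_taylor_def power_divide)

lemma three_point_ends_2:
  "0 \<le> three_point_gap (147 / 200) (41 / 20)" "0 \<le> three_point_gap (147 / 200) (227 / 100)"
  by (rule three_point_node[where La="11576922 / 10000000" and Lb="1796273 / 1000000" and Ua="12275251 / 10000000"
      and Ub="1506818 / 1000000" and Uc="2787097 / 1000000" and Ud="515518 / 100000"];
      simp add: exp_taylor_def power_divide)
    (rule three_point_node[where La="11760282 / 10000000" and Lb="1912806 / 1000000" and Ua="12548299 / 10000000"
        and Ub="1574599 / 1000000" and Uc="3111178 / 1000000" and Ud="614724 / 100000"];
      simp add: exp_taylor_def power_divide)

lemma three_point_ends_3:
  "0 \<le> three_point_gap (63 / 100) (227 / 100)" "0 \<le> three_point_gap (63 / 100) (239 / 100)"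
  by (rule three_point_node[where La="11760282 / 10000000" and Lb="1912806 / 1000000" and Ua="12548299 / 10000000"
      and Ub="1574599 / 1000000" and Uc="3111178 / 1000000" and Ud="614724 / 100000"];
      simp add: exp_taylor_def power_divide)
    (rule three_point_node[where La="11861518 / 10000000" and Lb="1979525 / 1000000" and Ua="12699786 / 10000000"
        and Ub="1612846 / 1000000" and Uc="3303561 / 1000000" and Ud="676662 / 100000"];
      simp add: exp_taylor_def power_divide)

lemma three_point_ends_4:
  "0 \<le> three_point_gap (23 / 40) (239 / 100)" "0 \<le> three_point_gap (23 / 40) (247 / 100)"
  by (rule three_point_node[where La="11861518 / 10000000" and Lb="1979525 / 1000000" and Ua="12699786 / 10000000"
      and Ub="1612846 / 1000000" and Uc="3303561 / 1000000" and Ud="676662 / 100000"];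
      simp add: exp_taylor_def power_divide)
    (rule three_point_node[where La="11929492 / 10000000" and Lb="2025292 / 1000000" and Ua="12801792 / 10000000"
        and Ub="1638859 / 1000000" and Uc="3438381 / 1000000" and Ud="721384 / 100000"];
      simp add: exp_taylor_def power_divide)

lemma three_point_ends_5:
  "0 \<le> three_point_gap (27 / 50) (247 / 100)" "0 \<le> three_point_gap (27 / 50) (127 / 50)"
  by (rule three_point_node[where La="11929492 / 10000000" and Lb="2025292 / 1000000" and Ua="12801792 / 10000000"
      and Ub="1638859 / 1000000" and Uc="3438381 / 1000000" and Ud="721384 / 100000"];
      simp add: exp_taylor_def power_divide)
    (rule three_point_node[where La="11989288 / 10000000" and Lb="2066205 / 1000000" and Ua="12891719 / 10000000"
        and Ub="1661965 / 1000000" and Uc="3560858 / 1000000" and Ud="762935 / 100000"];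
      simp add: exp_taylor_def power_divide)

lemma three_point_ends_6:
  "0 \<le> three_point_gap (101 / 200) (127 / 50)" "0 \<le> three_point_gap (101 / 200) (131 / 50)"
  by (rule three_point_node[where La="11989288 / 10000000" and Lb="2066205 / 1000000" and Ua="12891719 / 10000000"
      and Ub="1661965 / 1000000" and Uc="3560858 / 1000000" and Ud="762935 / 100000"];
      simp add: exp_taylor_def power_divide)
    (rule three_point_node[where La="12057995 / 10000000" and Lb="2113977 / 1000000" and Ua="12995266 / 10000000"
        and Ub="168877 / 100000" and Uc="3706178 / 1000000" and Ud="813359 / 100000"];
      simp add: exp_taylor_def power_divide)

lemma three_point_ends_7:
  "0 \<le> three_point_gap (47 / 100) (131 / 50)" "0 \<le> three_point_gap (47 / 100) (273 / 100)"
  by (rule three_point_node[where La="12057995 / 10000000" and Lb="2113977 / 1000000" and Ua="12995266 / 10000000"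
      and Ub="168877 / 100000" and Uc="3706178 / 1000000" and Ud="813359 / 100000"];
      simp add: exp_taylor_def power_divide)
    (rule three_point_node[where La="12153109 / 10000000" and Lb="2181471 / 1000000" and Ua="13139003 / 10000000"
        and Ub="1726334 / 1000000" and Uc="3915724 / 1000000" and Ud="888177 / 100000"];
      simp add: exp_taylor_def power_divide)

lemma three_point_ends_8:
  "0 \<le> three_point_gap (21 / 50) (273 / 100)" "0 \<le> three_point_gap (21 / 50) (29 / 10)"
  by (rule three_point_node[where La="12153109 / 10000000" and Lb="2181471 / 1000000" and Ua="13139003 / 10000000"
      and Ub="1726334 / 1000000" and Uc="3915724 / 1000000" and Ud="888177 / 100000"];
      simp add: exp_taylor_def power_divide)
    (rule three_point_node[where La="12301582 / 10000000" and Lb="2290044 / 1000000" and Ua="13364275 / 10000000"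
        and Ub="1786039 / 1000000" and Uc="4263118 / 1000000" and Ud="1017569 / 100000"];
      simp add: exp_taylor_def power_divide)

lemma three_point_ends_9:
  "0 \<le> three_point_gap (71 / 200) (29 / 10)" "0 \<le> three_point_gap (71 / 200) (63 / 20)"
  by (rule three_point_node[where La="12301582 / 10000000" and Lb="2290044 / 1000000" and Ua="13364275 / 10000000"
      and Ub="1786039 / 1000000" and Uc="4263118 / 1000000" and Ud="1017569 / 100000"];
      simp add: exp_taylor_def power_divide)
    (rule three_point_node[where La="12523227 / 10000000" and Lb="2459602 / 1000000" and Ua="13702594 / 10000000"
        and Ub="1877611 / 1000000" and Uc="4830745 / 1000000" and Ud="1242861 / 100000"];
      simp add: exp_taylor_def power_divide)

lemma three_point_ends_10:
  "0 \<le> three_point_gap (57 / 200) (63 / 20)" "0 \<le> three_point_gap (57 / 200) (87 / 25)"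
  by (rule three_point_node[where La="12523227 / 10000000" and Lb="2459602 / 1000000" and Ua="13702594 / 10000000"
      and Ub="1877611 / 1000000" and Uc="4830745 / 1000000" and Ud="1242861 / 100000"];
      simp add: exp_taylor_def power_divide)
    (rule three_point_node[where La="12821924 / 10000000" and Lb="2702793 / 1000000" and Ua="14162323 / 10000000"
        and Ub="2005714 / 1000000" and Uc="5697345 / 1000000" and Ud="1618364 / 100000"];
      simp add: exp_taylor_def power_divide)

lemma three_point_ends_11:
  "0 \<le> three_point_gap (11 / 50) (87 / 25)" "0 \<le> three_point_gap (11 / 50) (191 / 50)"
  by (rule three_point_node[where La="12821924 / 10000000" and Lb="2702793 / 1000000" and Ua="14162323 / 10000000"
      and Ub="2005714 / 1000000" and Uc="5697345 / 1000000" and Ud="1618364 / 100000"];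
      simp add: exp_taylor_def power_divide)
    (rule three_point_node[where La="13137125 / 10000000" and Lb="2978525 / 1000000" and Ua="14652122 / 10000000"
        and Ub="2146847 / 1000000" and Uc="6753093 / 1000000" and Ud="2124244 / 100000"];
      simp add: exp_taylor_def power_divide)

lemma three_point_ends_12:
  "0 \<le> three_point_gap (7 / 40) (191 / 50)" "0 \<le> three_point_gap (7 / 40) (83 / 20)"
  by (rule three_point_node[where La="13137125 / 10000000" and Lb="2978525 / 1000000" and Ua="14652122 / 10000000"
      and Ub="2146847 / 1000000" and Uc="6753093 / 1000000" and Ud="2124244 / 100000"];
      simp add: exp_taylor_def power_divide)
    (rule three_point_node[where La="13450464 / 10000000" and Lb="3273023 / 1000000" and Ua="15143708 / 10000000"
        and Ub="2293319 / 1000000" and Uc="7964549 / 1000000" and Ud="2766037 / 100000"];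
      simp add: exp_taylor_def power_divide)

lemma three_point_ends_13:
  "0 \<le> three_point_gap (29 / 200) (83 / 20)" "0 \<le> three_point_gap (29 / 200) (22 / 5)"
  by (rule three_point_node[where La="13450464 / 10000000" and Lb="3273023 / 1000000" and Ua="15143708 / 10000000"
      and Ub="2293319 / 1000000" and Uc="7964549 / 1000000" and Ud="2766037 / 100000"];
      simp add: exp_taylor_def power_divide)
    (rule three_point_node[where La="13692809 / 10000000" and Lb="3515363 / 1000000" and Ua="15527073 / 10000000"
        and Ub="24109 / 10000" and Uc="9025017 / 1000000" and Ud="3378445 / 100000"];
      simp add: exp_taylor_def power_divide)

text \<open>The intervals are stacked from the top: each of \<open>q0\<close> to \<open>q12\<close>
  covers everything from its own node up to 22/5 and passes what lies above its interval to the fact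
  proved before it.\<close>

lemma three_point_cover:
  assumes "37 / 25 \<le> \<kappa>\<^sup>2" "\<kappa>\<^sup>2 \<le> 22 / 5"
  shows "\<exists>n w b. bayes_bound \<kappa> (4 / 5 / (1 + \<kappa>\<^sup>2)) n w b"
proof -
  have q12: ?thesis if "83 / 20 \<le> \<kappa>\<^sup>2"
    by (rule three_point_interval[OF three_point_ends_13 that assms(2)]) simp_all
  have q11: ?thesis if "191 / 50 \<le> \<kappa>\<^sup>2"
    by (rule le_cases[of "\<kappa>\<^sup>2" "83 / 20"], erule three_point_interval[OF three_point_ends_12 that], simp, simp, simp, erule q12)
  have q10: ?thesis if "87 / 25 \<le> \<kappa>\<^sup>2"
    by (rule le_cases[of "\<kappa>\<^sup>2" "191 / 50"], erule three_point_interval[OF three_point_ends_11 that], simp, simp, simp, erule q11)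
  have q9: ?thesis if "63 / 20 \<le> \<kappa>\<^sup>2"
    by (rule le_cases[of "\<kappa>\<^sup>2" "87 / 25"], erule three_point_interval[OF three_point_ends_10 that], simp, simp, simp, erule q10)
  have q8: ?thesis if "29 / 10 \<le> \<kappa>\<^sup>2"
    by (rule le_cases[of "\<kappa>\<^sup>2" "63 / 20"], erule three_point_interval[OF three_point_ends_9 that], simp, simp, simp, erule q9)
  have q7: ?thesis if "273 / 100 \<le> \<kappa>\<^sup>2"
    by (rule le_cases[of "\<kappa>\<^sup>2" "29 / 10"], erule three_point_interval[OF three_point_ends_8 that], simp, simp, simp, erule q8)
  have q6: ?thesis if "131 / 50 \<le> \<kappa>\<^sup>2"
    by (rule le_cases[of "\<kappa>\<^sup>2" "273 / 100"], erule three_point_interval[OF three_point_ends_7 that], simp, simp, simp, erule q7)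
  have q5: ?thesis if "127 / 50 \<le> \<kappa>\<^sup>2"
    by (rule le_cases[of "\<kappa>\<^sup>2" "131 / 50"], erule three_point_interval[OF three_point_ends_6 that], simp, simp, simp, erule q6)
  have q4: ?thesis if "247 / 100 \<le> \<kappa>\<^sup>2"
    by (rule le_cases[of "\<kappa>\<^sup>2" "127 / 50"], erule three_point_interval[OF three_point_ends_5 that], simp, simp, simp, erule q5)
  have q3: ?thesis if "239 / 100 \<le> \<kappa>\<^sup>2"
    by (rule le_cases[of "\<kappa>\<^sup>2" "247 / 100"], erule three_point_interval[OF three_point_ends_4 that], simp, simp, simp, erule q4)
  have q2: ?thesis if "227 / 100 \<le> \<kappa>\<^sup>2"
    by (rule le_cases[of "\<kappa>\<^sup>2" "239 / 100"], erule three_point_interval[OF three_point_ends_3 that], simp, simp, simp, erule q3)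
  have q1: ?thesis if "41 / 20 \<le> \<kappa>\<^sup>2"
    by (rule le_cases[of "\<kappa>\<^sup>2" "227 / 100"], erule three_point_interval[OF three_point_ends_2 that], simp, simp, simp, erule q2)
  have q0: ?thesis if "37 / 25 \<le> \<kappa>\<^sup>2"
    by (rule le_cases[of "\<kappa>\<^sup>2" "41 / 20"], erule three_point_interval[OF three_point_ends_1 that], simp, simp, simp, erule q1)
  show ?thesis by (rule q0[OF assms(1)])
qed

section \<open>Rational certificates for four-point and squared-marginal priors\<close>

text \<open>All exponents are integer multiples of \<open>u / 32\<close>, \<open>5 u / 416\<close>
  or \<open>5 u / 288\<close>, so three rounded exponentials and their powers give every bound. The
  constant 1.6124515 is a lower bound of \<open>sqrt (13 / 5)\<close>.\<close>

lemma four_point_node: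
  assumes u: "0 < u" "u \<le> 32" and A: "0 < A" and c: "0 \<le> c"
    and L: "0 \<le> La" "La \<le> exp_taylor (u / 32)" "0 \<le> Lb" "Lb \<le> La ^ 5"
    and U: "exp_taylor (u / 32) + (u / 32) ^ 8 / 13440 \<le> Ua" "Ua ^ 4 \<le> Ub" "Ub ^ 4 \<le> Uc"
    and M: "0 \<le> Ma" "Ma \<le> exp_taylor (5 * u / 288)" "0 \<le> Mb" "Mb \<le> Ma ^ 5" "0 \<le> Mc" "Mc \<le> Mb ^ 5"
    and V: "exp_taylor (5 * u / 416) + (5 * u / 416) ^ 8 / 13440 \<le> Va" "Va ^ 4 \<le> Vb" "Vb ^ 4 \<le> Vc"
      "Vc ^ 2 * Vb \<le> Vd" "Vc ^ 3 * Va \<le> Ve" "Vd ^ 2 * Vb ^ 2 * Va \<le> Vf"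
    and num: "c * (Uc + A * Ua) * ((A\<^sup>2 / 16 + 1 + 17 * A\<^sup>2 / 32) * Vc + (A * (A\<^sup>2 / 16 + 1) + 17 * A / 32) * Va
         + 9 * A / 64 * Vf + 25 * A / 64 * Ve + 9 * A\<^sup>2 / 64 * Vd + 25 * A\<^sup>2 / 64 * Vb)
      \<le> (A\<^sup>2 / 16 + 1 + 9 * A / 32 * Mc + 25 * A / 32 * Lb)\<^sup>2 * (5 / 9) * (16124515 / 10000000)"
  shows "\<exists>n w b. bayes_bound (sqrt u) c n w b"
proof (rule four_point_bayes_bound[OF A])
  define y z v where "y = exp (u / 32)" and "z = exp (5 * u / 416)" and "v = exp (5 * u / 288)"
  have pos: "0 < y" "0 < z" "0 < v" by (simp_all add: y_def z_def v_def)
  have y: "La \<le> y" "y \<le> Ua" and z: "z \<le> Va" and v: "Ma \<le> v"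
    using exp_taylor_bounds[of "u / 32"] exp_taylor_bounds[of "5 * u / 416"] exp_taylor_bounds[of "5 * u / 288"] u L U(1) V(1) M(2)
    by (auto simp: y_def z_def v_def)
  have y4: "y ^ 4 \<le> Ub"
    using power_mono[OF y(2), of 4] U(2) pos by linarith
  have y16: "y ^ 16 \<le> Uc"
    using power_mono[OF y4, of 4] U(3) pos by (simp add: power_mult[symmetric])
  have z4: "z ^ 4 \<le> Vb"
    using power_mono[OF z, of 4] V(2) pos by linarith
  have z16: "z ^ 16 \<le> Vc"
    using power_mono[OF z4, of 4] V(3) pos by (simp add: power_mult[symmetric])
  have nn: "0 \<le> Ua" "0 \<le> Uc" "0 \<le> Va" "0 \<le> Vb" "0 \<le> Vc"
    using y(2) y16 z z4 z16 pos zero_less_power[of y 16] zero_less_power[of z 4] zero_less_power[of z 16] by linarith+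
  have "(z ^ 16) ^ 2 * z ^ 4 \<le> Vc ^ 2 * Vb"
    using z16 z4 nn pos by (intro mult_mono power_mono) auto
  hence z36: "z ^ 36 \<le> Vd"
    using V(4) by (simp add: power_mult[symmetric] power_add[symmetric])
  have nn': "0 \<le> Vd" using z36 zero_less_power[OF pos(2), of 36] by linarith
  have "(z ^ 16) ^ 3 * z \<le> Vc ^ 3 * Va"
    using z16 z nn pos by (intro mult_mono power_mono) auto
  hence z49: "z ^ 49 \<le> Ve"
    using V(5) power_add[of z 48 1] by (simp add: power_mult[symmetric])
  have "(z ^ 36) ^ 2 * (z ^ 4) ^ 2 * z \<le> Vd ^ 2 * Vb ^ 2 * Va"
    using z36 z4 z nn nn' pos by (intro mult_mono power_mono) auto
  hence z81: "z ^ 81 \<le> Vf"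
    using V(6) power_add[of z 80 1] by (simp add: power_mult[symmetric] power_add[symmetric])
  have "Mb \<le> v ^ 5"
    using power_mono[OF v M(1), of 5] M(4) by linarith
  hence v25: "Mc \<le> v ^ 25"
    using power_mono[of Mb "v ^ 5" 5] M(3,6) by (simp add: power_mult[symmetric])
  have y5: "Lb \<le> y ^ 5"
    using power_mono[OF y(1) L(1), of 5] L(4) by linarith
  have e: "exp (u / 2) = y ^ 16" "exp (u / 32) = y" "exp (5 * u / 26) = z ^ 16" "exp (5 * u / 416) = z"
    "exp (405 * u / 416) = z ^ 81" "exp (245 * u / 416) = z ^ 49" "exp (45 * u / 104) = z ^ 36" "exp (5 * u / 104) = z ^ 4"
    "exp (125 * u / 288) = v ^ 25" "exp (5 * u / 32) = y ^ 5"
    by (simp_all add: y_def z_def v_def exp_of_nat_mult[symmetric])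
  let ?I2 = "\<lambda>a b c d e f. (A\<^sup>2 / 16 + 1 + 17 * A\<^sup>2 / 32) * a + (A * (A\<^sup>2 / 16 + 1) + 17 * A / 32) * b
         + 9 * A / 64 * c + 25 * A / 64 * d + 9 * A\<^sup>2 / 64 * e + 25 * A\<^sup>2 / 64 * f"
  let ?N = "(A\<^sup>2 / 16 + 1 + 9 * A / 32 * v ^ 25 + 25 * A / 32 * y ^ 5)\<^sup>2 * (5 / 9)"
  have "c * (y ^ 16 + A * y) * ?I2 (z ^ 16) z (z ^ 81) (z ^ 49) (z ^ 36) (z ^ 4)
      \<le> c * (Uc + A * Ua) * ?I2 Vc Va Vf Ve Vd Vb"
    using y16 y z16 z z81 z49 z36 z4 A c nn pos
    by (intro mult_mono mult_left_mono add_mono) (auto intro!: add_nonneg_nonneg mult_nonneg_nonneg)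
  also note num
  also have "(A\<^sup>2 / 16 + 1 + 9 * A / 32 * Mc + 25 * A / 32 * Lb)\<^sup>2 * (5 / 9) * (16124515 / 10000000)
      \<le> ?N * (16124515 / 10000000)"
    using v25 y y5 A L M
    by (intro mult_right_mono power_mono add_mono mult_left_mono) (auto intro!: add_nonneg_nonneg mult_nonneg_nonneg)
  also have "\<dots> \<le> ?N * sqrt (13 / 5)"
    by (intro mult_left_mono real_le_rsqrt) (auto simp: power2_eq_square)
  finally have "c * (y ^ 16 + A * y) * ?I2 (z ^ 16) z (z ^ 81) (z ^ 49) (z ^ 36) (z ^ 4) / sqrt (13 / 5) \<le> ?N"
    by (simp add: pos_divide_le_eq)
  moreover have "(sqrt u)\<^sup>2 = u" using u by simp
  ultimately show "c * (exp ((sqrt u)\<^sup>2 / 2) + A * exp ((sqrt u)\<^sup>2 / 32))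
      * ((A\<^sup>2 / 16 + 1 + 17 * A\<^sup>2 / 32) * exp (5 * (sqrt u)\<^sup>2 / 26) + (A * (A\<^sup>2 / 16 + 1) + 17 * A / 32) * exp (5 * (sqrt u)\<^sup>2 / 416)
         + 9 * A / 64 * exp (405 * (sqrt u)\<^sup>2 / 416) + 25 * A / 64 * exp (245 * (sqrt u)\<^sup>2 / 416)
         + 9 * A\<^sup>2 / 64 * exp (45 * (sqrt u)\<^sup>2 / 104) + 25 * A\<^sup>2 / 64 * exp (5 * (sqrt u)\<^sup>2 / 104)) / sqrt (13 / 5)
      \<le> (A\<^sup>2 / 16 + 1 + 9 * A / 32 * exp (125 * (sqrt u)\<^sup>2 / 288) + 25 * A / 32 * exp (5 * (sqrt u)\<^sup>2 / 32))\<^sup>2 * (5 / 9)"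
    by (simp only: e)
qed

text \<open>Everything is a power of \<open>exp (u / 32)\<close>. The powers 1, 4 and 9 are bounded
  on both sides, because they occur in the normalisation of the prior and in the integral of
  \<open>l\<close>.\<close>

lemma squared_marginal_node:
  assumes u: "0 < u" "u \<le> 32" and p: "0 \<le> p" and q: "0 \<le> q" and c: "0 \<le> c"
    and L: "0 \<le> La" "La \<le> exp_taylor (u / 32)" "0 \<le> Lb" "Lb \<le> La ^ 4"
    and U: "exp_taylor (u / 32) + (u / 32) ^ 8 / 13440 \<le> Ua" "Ua ^ 4 \<le> Ub" "Ub ^ 4 \<le> Uc"
    and num: "c * (p\<^sup>2 + q\<^sup>2 / 2 + 1 / 2 + (2 * p * q + q) * Ua + (2 * p + q\<^sup>2 / 2) * Ub + q * (Ub ^ 2 * Ua) + Uc / 2)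
      \<le> 1 / 2 + q\<^sup>2 / 8 + (p * q / 8 + 9 * q / 16) * La + p / 2 * Lb + q / 16 * (Lb ^ 2 * La)"
  shows "\<exists>n w b. bayes_bound (sqrt u) c n w b"
proof (rule squared_marginal_bayes_bound[OF p q])
  define y where "y = exp (u / 32)"
  have y: "0 < y" "La \<le> y" "y \<le> Ua"
    using exp_taylor_bounds[of "u / 32"] u L U by (auto simp: y_def)
  have y4: "y ^ 4 \<le> Ub" "Lb \<le> y ^ 4"
    using power_mono[OF y(3), of 4] power_mono[OF y(2), of 4] U(2) L y(1) by linarith+
  have y16: "y ^ 16 \<le> Uc"
    using power_mono[OF y4(1), of 4] U(3) y(1) by (simp add: power_mult[symmetric])
  have y9: "y ^ 9 = (y ^ 4) ^ 2 * y"
    using power_add[of y 8 1] by (simp add: power_mult[symmetric])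
  have Ub: "0 \<le> Ub" using y4(1) zero_less_power[OF y(1), of 4] by linarith
  have y9': "y ^ 9 \<le> Ub ^ 2 * Ua" "Lb ^ 2 * La \<le> y ^ 9"
    unfolding y9 using y y4 L Ub by (intro mult_mono power_mono; simp)+
  have "c * (p\<^sup>2 + q\<^sup>2 / 2 + 1 / 2 + (2 * p * q + q) * y + (2 * p + q\<^sup>2 / 2) * y ^ 4 + q * y ^ 9 + y ^ 16 / 2)
     \<le> c * (p\<^sup>2 + q\<^sup>2 / 2 + 1 / 2 + (2 * p * q + q) * Ua + (2 * p + q\<^sup>2 / 2) * Ub + q * (Ub ^ 2 * Ua) + Uc / 2)"
    using y y4 y9' y16 c p q by (intro mult_left_mono add_mono divide_right_mono) auto
  also note num
  also have "1 / 2 + q\<^sup>2 / 8 + (p * q / 8 + 9 * q / 16) * La + p / 2 * Lb + q / 16 * (Lb ^ 2 * La)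
     \<le> 1 / 2 + q\<^sup>2 / 8 + (p * q / 8 + 9 * q / 16) * y + p / 2 * y ^ 4 + q / 16 * y ^ 9"
    using y y4 y9' p q by (intro add_mono mult_left_mono) auto
  finally show "c * (p\<^sup>2 + q\<^sup>2 / 2 + 1 / 2 + (2 * p * q + q) * exp ((sqrt u)\<^sup>2 / 32)
      + (2 * p + q\<^sup>2 / 2) * exp ((sqrt u)\<^sup>2 / 32) ^ 4 + q * exp ((sqrt u)\<^sup>2 / 32) ^ 9 + exp ((sqrt u)\<^sup>2 / 32) ^ 16 / 2)
      \<le> 1 / 2 + q\<^sup>2 / 8 + (p * q / 8 + 9 * q / 16) * exp ((sqrt u)\<^sup>2 / 32) + p / 2 * exp ((sqrt u)\<^sup>2 / 32) ^ 4
      + q / 16 * exp ((sqrt u)\<^sup>2 / 32) ^ 9"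
    using u by (simp add: y_def)
qed

section \<open>Range of the four-point priors\<close>

text \<open>The prior is built at the left end of a grid interval, and the constant is the one
  demanded at the right end. The steps lengthen from 0.08 to 0.6 as \<open>\<kappa>\<^sup>2\<close>
  moves away from the critical region near 2.6, and the inner mass \<open>A\<close> grows along the
  grid.\<close>

lemma four_point_bound_1: "\<exists>n w b. bayes_bound (sqrt (22 / 5)) (4 / 5 * (112 / 25) / ((1 + 112 / 25) * (22 / 5))) n w b"
  by (rule four_point_node[where A="31 / 4" and La="11474017 / 10000000" and Lb="1988737 / 1000000"
      and Mc="675119 / 100000" and Ua="11474018 / 10000000" and Ub="1733254 / 1000000" and Uc="902504 / 100000"
      and Ma="10793822 / 10000000" and Mb="146513 / 100000" and Va="1054308 / 1000000" and Vb="1235578 / 1000000"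
      and Vc="233067 / 100000" and Vd="671169 / 100000" and Ve="133479 / 10000" and Vf="72506 / 1000"];
      simp add: exp_taylor_def power_divide)

lemma four_point_bound_2: "\<exists>n w b. bayes_bound (sqrt (112 / 25)) (4 / 5 * (229 / 50) / ((1 + 229 / 50) * (112 / 25))) n w b"
  by (rule four_point_node[where A="8" and La="11502737 / 10000000" and Lb="2013751 / 1000000"
      and Mc="698973 / 100000" and Ua="11502738 / 10000000" and Ub="1750673 / 1000000" and Uc="939335 / 100000"
      and Ma="10808824 / 10000000" and Mb="147534 / 100000" and Va="10553223 / 10000000" and Vb="124034 / 100000"
      and Vc="2366808 / 1000000" and Vd="694812 / 100000" and Ve="139919 / 10000" and Vf="7838 / 100"];
      simp add: exp_taylor_def power_divide)

lemma four_point_bound_3: "\<exists>n w b. bayes_bound (sqrt (229 / 50)) (4 / 5 * (471 / 100) / ((1 + 471 / 100) * (229 / 50))) n w b"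
  by (rule four_point_node[where A="17 / 2" and La="1153874 / 1000000" and Lb="2045464 / 1000000"
      and Mc="729977 / 100000" and Ua="11538741 / 10000000" and Ub="1772694 / 1000000" and Uc="987496 / 100000"
      and Ma="10827605 / 10000000" and Mb="1488202 / 1000000" and Va="10565915 / 10000000" and Vb="1246317 / 1000000"
      and Vc="241276 / 100000" and Vd="725533 / 100000" and Ve="148406 / 10000" and Vf="86393 / 1000"];
      simp add: exp_taylor_def power_divide)

lemma four_point_bound_4: "\<exists>n w b. bayes_bound (sqrt (471 / 100)) (4 / 5 * (122 / 25) / ((1 + 122 / 25) * (471 / 100))) n w b"
  by (rule four_point_node[where A="37 / 4" and La="11585711 / 10000000" and Lb="2087437 / 1000000"
      and Mc="772349 / 100000" and Ua="11585712 / 10000000" and Ub="1801735 / 1000000" and Uc="1053814 / 100000"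
      and Ma="1085207 / 1000000" and Mb="1505091 / 1000000" and Va="10582437 / 10000000" and Vb="1254131 / 1000000"
      and Vc="2473841 / 1000000" and Vd="767515 / 100000" and Ve="160215 / 10000" and Vf="9805 / 100"];
      simp add: exp_taylor_def power_divide)

lemma four_point_bound_5: "\<exists>n w b. bayes_bound (sqrt (122 / 25)) (4 / 5 * (51 / 10) / ((1 + 51 / 10) * (122 / 25))) n w b"
  by (rule four_point_node[where A="41 / 4" and La="11647424 / 10000000" and Lb="2143628 / 1000000"
      and Mc="831491 / 100000" and Ua="11647425 / 10000000" and Ub="1840432 / 1000000" and Uc="1147306 / 100000"
      and Ma="10884146 / 10000000" and Mb="1527466 / 1000000" and Va="10604082 / 10000000" and Vb="1264423 / 1000000"
      and Vc="2556052 / 1000000" and Vd="826099 / 100000" and Ve="177086 / 10000" and Vf="115697 / 1000"];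
      simp add: exp_taylor_def power_divide)

lemma four_point_bound_6: "\<exists>n w b. bayes_bound (sqrt (51 / 10)) (4 / 5 * (27 / 5) / ((1 + 27 / 5) * (51 / 10))) n w b"
  by (rule four_point_node[where A="47 / 4" and La="11727776 / 10000000" and Lb="2218596 / 1000000"
      and Mc="914802 / 100000" and Ua="11727777 / 10000000" and Ub="1891746 / 1000000" and Uc="1280712 / 100000"
      and Ma="10925797 / 10000000" and Mb="1556917 / 1000000" and Va="10632158 / 10000000" and Vb="1277868 / 1000000"
      and Vc="2666515 / 1000000" and Vd="908603 / 100000" and Ve="201583 / 10000" and Vf="143332 / 1000"];
      simp add: exp_taylor_def power_divide)

lemma four_point_bound_7: "\<exists>n w b. bayes_bound (sqrt (27 / 5)) (4 / 5 * (29 / 5) / ((1 + 29 / 5) * (27 / 5))) n w b"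
  by (rule four_point_node[where A="14" and La="11838241 / 10000000" and Lb="2325069 / 1000000"
      and Mc="1042022 / 100000" and Ua="11838242 / 10000000" and Ub="1964034 / 1000000" and Uc="1487977 / 100000"
      and Ma="10982851 / 10000000" and Mb="1597995 / 1000000" and Va="10670565 / 10000000" and Vb="1296432 / 1000000"
      and Vc="2824874 / 1000000" and Vd="1034542 / 100000" and Ve="240539 / 10000" and Vf="191948 / 1000"];
      simp add: exp_taylor_def power_divide)

lemma four_point_bound_8: "\<exists>n w b. bayes_bound (sqrt (29 / 5)) (4 / 5 * (63 / 10) / ((1 + 63 / 10) * (29 / 5))) n w b"
  by (rule four_point_node[where A="71 / 4" and La="11987148 / 10000000" and Lb="2475023 / 1000000"
      and Mc="123958 / 10000" and Ua="11987149 / 10000000" and Ub="2064732 / 1000000" and Uc="1817418 / 100000"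
      and Ma="11059386 / 10000000" and Mb="1654455 / 1000000" and Va="10721989 / 10000000" and Vb="1321605 / 1000000"
      and Vc="3050751 / 1000000" and Vd="1230029 / 100000" and Ve="304436 / 10000" and Vf="283341 / 1000"];
      simp add: exp_taylor_def power_divide)

lemma four_point_bound_9: "\<exists>n w b. bayes_bound (sqrt (63 / 10)) (4 / 5 * (69 / 10) / ((1 + 69 / 10) * (63 / 10))) n w b"
  by (rule four_point_node[where A="24" and La="12175918 / 10000000" and Lb="2676138 / 1000000"
      and Mc="1540006 / 100000" and Ua="12175919 / 10000000" and Ub="2197896 / 1000000" and Uc="2333612 / 100000"
      and Ma="11155806 / 10000000" and Mb="1727844 / 1000000" and Va="10786618 / 10000000" and Vb="1353759 / 1000000"
      and Vc="3358656 / 1000000" and Vd="1527118 / 100000" and Ve="408679 / 10000" and Vf="461014 / 1000"];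
      simp add: exp_taylor_def power_divide)

lemma four_point_cover:
  assumes "22 / 5 \<le> \<kappa>\<^sup>2" "\<kappa>\<^sup>2 \<le> 69 / 10" "0 \<le> \<kappa>"
  shows "\<exists>n w b. bayes_bound \<kappa> (4 / 5 / (1 + \<kappa>\<^sup>2)) n w b"
proof -
  have q8: ?thesis if "63 / 10 \<le> \<kappa>\<^sup>2"
    by (rule bayes_bound_extend[OF four_point_bound_9 that assms(2,3)]) simp
  have q7: ?thesis if "29 / 5 \<le> \<kappa>\<^sup>2"
    by (rule le_cases[of "\<kappa>\<^sup>2" "63 / 10"], erule bayes_bound_extend[OF four_point_bound_8 that _ assms(3)], simp, erule q8)
  have q6: ?thesis if "27 / 5 \<le> \<kappa>\<^sup>2"
    by (rule le_cases[of "\<kappa>\<^sup>2" "29 / 5"], erule bayes_bound_extend[OF four_point_bound_7 that _ assms(3)], simp, erule q7)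
  have q5: ?thesis if "51 / 10 \<le> \<kappa>\<^sup>2"
    by (rule le_cases[of "\<kappa>\<^sup>2" "27 / 5"], erule bayes_bound_extend[OF four_point_bound_6 that _ assms(3)], simp, erule q6)
  have q4: ?thesis if "122 / 25 \<le> \<kappa>\<^sup>2"
    by (rule le_cases[of "\<kappa>\<^sup>2" "51 / 10"], erule bayes_bound_extend[OF four_point_bound_5 that _ assms(3)], simp, erule q5)
  have q3: ?thesis if "471 / 100 \<le> \<kappa>\<^sup>2"
    by (rule le_cases[of "\<kappa>\<^sup>2" "122 / 25"], erule bayes_bound_extend[OF four_point_bound_4 that _ assms(3)], simp, erule q4)
  have q2: ?thesis if "229 / 50 \<le> \<kappa>\<^sup>2"
    by (rule le_cases[of "\<kappa>\<^sup>2" "471 / 100"], erule bayes_bound_extend[OF four_point_bound_3 that _ assms(3)], simp, erule q3)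
  have q1: ?thesis if "112 / 25 \<le> \<kappa>\<^sup>2"
    by (rule le_cases[of "\<kappa>\<^sup>2" "229 / 50"], erule bayes_bound_extend[OF four_point_bound_2 that _ assms(3)], simp, erule q2)
  have q0: ?thesis if "22 / 5 \<le> \<kappa>\<^sup>2"
    by (rule le_cases[of "\<kappa>\<^sup>2" "112 / 25"], erule bayes_bound_extend[OF four_point_bound_1 that _ assms(3)], simp, erule q1)
  show ?thesis by (rule q0[OF assms(1)])
qed

section \<open>Range of the five- and nine-point priors\<close>

text \<open>With \<open>q = 0\<close> the masses at odd multiples of 1/4 vanish and five points
  remain; from \<open>\<kappa>\<^sup>2 = 12\<close> on all nine are used.\<close>

lemma squared_marginal_bound_1: "\<exists>n w b. bayes_bound (sqrt (69 / 10)) (4 / 5 * (79 / 10) / ((1 + 79 / 10) * (69 / 10))) n w b"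
  by (rule squared_marginal_node[where p="7 / 2" and q="0" and La="1240637 / 1000000" and Lb="236907 / 100000"
      and Ua="1240638 / 1000000" and Ub="236909 / 100000" and Uc="31502 / 1000"];
      simp add: exp_taylor_def power_divide)

lemma squared_marginal_bound_2: "\<exists>n w b. bayes_bound (sqrt (79 / 10)) (4 / 5 * (10) / ((1 + 10) * (79 / 10))) n w b"
  by (rule squared_marginal_node[where p="9 / 2" and q="0" and La="1280019 / 1000000" and Lb="268451 / 100000"
      and Ua="128002 / 100000" and Ub="268453 / 100000" and Uc="51937 / 1000"];
      simp add: exp_taylor_def power_divide)

lemma squared_marginal_bound_3: "\<exists>n w b. bayes_bound (sqrt (10)) (4 / 5 * (12) / ((1 + 12) * (10))) n w b"
  by (rule squared_marginal_node[where p="8" and q="0" and La="1366837 / 1000000" and Lb="349033 / 100000"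
      and Ua="1366838 / 1000000" and Ub="349035 / 100000" and Uc="148415 / 1000"];
      simp add: exp_taylor_def power_divide)

lemma squared_marginal_bound_4: "\<exists>n w b. bayes_bound (sqrt (12)) (4 / 5 * (16) / ((1 + 16) * (12))) n w b"
  by (rule squared_marginal_node[where p="13" and q="6" and La="1454991 / 1000000" and Lb="448168 / 100000"
      and Ua="1454992 / 1000000" and Ub="44817 / 10000" and Uc="403433 / 1000"];
      simp add: exp_taylor_def power_divide)

lemma squared_marginal_cover:
  assumes "69 / 10 \<le> \<kappa>\<^sup>2" "\<kappa>\<^sup>2 \<le> 16" "0 \<le> \<kappa>"
  shows "\<exists>n w b. bayes_bound \<kappa> (4 / 5 / (1 + \<kappa>\<^sup>2)) n w b"
proof -
  have q3: ?thesis if "12 \<le> \<kappa>\<^sup>2"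
    by (rule bayes_bound_extend[OF squared_marginal_bound_4 that assms(2,3)]) simp
  have q2: ?thesis if "10 \<le> \<kappa>\<^sup>2"
    by (rule le_cases[of "\<kappa>\<^sup>2" "12"], erule bayes_bound_extend[OF squared_marginal_bound_3 that _ assms(3)], simp, erule q3)
  have q1: ?thesis if "79 / 10 \<le> \<kappa>\<^sup>2"
    by (rule le_cases[of "\<kappa>\<^sup>2" "10"], erule bayes_bound_extend[OF squared_marginal_bound_2 that _ assms(3)], simp, erule q2)
  have q0: ?thesis if "69 / 10 \<le> \<kappa>\<^sup>2"
    by (rule le_cases[of "\<kappa>\<^sup>2" "79 / 10"], erule bayes_bound_extend[OF squared_marginal_bound_1 that _ assms(3)], simp, erule q1)
  show ?thesis by (rule q0[OF assms(1)])
qed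

lemma squared_marginal_bound_5: "\<exists>n w b. bayes_bound (sqrt 16) (4 / 5 / 16) n w b"
  by (rule squared_marginal_node[where p=37 and q=20 and La="1648721 / 1000000" and Lb="738905 / 100000"
      and Ua="1648722 / 1000000" and Ub="738907 / 100000" and Uc="2980981 / 1000"];
      simp add: exp_taylor_def power_divide)

text \<open>One prior serves an unbounded range, because in signal units its Bayes risk is unchanged
  by rescaling while \<open>\<kappa>\<^sup>2 / (1 + \<kappa>\<^sup>2)\<close> stays below 1. The
  division by 16 converts from signal units to locations in the unit interval.\<close>

lemma squared_marginal_tail:
  assumes "16 \<le> \<kappa>\<^sup>2" "0 \<le> \<kappa>"
  shows "\<exists>n w b. bayes_bound \<kappa> (4 / 5 / (1 + \<kappa>\<^sup>2)) n w b"
proof -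
  have "sqrt 16 = (4::real)" by (rule real_sqrt_unique) auto
  then obtain n w b where bb: "bayes_bound 4 (4 / 5 / 16) n w b"
    using squared_marginal_bound_5 by metis
  have "4 \<le> \<kappa>" by (rule power2_le_imp_le) (use assms in simp_all)
  note scaled = bayes_bound_rescale[OF bb zero_less_numeral this]
  have "4 / 5 / (1 + \<kappa>\<^sup>2) \<le> (4 / \<kappa>)\<^sup>2 * (4 / 5 / 16)"
  proof -
    have "4 / 5 / (1 + \<kappa>\<^sup>2) \<le> 4 / 5 / \<kappa>\<^sup>2"
    proof (rule divide_left_mono)
      have "0 < \<kappa>\<^sup>2" using assms(1) by linarith
      thus "0 < (1 + \<kappa>\<^sup>2) * \<kappa>\<^sup>2" by (intro mult_pos_pos add_pos_pos) auto
    qed auto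
    thus ?thesis by (simp add: power_divide)
  qed
  from bayes_bound_mono[OF scaled this] show ?thesis by (intro exI)
qed

theorem bounded_normal_mean_bayes_bound:
  assumes "0 \<le> \<kappa>"
  shows "\<exists>n w b. bayes_bound \<kappa> (4 / 5 / (1 + \<kappa>\<^sup>2)) n w b"
proof -
  consider "\<kappa>\<^sup>2 \<le> 37 / 25" | "37 / 25 \<le> \<kappa>\<^sup>2" "\<kappa>\<^sup>2 \<le> 22 / 5" | "22 / 5 \<le> \<kappa>\<^sup>2" "\<kappa>\<^sup>2 \<le> 69 / 10"
    | "69 / 10 \<le> \<kappa>\<^sup>2" "\<kappa>\<^sup>2 \<le> 16" | "16 \<le> \<kappa>\<^sup>2"
    by linarith
  thus ?thesis
  proof cases
    case 1 show ?thesis by (rule two_point_cover[OF 1])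
  next
    case 2 show ?thesis by (rule three_point_cover[OF 2])
  next
    case 3 show ?thesis by (rule four_point_cover[OF 3 assms])
  next
    case 4 show ?thesis by (rule squared_marginal_cover[OF 4 assms])
  next
    case 5 show ?thesis by (rule squared_marginal_tail[OF 5 assms])
  qed
qed

section \<open>Symmetric matrices\<close>

lemma sym_matrix_inner:
  fixes M :: "real^'d^'d"
  assumes "transpose M = M"
  shows "x \<bullet> (M *v y) = (M *v x) \<bullet> y"
  by (metis assms dot_lmul_matrix transpose_matrix_vector)

text \<open>The eigenvector is a maximiser of the Rayleigh quotient on the unit sphere of \<open>V\<close>.\<close>

lemma symmetric_matrix_eigenvector:
  fixes M :: "real^'d^'d"
  assumes M: "transpose M = M" and V: "subspace V" "V \<noteq> {0}" and inv: "\<And>x. x \<in> V \<Longrightarrow> M *v x \<in> V"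
  obtains v m where "v \<in> V" "norm v = 1" "M *v v = m *\<^sub>R v"
proof -
  let ?K = "V \<inter> sphere 0 1"
  have K: "compact ?K"
    using V(1) by (simp add: closed_subspace closed_Int_compact)
  have nonempty: "?K \<noteq> {}"
  proof -
    obtain x where "x \<in> V" "x \<noteq> 0" using V subspace_0 by blast
    hence "x /\<^sub>R norm x \<in> ?K" using V(1) by (simp add: subspace_scale)
    thus ?thesis by blast
  qed
  have cont: "continuous_on ?K (\<lambda>x. x \<bullet> (M *v x))"
    by (intro continuous_intros matrix_vector_mult_linear_continuous_on)
  obtain v where v: "v \<in> ?K" and max: "\<And>x. x \<in> ?K \<Longrightarrow> x \<bullet> (M *v x) \<le> v \<bullet> (M *v v)"
    using continuous_attains_sup[OF K nonempty cont] by (metis (no_types, lifting))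
  define m where "m = v \<bullet> (M *v v)"
  define w where "w = m *\<^sub>R v - M *v v"
  have vV: "v \<in> V" "v \<bullet> v = 1" using v by (auto simp: dot_square_norm)
  have le: "x \<bullet> (M *v x) \<le> m * (x \<bullet> x)" if "x \<in> V" for x
  proof (cases "x = 0")
    case False
    have "(x /\<^sub>R norm x) \<bullet> (M *v (x /\<^sub>R norm x)) \<le> m"
      unfolding m_def using that False V(1) by (intro max) (simp add: subspace_scale)
    thus ?thesis
      using False by (simp add: matrix_vector_mult_scaleR divide_simps dot_square_norm power2_eq_square)
  qed simp
  have wV: "w \<in> V" unfolding w_def using vV inv V(1) by (simp add: subspace_diff subspace_scale)
  have "w = 0"
  proof (rule ccontr)
    assume "w \<noteq> 0"
    hence pos: "0 < w \<bullet> w" by simp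
    define q where "q = m * (w \<bullet> w) - w \<bullet> (M *v w)"
    have "0 \<le> q" using le[OF wV] by (simp add: q_def)
    \<comment> \<open>Exact expansion of the nonnegative defect
      \<open>m (x \<bullet> x) - x \<bullet> (M x)\<close> at \<open>v - e w\<close>; its linear
      term is negative for \<open>e > 0\<close> unless the residual \<open>w\<close>
      vanishes.\<close>
    have key: "0 \<le> - 2 * e * (w \<bullet> w) + e\<^sup>2 * q" for e
    proof -
      have "v - e *\<^sub>R w \<in> V" using vV wV V(1) by (simp add: subspace_diff subspace_scale)
      from le[OF this] have "0 \<le> m * ((v - e *\<^sub>R w) \<bullet> (v - e *\<^sub>R w)) - (v - e *\<^sub>R w) \<bullet> (M *v (v - e *\<^sub>R w))"
        by simp
      also have "\<dots> = - 2 * e * (m * (w \<bullet> v) - w \<bullet> (M *v v)) + e\<^sup>2 * q"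
        using sym_matrix_inner[OF M, of v w] vV(2)
        by (simp add: matrix_vector_mult_diff_distrib matrix_vector_mult_scaleR inner_diff_left inner_diff_right
            inner_commute m_def[symmetric] q_def algebra_simps power2_eq_square)
      also have "m * (w \<bullet> v) - w \<bullet> (M *v v) = w \<bullet> w"
        by (simp add: w_def inner_diff_right)
      finally show ?thesis .
    qed
    \<comment> \<open>Any small positive step gives a contradiction; the summand 1 keeps the
      denominator positive when \<open>q = 0\<close>.\<close>
    define e where "e = (w \<bullet> w) / (q + 1)"
    have e: "0 < e" "e * (q + 1) = w \<bullet> w" using pos \<open>0 \<le> q\<close> by (auto simp: e_def)
    have "- 2 * e * (w \<bullet> w) + e\<^sup>2 * q = - e * (w \<bullet> w) - e\<^sup>2"
      unfolding e(2)[symmetric] by (simp add: algebra_simps power2_eq_square)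
    also have "\<dots> < 0" using mult_pos_pos[OF e(1) pos] zero_le_power2[of e] by linarith
    finally show False using key[of e] by simp
  qed
  thus ?thesis using that[of v m] v by (simp add: w_def)
qed

section \<open>Common eigenbases\<close>

definition orthonormal_basis :: "'a::euclidean_space set \<Rightarrow> bool" where
  "orthonormal_basis B \<longleftrightarrow> finite B \<and> pairwise orthogonal B \<and> (\<forall>b\<in>B. norm b = 1) \<and> span B = UNIV"

text \<open>Take an orthonormal set of common eigenvectors of maximal size. Its orthogonal
  complement is invariant under both matrices. If it were nonzero, an eigenspace of \<open>M\<close>
  inside it would be preserved by \<open>N\<close> because the matrices commute, and would contain a
  further common eigenvector. With \<open>M = N\<close> this is the spectral theorem.\<close>

lemma commuting_symmetric_eigenbasis:
  fixes M N :: "real^'d^'d"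
  assumes M: "transpose M = M" and N: "transpose N = N" and comm: "M ** N = N ** M"
  obtains B m n where "orthonormal_basis B"
    and "\<And>b. b \<in> B \<Longrightarrow> M *v b = m b *\<^sub>R b" and "\<And>b. b \<in> B \<Longrightarrow> N *v b = n b *\<^sub>R b"
proof -
  define P where "P B \<longleftrightarrow> finite B \<and> pairwise orthogonal B \<and>
    (\<forall>b\<in>B. norm b = 1 \<and> (\<exists>m. M *v b = m *\<^sub>R b) \<and> (\<exists>n. N *v b = n *\<^sub>R b))" for B
  have card_le: "card B \<le> DIM(real^'d)" if "P B" for B
  proof -
    have "independent B"
      using that by (intro pairwise_orthogonal_independent) (auto simp: P_def)
    thus ?thesis using that independent_bound by blast
  qed
  have "P {}" by (simp add: P_def)
  have "\<exists>B. P B \<and> (\<forall>B'. P B' \<longrightarrow> card B' \<le> card B)"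
    by (rule ex_has_greatest_nat[where P=P and k="{}" and f=card and b="Suc (DIM(real^'d))"])
       (use card_le \<open>P {}\<close> in \<open>auto simp: less_Suc_eq_le\<close>)
  then obtain B where PB: "P B" and max: "\<And>B'. P B' \<Longrightarrow> card B' \<le> card B" by blast
  define V where "V = {x. \<forall>b\<in>B. b \<bullet> x = 0}"
  have V: "subspace V"
    unfolding V_def by (auto simp: subspace_def inner_add_right)
  have inv: "A *v x \<in> V" if "transpose A = A" "\<forall>b\<in>B. \<exists>m. A *v b = m *\<^sub>R b" "x \<in> V" for A x
    using that sym_matrix_inner[OF that(1)] unfolding V_def by fastforce
  have "V = {0}"
  proof (rule ccontr)
    assume "V \<noteq> {0}"
    obtain v m where v: "v \<in> V" "norm v = 1" "M *v v = m *\<^sub>R v"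
      using symmetric_matrix_eigenvector[OF M V \<open>V \<noteq> {0}\<close>] inv[OF M] PB unfolding P_def by metis
    define V' where "V' = {x\<in>V. M *v x = m *\<^sub>R x}"
    have V': "subspace V'"
      using V unfolding V'_def subspace_def
      by (auto simp: matrix_vector_right_distrib matrix_vector_mult_scaleR scaleR_add_right)
    have "v \<in> V'" "v \<noteq> 0" using v by (auto simp: V'_def)
    hence "V' \<noteq> {0}" by blast
    have "N *v x \<in> V'" if "x \<in> V'" for x
    proof -
      have "M *v (N *v x) = N *v (M *v x)"
        by (simp add: matrix_vector_mul_assoc comm)
      moreover have "N *v x \<in> V"
        using that PB by (intro inv[OF N]) (auto simp: V'_def P_def)
      ultimately show ?thesis
        using that by (simp add: V'_def matrix_vector_mult_scaleR)
    qed
    then obtain w n where w: "w \<in> V'" "norm w = 1" "N *v w = n *\<^sub>R w"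
      using symmetric_matrix_eigenvector[OF N V' \<open>V' \<noteq> {0}\<close>] by metis
    hence wV: "\<And>b. b \<in> B \<Longrightarrow> b \<bullet> w = 0" "M *v w = m *\<^sub>R w" by (auto simp: V'_def V_def)
    have "w \<notin> B" using wV(1)[of w] w(2) by (auto simp: dot_square_norm)
    have "P (insert w B)"
      using PB w wV unfolding P_def by (auto simp: pairwise_insert orthogonal_def inner_commute)
    from max[OF this] show False using \<open>w \<notin> B\<close> PB by (simp add: P_def)
  qed
  have "x \<in> span B" for x
  proof -
    obtain y z where yz: "y \<in> span B" "\<And>w. w \<in> span B \<Longrightarrow> orthogonal z w" "x = y + z"
      using orthogonal_subspace_decomp_exists[of B x] by metis
    have "z \<in> V" using yz(2) span_base by (auto simp: V_def orthogonal_def inner_commute)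
    thus ?thesis using \<open>V = {0}\<close> yz by simp
  qed
  hence "orthonormal_basis B" using PB by (auto simp: P_def orthonormal_basis_def)
  moreover have "\<exists>m n. \<forall>b\<in>B. M *v b = m b *\<^sub>R b \<and> N *v b = n b *\<^sub>R b"
    using PB unfolding P_def by (meson bchoice)
  ultimately show ?thesis using that by blast
qed

section \<open>Coordinates and diagonal matrices in an orthonormal basis\<close>

context
  fixes B :: "(real^'d) set"
  assumes B: "orthonormal_basis B"
begin

lemma orthonormal_basis_inner:
  "b \<in> B \<Longrightarrow> c \<in> B \<Longrightarrow> b \<bullet> c = (if b = c then 1 else 0)"
  using B unfolding orthonormal_basis_def pairwise_def orthogonal_def by (auto simp: dot_square_norm)

lemma orthonormal_basis_finite: "finite B"
  using B by (simp add: orthonormal_basis_def)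

lemma orthonormal_basis_expansion: "(\<Sum>b\<in>B. (x \<bullet> b) *\<^sub>R b) = x"
  using B by (intro orthonormal_basis_expand) (auto simp: orthonormal_basis_def)

lemma orthonormal_basis_inner_sum: "x \<bullet> y = (\<Sum>b\<in>B. (x \<bullet> b) * (y \<bullet> b))"
  by (subst orthonormal_basis_expansion[of y, symmetric]) (simp add: inner_sum_right mult_ac)

lemma orthonormal_basis_norm_square: "(norm x)\<^sup>2 = (\<Sum>b\<in>B. (x \<bullet> b)\<^sup>2)"
  using orthonormal_basis_inner_sum[of x x] by (simp add: dot_square_norm power2_eq_square)

lemma matrix_eq_on_basis:
  fixes M N :: "real^'d^'m"
  assumes "\<And>b. b \<in> B \<Longrightarrow> M *v b = N *v b"
  shows "M = N"
proof -
  have "M *v x = N *v x" for x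
  proof -
    have "M *v (\<Sum>b\<in>B. (x \<bullet> b) *\<^sub>R b) = N *v (\<Sum>b\<in>B. (x \<bullet> b) *\<^sub>R b)"
      by (simp add: linear_sum[OF matrix_vector_mul_linear] matrix_vector_mult_scaleR assms)
    thus ?thesis by (simp add: orthonormal_basis_expansion)
  qed
  thus ?thesis by (simp add: matrix_eq)
qed

text \<open>The projections onto the lines through the basis vectors, weighted by \<open>f\<close>:
  the matrix that is diagonal in \<open>B\<close> with eigenvalues \<open>f\<close>.\<close>

definition eigen_matrix :: "(real^'d \<Rightarrow> real) \<Rightarrow> real^'d^'d" where
  "eigen_matrix f = (\<chi> i j. \<Sum>b\<in>B. f b * (b $ i) * (b $ j))"

lemma eigen_matrix_mult: "eigen_matrix f *v x = (\<Sum>b\<in>B. (f b * (x \<bullet> b)) *\<^sub>R b)"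
  unfolding eigen_matrix_def vec_eq_iff
  by (simp add: matrix_vector_mult_def inner_vec_def sum_distrib_left sum_distrib_right mult_ac)
     (intro allI sum.swap)

lemma eigen_matrix_basis: "b \<in> B \<Longrightarrow> eigen_matrix f *v b = f b *\<^sub>R b"
  by (simp add: eigen_matrix_mult orthonormal_basis_inner if_distrib[of "\<lambda>x. x *\<^sub>R _"] if_distrib[of "(*) _"]
      sum.delta' orthonormal_basis_finite cong: if_cong)

lemma transpose_eigen_matrix: "transpose (eigen_matrix f) = eigen_matrix f"
  by (simp add: eigen_matrix_def transpose_def vec_eq_iff mult_ac)

lemma eigen_matrix_inner: "x \<bullet> (eigen_matrix f *v x) = (\<Sum>b\<in>B. f b * (x \<bullet> b)\<^sup>2)"
  by (simp add: eigen_matrix_mult inner_sum_right power2_eq_square mult_ac)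

lemma trace_eigen_matrix: "trace (eigen_matrix f) = (\<Sum>b\<in>B. f b)"
proof -
  have "trace (eigen_matrix f) = (\<Sum>b\<in>B. \<Sum>i\<in>UNIV. f b * (b $ i * b $ i))"
    by (simp add: trace_def eigen_matrix_def mult.assoc sum.swap[of _ UNIV])
  also have "\<dots> = (\<Sum>b\<in>B. f b * (b \<bullet> b))"
    by (simp add: inner_vec_def sum_distrib_left)
  also have "\<dots> = (\<Sum>b\<in>B. f b)" by (simp add: orthonormal_basis_inner)
  finally show ?thesis .
qed

lemma eq_eigen_matrix:
  assumes "\<And>b. b \<in> B \<Longrightarrow> M *v b = f b *\<^sub>R b"
  shows "M = eigen_matrix f"
  using assms by (intro matrix_eq_on_basis) (simp add: eigen_matrix_basis)

end

section \<open>Positive semidefinite square roots\<close>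

text \<open>From \<open>(S + m) (S - m) b = 0\<close> the vector \<open>w = (S - m) b\<close>
  satisfies \<open>S w = - m w\<close>, which for psd \<open>S\<close> and \<open>m > 0\<close>
  forces \<open>w = 0\<close>. Thus a psd root is determined on the eigenvectors of its
  square.\<close>

lemma psd_square_root_eigenvector:
  fixes S :: "real^'d^'d"
  assumes S: "psd S" and e: "S *v (S *v b) = m\<^sup>2 *\<^sub>R b" and m: "0 \<le> m"
  shows "S *v b = m *\<^sub>R b"
proof (cases "m = 0")
  case True
  have "(S *v b) \<bullet> (S *v b) = b \<bullet> (S *v (S *v b))"
    using S sym_matrix_inner[of S b "S *v b"] by (simp add: psd_def)
  thus ?thesis using True e by simp
next
  case False
  define w where "w = S *v b - m *\<^sub>R b"
  have "S *v w = - m *\<^sub>R w"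
    by (simp add: w_def matrix_vector_mult_diff_distrib matrix_vector_mult_scaleR e algebra_simps power2_eq_square)
  hence "0 \<le> - m * (w \<bullet> w)"
    using S unfolding psd_def by (metis inner_scaleR_right)
  hence "w \<bullet> w \<le> 0" using m False by (simp add: mult_le_0_iff zero_le_mult_iff)
  hence "w \<bullet> w = 0" using inner_ge_zero[of w] by linarith
  thus ?thesis by (simp add: w_def)
qed

lemma psd_eigenvalue_nonneg:
  assumes "psd M" "M *v b = m *\<^sub>R b" "norm b = 1"
  shows "0 \<le> m"
  using assms unfolding psd_def by (metis dot_square_norm inner_scaleR_right mult.right_neutral power_one)

text \<open>Uniqueness, which gives the definite description \<open>psd_sqrt\<close> its meaning:
  two psd roots agree on an eigenbasis of \<open>M\<close>.\<close>

lemma psd_sqrt_eq: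
  fixes M :: "real^'d^'d"
  assumes M: "psd M" and S: "psd S" "S ** S = M"
  shows "psd_sqrt M = S"
  unfolding psd_sqrt_def
proof (rule the_equality)
  fix S' assume S': "psd S' \<and> S' ** S' = M"
  have tM: "transpose M = M" using M by (simp add: psd_def)
  obtain B m where B: "orthonormal_basis B" and m: "\<And>b. b \<in> B \<Longrightarrow> M *v b = m b *\<^sub>R b"
    using commuting_symmetric_eigenbasis[OF tM tM] by metis
  show "S' = S"
  proof (rule matrix_eq_on_basis[OF B])
    fix b assume b: "b \<in> B"
    have nn: "0 \<le> m b"
      using psd_eigenvalue_nonneg[OF M m[OF b]] b B by (auto simp: orthonormal_basis_def)
    have "T *v b = sqrt (m b) *\<^sub>R b" if "psd T" "T ** T = M" for T
      using that m[OF b] nn by (intro psd_square_root_eigenvector) (auto simp: matrix_vector_mul_assoc)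
    thus "S' *v b = S *v b" using S S' by simp
  qed
qed (use S in auto)

lemma psd_sqrt_exists:
  fixes M :: "real^'d^'d"
  assumes M: "psd M"
  shows "psd (psd_sqrt M)" "psd_sqrt M ** psd_sqrt M = M"
proof -
  have tM: "transpose M = M" using M by (simp add: psd_def)
  obtain B m where B: "orthonormal_basis B" and m: "\<And>b. b \<in> B \<Longrightarrow> M *v b = m b *\<^sub>R b"
    using commuting_symmetric_eigenbasis[OF tM tM] by metis
  have nn: "0 \<le> m b" if "b \<in> B" for b
    using psd_eigenvalue_nonneg[OF M m[OF that]] that B by (auto simp: orthonormal_basis_def)
  define S where "S = eigen_matrix B (\<lambda>b. sqrt (m b))"
  have "psd S"
    unfolding psd_def S_def using nn
    by (auto simp: transpose_eigen_matrix[OF B] eigen_matrix_inner[OF B] intro!: sum_nonneg)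
  moreover have "S ** S = M"
    by (rule matrix_eq_on_basis[OF B])
       (simp add: matrix_vector_mul_assoc[symmetric] S_def eigen_matrix_basis[OF B] matrix_vector_mult_scaleR m nn)
  ultimately show "psd (psd_sqrt M)" "psd_sqrt M ** psd_sqrt M = M"
    using psd_sqrt_eq[OF M] by auto
qed

lemma norm_psd_sqrt_square:
  fixes M :: "real^'d^'d"
  assumes "psd M"
  shows "(norm (psd_sqrt M *v x))\<^sup>2 = x \<bullet> (M *v x)"
proof -
  have "(psd_sqrt M *v x) \<bullet> (psd_sqrt M *v x) = x \<bullet> (psd_sqrt M *v (psd_sqrt M *v x))"
    using psd_sqrt_exists(1)[OF assms] sym_matrix_inner[of "psd_sqrt M" x "psd_sqrt M *v x"] by (simp add: psd_def)
  also have "\<dots> = x \<bullet> (M *v x)"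
    by (simp add: matrix_vector_mul_assoc psd_sqrt_exists(2)[OF assms])
  finally show ?thesis by (simp add: dot_square_norm)
qed

section \<open>Linear estimators\<close>

lemma matrix_inv_mult:
  fixes A :: "real^'d^'d"
  assumes "invertible A"
  shows "A ** matrix_inv A = mat 1" "matrix_inv A ** A = mat 1"
  using someI_ex[of "\<lambda>A'. A ** A' = mat 1 \<and> A' ** A = mat 1"] assms
  unfolding matrix_inv_def invertible_def by blast+

lemma norm_vec_square: "(norm v)\<^sup>2 = (\<Sum>i\<in>UNIV. (v $ i)\<^sup>2)" for v :: "real^'d"
  unfolding dot_square_norm[symmetric] inner_vec_def by (simp add: power2_eq_square)

lemma matrix_vector_mult_row: "(K *v z) $ i = row i K \<bullet> z" for K :: "real^'n^'d"
  by (simp add: matrix_vector_mult_def row_def inner_vec_def)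

lemma trace_mult_transpose: "trace (K ** transpose K) = (\<Sum>i\<in>UNIV. (norm (row i K))\<^sup>2)" for K :: "real^'n^'d"
  unfolding norm_vec_square
  by (simp add: trace_def matrix_matrix_mult_def transpose_def row_def power2_eq_square)

lemma matrix_scaleR_left: "(c *\<^sub>R A) ** B = c *\<^sub>R (A ** B)" for A :: "real^'b^'a" and B :: "real^'c^'b"
  by (simp add: matrix_matrix_mult_def vec_eq_iff sum_distrib_left mult_ac)

lemma matrix_scaleR_right: "A ** (c *\<^sub>R B) = c *\<^sub>R (A ** B)" for A :: "real^'b^'a" and B :: "real^'c^'b"
  by (simp add: matrix_matrix_mult_def vec_eq_iff sum_distrib_left mult_ac)

lemma matrix_add_mult: "(A + B) ** C = A ** C + B ** C" for A B :: "real^'b^'a" and C :: "real^'c^'b"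
  by (simp add: matrix_matrix_mult_def vec_eq_iff distrib_right sum.distrib)

lemma matrix_diff_mult: "(A - B) ** C = A ** C - B ** C" for A B :: "real^'b^'a" and C :: "real^'c^'b"
  by (simp add: matrix_matrix_mult_def vec_eq_iff left_diff_distrib sum_subtractf)

lemma bias_form:
  fixes SigT D :: "real^'d^'d"
  assumes SigT: "psd SigT"
  shows "(norm (psd_sqrt SigT *v (D *v x)))\<^sup>2 = x \<bullet> ((transpose D ** SigT ** D) *v x)"
proof -
  have "(D *v x) \<bullet> (SigT *v (D *v x)) = x \<bullet> (transpose D *v (SigT *v (D *v x)))"
    by (metis dot_lmul_matrix inner_commute transpose_matrix_vector)
  thus ?thesis
    unfolding norm_psd_sqrt_square[OF SigT] by (simp add: matrix_vector_mul_assoc matrix_mul_assoc)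
qed

text \<open>Turns the Loewner constraint into a bound on the squared bias that is homogeneous in the
  parameter \<open>x\<close>.\<close>

lemma mm_feasible_iff:
  fixes SigT :: "real^'d^'d"
  assumes SigT: "psd SigT"
  shows "mm_feasible SigT C \<tau> \<longleftrightarrow> (\<forall>x. (norm (psd_sqrt SigT *v ((C - mat 1) *v x)))\<^sup>2 \<le> \<tau> * (norm x)\<^sup>2)"
proof -
  let ?Q = "transpose (C - mat 1) ** SigT ** (C - mat 1)"
  have "transpose SigT = SigT" using SigT by (simp add: psd_def)
  hence "transpose ?Q = ?Q"
    by (simp add: matrix_transpose_mul matrix_mul_assoc)
  hence "transpose (\<tau> *\<^sub>R mat 1 - ?Q) = \<tau> *\<^sub>R mat 1 - ?Q"
    by (simp add: transpose_def vec_eq_iff mat_def)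
  moreover have "x \<bullet> ((\<tau> *\<^sub>R mat 1 - ?Q) *v x) = \<tau> * (norm x)\<^sup>2 - x \<bullet> (?Q *v x)" for x
    by (simp add: matrix_vector_mult_diff_rdistrib inner_diff_right scaleR_matrix_vector_assoc[symmetric] dot_square_norm)
  ultimately show ?thesis
    unfolding mm_feasible_def loewner_le_def psd_def bias_form[OF SigT] by simp
qed

section \<open>Worst case risk of a linear estimator\<close>

context
  fixes SigT :: "real^'d^'d" and X :: "real^'d^'n" and \<sigma> r :: real
  assumes \<sigma>: "0 < \<sigma>" and r: "0 < r" and SigT: "psd SigT"
begin

text \<open>Bias-variance split in each coordinate of the loss vector. The variance is free of
  \<open>\<beta>\<close>, so the worst case concerns the bias alone.\<close>

lemma linear_estimator_risk:
  fixes A :: "real^'n^'d"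
  shows "(\<integral>\<^sup>+z. ennreal ((norm (psd_sqrt SigT *v (A *v (X *v \<beta> + z) - \<beta>)))\<^sup>2) \<partial>(gauss_noise \<sigma>))
    = ennreal ((norm (psd_sqrt SigT *v ((A ** X - mat 1) *v \<beta>)))\<^sup>2
        + \<sigma>\<^sup>2 * trace (psd_sqrt SigT ** A ** transpose A ** psd_sqrt SigT))"
proof -
  let ?S = "psd_sqrt SigT"
  define m where "m = ?S *v ((A ** X - mat 1) *v \<beta>)"
  define K where "K = ?S ** A"
  have vec: "?S *v (A *v (X *v \<beta> + z) - \<beta>) = m + K *v z" for z
    unfolding m_def K_def
    by (simp add: matrix_vector_mult_diff_rdistrib matrix_vector_right_distrib matrix_vector_mult_diff_distrib
        matrix_vector_mul_assoc)
  have tS: "transpose ?S = ?S" using psd_sqrt_exists(1)[OF SigT] by (simp add: psd_def)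
  have tr: "trace (?S ** A ** transpose A ** ?S) = (\<Sum>i\<in>UNIV. (norm (row i K))\<^sup>2)"
    unfolding trace_mult_transpose[symmetric] K_def by (simp add: matrix_transpose_mul tS matrix_mul_assoc)
  have "(\<integral>\<^sup>+z. ennreal ((norm (?S *v (A *v (X *v \<beta> + z) - \<beta>)))\<^sup>2) \<partial>(gauss_noise \<sigma>))
      = (\<integral>\<^sup>+z. (\<Sum>i\<in>UNIV. ennreal ((m $ i + row i K \<bullet> z)\<^sup>2)) \<partial>(gauss_noise \<sigma>))"
    by (simp add: vec norm_vec_square matrix_vector_mult_row)
  also have "\<dots> = (\<Sum>i\<in>UNIV. \<integral>\<^sup>+z. ennreal ((m $ i + row i K \<bullet> z)\<^sup>2) \<partial>(gauss_noise \<sigma>))"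
    by (intro nn_integral_sum) measurable
  also have "\<dots> = (\<Sum>i\<in>UNIV. ennreal ((m $ i)\<^sup>2 + \<sigma>\<^sup>2 * (norm (row i K))\<^sup>2))"
    by (simp add: nn_integral_gauss_noise_affine_square[OF \<sigma>])
  also have "\<dots> = ennreal ((norm m)\<^sup>2 + \<sigma>\<^sup>2 * trace (?S ** A ** transpose A ** ?S))"
    unfolding tr norm_vec_square[of m] sum_distrib_left sum.distrib[symmetric] by (rule sum_ennreal) auto
  finally show ?thesis by (simp add: m_def)
qed

lemma linear_risk_le:
  fixes A :: "real^'n^'d"
  assumes "mm_feasible SigT (A ** X) \<tau>"
  shows "risk_L SigT X \<sigma> r (\<lambda>y. A *v y)
    \<le> ennreal (r\<^sup>2 * \<tau> + \<sigma>\<^sup>2 * trace (psd_sqrt SigT ** A ** transpose A ** psd_sqrt SigT))"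
  unfolding risk_L_def
proof (rule SUP_least)
  fix \<beta> :: "real^'d" assume "\<beta> \<in> {\<beta>. norm \<beta> \<le> r}"
  hence \<beta>: "norm \<beta> \<le> r" by simp
  have feas: "(norm (psd_sqrt SigT *v ((A ** X - mat 1) *v x)))\<^sup>2 \<le> \<tau> * (norm x)\<^sup>2" for x
    using assms by (simp add: mm_feasible_iff[OF SigT])
  \<comment> \<open>Tested on a unit vector. The sign is what allows \<open>norm \<beta>\<close> to
    be replaced by \<open>r\<close>.\<close>
  have "0 \<le> \<tau>"
  proof -
    have "0 \<le> (norm (psd_sqrt SigT *v ((A ** X - mat 1) *v axis undefined 1)))\<^sup>2" by simp
    also note feas
    finally show ?thesis by (simp add: norm_axis_1)
  qed
  hence "\<tau> * (norm \<beta>)\<^sup>2 \<le> r\<^sup>2 * \<tau>"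
    using \<beta> by (simp add: mult.commute mult_left_mono power_mono)
  with feas[of \<beta>] show "(\<integral>\<^sup>+z. ennreal ((norm (psd_sqrt SigT *v (A *v (X *v \<beta> + z) - \<beta>)))\<^sup>2) \<partial>(gauss_noise \<sigma>))
    \<le> ennreal (r\<^sup>2 * \<tau> + \<sigma>\<^sup>2 * trace (psd_sqrt SigT ** A ** transpose A ** psd_sqrt SigT))"
    unfolding linear_estimator_risk by (intro ennreal_leI add_right_mono) linarith
qed

text \<open>\<open>\<tau>\<close> is the maximum of the bias form on the unit sphere. Its maximiser,
  scaled to length \<open>r\<close>, lies in the ball, and there the risk equals the bound.\<close>

lemma linear_risk_ge:
  fixes A :: "real^'n^'d"
  obtains \<tau> where "mm_feasible SigT (A ** X) \<tau>"
    and "ennreal (r\<^sup>2 * \<tau> + \<sigma>\<^sup>2 * trace (psd_sqrt SigT ** A ** transpose A ** psd_sqrt SigT))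
      \<le> risk_L SigT X \<sigma> r (\<lambda>y. A *v y)"
proof -
  define f where "f x = (norm (psd_sqrt SigT *v ((A ** X - mat 1) *v x)))\<^sup>2" for x
  have cont: "continuous_on (sphere 0 1) f"
    unfolding f_def by (intro continuous_intros matrix_vector_mult_linear_continuous_on continuous_on_compose2[OF matrix_vector_mult_linear_continuous_on]) auto
  have scale: "f (c *\<^sub>R x) = c\<^sup>2 * f x" for c x
    by (simp add: f_def matrix_vector_mult_scaleR power_mult_distrib)
  have ne: "sphere 0 1 \<noteq> ({} :: (real^'d) set)"
    using norm_axis_1[of undefined] by (metis dist_0_norm empty_iff mem_sphere)
  obtain x0 where x0: "norm x0 = 1" and max: "\<And>x. norm x = 1 \<Longrightarrow> f x \<le> f x0"
    using continuous_attains_sup[OF compact_sphere ne cont] by auto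
  have "f x \<le> f x0 * (norm x)\<^sup>2" for x
  proof (cases "x = 0")
    case True
    thus ?thesis by (simp add: f_def)
  next
    case False
    have "f x = (norm x)\<^sup>2 * f (x /\<^sub>R norm x)"
      using False by (simp add: scale power_inverse)
    also have "\<dots> \<le> (norm x)\<^sup>2 * f x0"
      using False by (intro mult_left_mono max) auto
    finally show ?thesis by (simp add: mult.commute)
  qed
  hence "mm_feasible SigT (A ** X) (f x0)"
    by (simp add: mm_feasible_iff[OF SigT] f_def)
  moreover have "ennreal (r\<^sup>2 * f x0 + \<sigma>\<^sup>2 * trace (psd_sqrt SigT ** A ** transpose A ** psd_sqrt SigT))
      \<le> risk_L SigT X \<sigma> r (\<lambda>y. A *v y)"
    unfolding risk_L_def
    by (rule SUP_upper2[of "r *\<^sub>R x0"])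
       (use r x0 in \<open>simp_all add: linear_estimator_risk f_def[symmetric] scale\<close>)
  ultimately show ?thesis by (rule that)
qed

end

section \<open>The least squares estimator and the convex program\<close>

lemma transpose_sample_cov: "transpose (sample_cov X) = sample_cov X"
  by (simp add: sample_cov_def transpose_def vec_eq_iff matrix_matrix_mult_def mult.commute)

lemma sample_cov_mult: "sample_cov X *v x = (1 / real CARD('n)) *\<^sub>R (transpose X *v (X *v x))" for X :: "real^'d^'n"
  by (simp add: sample_cov_def scaleR_matrix_vector_assoc[symmetric] matrix_vector_mul_assoc)

lemma norm_design_square: "(norm (X *v x))\<^sup>2 = real CARD('n) * (x \<bullet> (sample_cov X *v x))" for X :: "real^'d^'n"
proof -
  have "(X *v x) \<bullet> (X *v x) = x \<bullet> (transpose X *v (X *v x))"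
    by (metis dot_lmul_matrix inner_commute transpose_matrix_vector)
  thus ?thesis by (simp add: sample_cov_mult dot_square_norm)
qed

lemma transpose_matrix_inv:
  fixes A :: "real^'d^'d"
  assumes "invertible A" "transpose A = A"
  shows "transpose (matrix_inv A) = matrix_inv A"
proof -
  have "A ** transpose (matrix_inv A) = mat 1"
    using arg_cong[OF matrix_inv_mult(2)[OF assms(1)], of transpose] assms(2)
    by (simp add: matrix_transpose_mul transpose_mat)
  hence "matrix_inv A ** (A ** transpose (matrix_inv A)) = matrix_inv A" by simp
  thus ?thesis by (simp add: matrix_mul_assoc matrix_inv_mult(2)[OF assms(1)])
qed

definition plug_in :: "real^'d^'n \<Rightarrow> real^'d^'d \<Rightarrow> real^'n^'d" where
  "plug_in X C = (1 / real CARD('n)) *\<^sub>R (C ** matrix_inv (sample_cov X) ** transpose X)"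

lemma plug_in_beta_SS: "C *v beta_SS X y = plug_in X C *v y"
  by (simp add: beta_SS_def plug_in_def scaleR_matrix_vector_assoc[symmetric] matrix_vector_mult_scaleR
      matrix_vector_mul_assoc matrix_mul_assoc del: transpose_matrix_vector)

lemma transpose_scaleR: "transpose (c *\<^sub>R A) = c *\<^sub>R transpose A" for A :: "real^'a^'b"
  by (simp add: transpose_def vec_eq_iff)

context
  fixes X :: "real^'d^'n"
  assumes inv: "invertible (sample_cov X)"
begin

lemma plug_in_design: "plug_in X C ** X = C"
proof -
  have "plug_in X C ** X = C ** matrix_inv (sample_cov X) ** sample_cov X"
  proof -
    have "K ** sample_cov X = (1 / real CARD('n)) *\<^sub>R (K ** transpose X ** X)" for K :: "real^'d^'d"
      by (simp add: sample_cov_def matrix_scaleR_right matrix_mul_assoc)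
    thus ?thesis by (simp add: plug_in_def matrix_scaleR_left)
  qed
  also have "\<dots> = C ** (matrix_inv (sample_cov X) ** sample_cov X)" by (simp add: matrix_mul_assoc)
  finally show ?thesis by (simp add: matrix_inv_mult(2)[OF inv])
qed

lemma plug_in_mult_transpose:
  "plug_in X C ** transpose (plug_in X C) = (1 / real CARD('n)) *\<^sub>R (C ** matrix_inv (sample_cov X) ** transpose C)"
proof -
  have "plug_in X C ** transpose (plug_in X C)
      = (1 / real CARD('n)) *\<^sub>R (plug_in X C ** X ** (matrix_inv (sample_cov X) ** transpose C))"
    by (subst (2) plug_in_def) (simp add: transpose_scaleR matrix_transpose_mul transpose_matrix_inv[OF inv transpose_sample_cov]
        matrix_scaleR_left matrix_scaleR_right matrix_mul_assoc)
  thus ?thesis by (simp add: plug_in_design matrix_mul_assoc)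
qed

text \<open>Among the linear estimators with the same \<open>A X\<close>, the plug-in estimator has the smallest variance:
  the rows of \<open>A - plug_in X (A X)\<close> are orthogonal to the range of \<open>X\<close>.\<close>

lemma plug_in_trace_le:
  fixes A :: "real^'n^'d" and S :: "real^'d^'d"
  assumes S: "transpose S = S"
  shows "trace (S ** plug_in X (A ** X) ** transpose (plug_in X (A ** X)) ** S) \<le> trace (S ** A ** transpose A ** S)"
proof -
  define A0 where "A0 = plug_in X (A ** X)"
  define D where "D = A - A0"
  have A: "A = A0 + D" by (simp add: D_def)
  have "D ** X = 0"
    by (simp add: D_def A0_def matrix_diff_mult plug_in_design)
  have "D ** transpose A0 = (1 / real CARD('n)) *\<^sub>R (D ** X ** (matrix_inv (sample_cov X) ** transpose (A ** X)))"
    by (simp add: A0_def plug_in_def transpose_scaleR matrix_transpose_mul transpose_matrix_inv[OF inv transpose_sample_cov]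
        matrix_scaleR_left matrix_scaleR_right matrix_mul_assoc)
  hence DA: "D ** transpose A0 = 0" using \<open>D ** X = 0\<close> by simp
  have AD: "A0 ** transpose D = 0"
  proof -
    have "A0 ** transpose D = transpose (D ** transpose A0)" by (simp add: matrix_transpose_mul)
    also have "\<dots> = 0" unfolding DA by (simp add: transpose_def vec_eq_iff)
    finally show ?thesis .
  qed
  have "transpose A = transpose A0 + transpose D"
    unfolding A by (simp add: transpose_def vec_eq_iff)
  hence "A ** transpose A = A0 ** transpose A0 + D ** transpose D"
    by (subst A) (simp add: matrix_add_ldistrib matrix_add_mult DA AD)
  hence "S ** (A ** transpose A) ** S = S ** (A0 ** transpose A0) ** S + S ** (D ** transpose D) ** S"
    by (simp add: matrix_add_ldistrib matrix_add_mult)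
  hence "S ** A ** transpose A ** S = S ** A0 ** transpose A0 ** S + S ** D ** transpose D ** S"
    by (simp add: matrix_mul_assoc)
  moreover have "trace (S ** D ** transpose D ** S) = trace ((S ** D) ** transpose (S ** D))"
    by (simp add: matrix_transpose_mul S matrix_mul_assoc)
  ultimately show ?thesis
    by (simp add: trace_add trace_mult_transpose A0_def[symmetric] sum_nonneg)
qed

lemma mm_objective_plug_in:
  "mm_objective SigT X \<sigma> r C \<tau>
     = r\<^sup>2 * \<tau> + \<sigma>\<^sup>2 * trace (psd_sqrt SigT ** plug_in X C ** transpose (plug_in X C) ** psd_sqrt SigT)"
proof -
  have "psd_sqrt SigT ** plug_in X C ** transpose (plug_in X C) ** psd_sqrt SigT
      = psd_sqrt SigT ** (plug_in X C ** transpose (plug_in X C)) ** psd_sqrt SigT"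
    by (simp add: matrix_mul_assoc)
  also have "\<dots> = (1 / real CARD('n)) *\<^sub>R (psd_sqrt SigT ** C ** matrix_inv (sample_cov X) ** transpose C ** psd_sqrt SigT)"
    unfolding plug_in_mult_transpose by (simp add: matrix_scaleR_left matrix_scaleR_right matrix_mul_assoc)
  finally show ?thesis
    by (simp add: mm_objective_def trace_def sum_distrib_left sum_divide_distrib)
qed

end

text \<open>Each linear estimator yields a feasible pair whose objective is at most its risk, so the
  optimal value bounds all linear risks from below, and the plug-in estimator attains it. The first
  conclusion keeps the numerical value for the comparison with nonlinear estimators.\<close>

theorem linear_minimax:
  fixes X :: "real^'d^'n" and SigT Cs :: "real^'d^'d"
  assumes \<sigma>: "0 < \<sigma>" and r: "0 < r" and inv: "invertible (sample_cov X)" and SigT: "psd SigT"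
    and feas: "mm_feasible SigT Cs \<tau>s"
    and opt: "\<And>C \<tau>. mm_feasible SigT C \<tau> \<Longrightarrow> mm_objective SigT X \<sigma> r Cs \<tau>s \<le> mm_objective SigT X \<sigma> r C \<tau>"
  shows "risk_L SigT X \<sigma> r (\<lambda>y. Cs *v beta_SS X y) \<le> ennreal (mm_objective SigT X \<sigma> r Cs \<tau>s)"
    and "risk_L SigT X \<sigma> r (\<lambda>y. Cs *v beta_SS X y) = R_L SigT X \<sigma> r"
proof -
  let ?S = "psd_sqrt SigT"
  show le: "risk_L SigT X \<sigma> r (\<lambda>y. Cs *v beta_SS X y) \<le> ennreal (mm_objective SigT X \<sigma> r Cs \<tau>s)"
    unfolding plug_in_beta_SS mm_objective_plug_in[OF inv]
    using feas by (intro linear_risk_le[OF \<sigma> r SigT]) (simp add: plug_in_design[OF inv])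
  have tS: "transpose ?S = ?S" using psd_sqrt_exists(1)[OF SigT] by (simp add: psd_def)
  have "ennreal (mm_objective SigT X \<sigma> r Cs \<tau>s) \<le> risk_L SigT X \<sigma> r (\<lambda>y. A *v y)" for A :: "real^'n^'d"
  proof -
    obtain \<tau> where f: "mm_feasible SigT (A ** X) \<tau>"
      and ge: "ennreal (r\<^sup>2 * \<tau> + \<sigma>\<^sup>2 * trace (?S ** A ** transpose A ** ?S)) \<le> risk_L SigT X \<sigma> r (\<lambda>y. A *v y)"
      by (rule linear_risk_ge[OF \<sigma> r SigT])
    have "mm_objective SigT X \<sigma> r Cs \<tau>s \<le> mm_objective SigT X \<sigma> r (A ** X) \<tau>" by (rule opt[OF f])
    also have "\<dots> \<le> r\<^sup>2 * \<tau> + \<sigma>\<^sup>2 * trace (?S ** A ** transpose A ** ?S)"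
      unfolding mm_objective_plug_in[OF inv]
      by (intro add_left_mono mult_left_mono plug_in_trace_le[OF inv tS]) simp
    finally show ?thesis using ge by (meson ennreal_leI order_trans)
  qed
  hence "risk_L SigT X \<sigma> r (\<lambda>y. Cs *v beta_SS X y) \<le> R_L SigT X \<sigma> r"
    unfolding R_L_def by (intro INF_greatest order_trans[OF le])
  moreover have "R_L SigT X \<sigma> r \<le> risk_L SigT X \<sigma> r (\<lambda>y. Cs *v beta_SS X y)"
    unfolding R_L_def plug_in_beta_SS by (rule INF_lower) simp
  ultimately show "risk_L SigT X \<sigma> r (\<lambda>y. Cs *v beta_SS X y) = R_L SigT X \<sigma> r" by (rule antisym)
qed

section \<open>Lower bounds for all estimators\<close>

text \<open>Separates one coordinate of a product prior from the others, which can then be held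
  fixed.\<close>

lemma sum_PiE_split:
  fixes F :: "('i \<Rightarrow> 'b) \<Rightarrow> 'c::comm_monoid_add"
  assumes "i \<notin> I"
  shows "(\<Sum>s\<in>Pi\<^sub>E (insert i I) T. F s) = (\<Sum>s\<in>Pi\<^sub>E I T. \<Sum>j\<in>T i. F (s(i := j)))"
proof -
  have "(\<Sum>s\<in>Pi\<^sub>E (insert i I) T. F s) = (\<Sum>(j, s)\<in>T i \<times> Pi\<^sub>E I T. F (s(i := j)))"
    unfolding PiE_insert_eq by (subst sum.reindex[OF inj_combinator[OF assms]]) (simp add: case_prod_beta o_def)
  also have "\<dots> = (\<Sum>j\<in>T i. \<Sum>s\<in>Pi\<^sub>E I T. F (s(i := j)))"
    by (simp add: sum.cartesian_product)
  also have "\<dots> = (\<Sum>s\<in>Pi\<^sub>E I T. \<Sum>j\<in>T i. F (s(i := j)))" by (rule sum.swap)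
  finally show ?thesis .
qed

text \<open>The coordinates along the \<open>h i\<close> get independent priors. For each \<open>i\<close>, the other coordinates may be
  revealed to the statistician, which leaves a bounded normal mean with signal to noise ratio
  \<open>norm (X *v h i) / \<sigma>\<close>.\<close>

lemma minimax_lower_bound:
  fixes X :: "real^'d^'n" and SigT :: "real^'d^'d" and h v :: "'i \<Rightarrow> real^'d"
  assumes \<sigma>: "0 < \<sigma>" and I: "finite I" and est[measurable]: "est \<in> borel_measurable borel"
    and Xh: "\<And>i. i \<in> I \<Longrightarrow> X *v h i \<noteq> 0"
    and vh: "\<And>i j. i \<in> I \<Longrightarrow> j \<in> I \<Longrightarrow> i \<noteq> j \<Longrightarrow> v i \<bullet> h j = 0"
    and S: "\<And>x. (\<Sum>i\<in>I. (v i \<bullet> x)\<^sup>2) \<le> (norm (psd_sqrt SigT *v x))\<^sup>2"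
    and ball: "\<And>a. (\<And>i. i \<in> I \<Longrightarrow> \<bar>a i\<bar> \<le> 1) \<Longrightarrow> norm (\<Sum>i\<in>I. a i *\<^sub>R h i) \<le> r"
  shows "ennreal (4 / 5 * (\<Sum>i\<in>I. (v i \<bullet> h i)\<^sup>2 / (1 + (norm (X *v h i) / \<sigma>)\<^sup>2))) \<le> risk_L SigT X \<sigma> r est"
proof -
  define \<kappa> where "\<kappa> i = norm (X *v h i) / \<sigma>" for i
  have "\<exists>n w b. bayes_bound (\<kappa> i) (4 / 5 / (1 + (\<kappa> i)\<^sup>2)) n w b" for i
    using \<sigma> by (intro bounded_normal_mean_bayes_bound) (simp add: \<kappa>_def)
  then obtain n w b where bb: "\<And>i. bayes_bound (\<kappa> i) (4 / 5 / (1 + (\<kappa> i)\<^sup>2)) (n i) (w i) (b i)"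
    by metis
  have w: "0 \<le> w i j" "\<bar>b i j\<bar> \<le> 1" if "j < n i" for i j
    using bb[of i] that by (auto simp: bayes_bound_def)
  have w1: "(\<Sum>j<n i. w i j) = 1" for i
    using bb[of i] by (simp add: bayes_bound_def)
  \<comment> \<open>A choice function \<open>s\<close> picks one atom per coordinate;
    \<open>W I\<close> is the product prior and \<open>\<beta> s\<close> the corresponding
    parameter.\<close>
  define P where "P J = Pi\<^sub>E J (\<lambda>i. {..<n i})" for J :: "'i set"
  define W where "W J s = (\<Prod>i\<in>J. w i (s i))" for J s
  define \<beta> where "\<beta> s = (\<Sum>i\<in>I. b i (s i) *\<^sub>R h i)" for s
  have W_nonneg: "0 \<le> W J s" if "s \<in> P J" for J s
    unfolding W_def using that by (intro prod_nonneg) (auto simp: P_def PiE_iff w)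
  have W_sum: "(\<Sum>s\<in>P J. W J s) = 1" if "finite J" for J
    unfolding W_def P_def using that prod_sum_PiE[of J "\<lambda>i. {..<n i}" w] by (simp add: w1)
  define R where "R \<beta> = (\<integral>\<^sup>+z. ennreal ((norm (psd_sqrt SigT *v (est (X *v \<beta> + z) - \<beta>)))\<^sup>2) \<partial>(gauss_noise \<sigma>))" for \<beta>
  define E where "E i s = (\<integral>\<^sup>+z. ennreal ((v i \<bullet> est (X *v \<beta> s + z) - (v i \<bullet> h i) * b i (s i))\<^sup>2) \<partial>(gauss_noise \<sigma>))" for i s
  have R_le: "R (\<beta> s) \<le> risk_L SigT X \<sigma> r est" if "s \<in> P I" for s
  proof -
    have "norm (\<beta> s) \<le> r"
      unfolding \<beta>_def using that by (intro ball) (auto simp: P_def PiE_iff w)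
    thus ?thesis unfolding risk_L_def R_def by (intro SUP_upper) simp
  qed
  have R_ge: "(\<Sum>i\<in>I. E i s) \<le> R (\<beta> s)" for s
  proof -
    have "(\<Sum>i\<in>I. E i s)
        = (\<integral>\<^sup>+z. (\<Sum>i\<in>I. ennreal ((v i \<bullet> est (X *v \<beta> s + z) - (v i \<bullet> h i) * b i (s i))\<^sup>2)) \<partial>(gauss_noise \<sigma>))"
      unfolding E_def by (intro nn_integral_sum[symmetric]) measurable
    also have "\<dots> \<le> R (\<beta> s)"
      unfolding R_def
    proof (rule nn_integral_mono)
      fix z
      \<comment> \<open>By \<open>vh\<close> the functional \<open>v i\<close> sees coordinate
        \<open>i\<close> alone, so the loss splits into one-dimensional losses.\<close>
      have "v i \<bullet> \<beta> s = (v i \<bullet> h i) * b i (s i)" if "i \<in> I" for i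
      proof -
        have "v i \<bullet> \<beta> s = (\<Sum>j\<in>I. if j = i then (v i \<bullet> h i) * b i (s i) else 0)"
          unfolding \<beta>_def inner_sum_right using that vh by (intro sum.cong) auto
        thus ?thesis using that I by simp
      qed
      hence "(\<Sum>i\<in>I. (v i \<bullet> est (X *v \<beta> s + z) - (v i \<bullet> h i) * b i (s i))\<^sup>2)
          = (\<Sum>i\<in>I. (v i \<bullet> (est (X *v \<beta> s + z) - \<beta> s))\<^sup>2)"
        by (simp add: inner_diff_right)
      also have "\<dots> \<le> (norm (psd_sqrt SigT *v (est (X *v \<beta> s + z) - \<beta> s)))\<^sup>2" by (rule S)
      finally show "(\<Sum>i\<in>I. ennreal ((v i \<bullet> est (X *v \<beta> s + z) - (v i \<bullet> h i) * b i (s i))\<^sup>2))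
          \<le> ennreal ((norm (psd_sqrt SigT *v (est (X *v \<beta> s + z) - \<beta> s)))\<^sup>2)"
        by (simp add: ennreal_leI)
    qed
    finally show ?thesis .
  qed
  have coord: "ennreal ((v i \<bullet> h i)\<^sup>2 * (4 / 5 / (1 + (\<kappa> i)\<^sup>2))) \<le> (\<Sum>s\<in>P I. ennreal (W I s) * E i s)" if i: "i \<in> I" for i
  proof -
    let ?J = "I - {i}"
    let ?c = "ennreal ((v i \<bullet> h i)\<^sup>2 * (4 / 5 / (1 + (\<kappa> i)\<^sup>2)))"
    have "finite ?J" "i \<notin> ?J" "insert i ?J = I" using I i by auto
    have inner: "?c \<le> (\<Sum>j<n i. ennreal (w i j) * E i (s(i := j)))" for s
    proof -
      define m where "m = (\<Sum>k\<in>?J. b k (s k) *\<^sub>R h k)"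
      have \<beta>_upd: "\<beta> (s(i := j)) = m + b i j *\<^sub>R h i" for j
      proof -
        have "\<beta> (s(i := j)) = (\<Sum>k\<in>insert i ?J. b k ((s(i := j)) k) *\<^sub>R h k)"
          unfolding \<beta>_def using \<open>insert i ?J = I\<close> by simp
        also have "\<dots> = b i j *\<^sub>R h i + (\<Sum>k\<in>?J. b k ((s(i := j)) k) *\<^sub>R h k)"
          using \<open>finite ?J\<close> by (subst sum.insert) auto
        also have "(\<Sum>k\<in>?J. b k ((s(i := j)) k) *\<^sub>R h k) = m"
          unfolding m_def by (intro sum.cong) auto
        finally show ?thesis by (simp only: add.commute)
      qed
      have "?c \<le> (\<Sum>j<n i. ennreal (w i j) *
          (\<integral>\<^sup>+z. ennreal ((v i \<bullet> est (X *v m + b i j *\<^sub>R (X *v h i) + z) - (v i \<bullet> h i) * b i j)\<^sup>2) \<partial>(gauss_noise \<sigma>)))"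
        using bb[of i] by (intro bayes_bound_gauss_noise[OF \<sigma> Xh[OF i], where g="\<lambda>y. v i \<bullet> est y"]) (auto simp: \<kappa>_def)
      thus ?thesis
        by (simp add: E_def \<beta>_upd matrix_vector_right_distrib matrix_vector_mult_scaleR)
    qed
    have "(\<Sum>s\<in>P I. ennreal (W I s) * E i s)
        = (\<Sum>s\<in>P ?J. \<Sum>j<n i. ennreal (W I (s(i := j))) * E i (s(i := j)))"
      unfolding P_def using sum_PiE_split[OF \<open>i \<notin> ?J\<close>, of "\<lambda>s. ennreal (W I s) * E i s" "\<lambda>i. {..<n i}"]
      by (simp only: \<open>insert i ?J = I\<close>)
    also have "\<dots> = (\<Sum>s\<in>P ?J. ennreal (W ?J s) * (\<Sum>j<n i. ennreal (w i j) * E i (s(i := j))))"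
    proof (intro sum.cong refl)
      fix s assume s: "s \<in> P ?J"
      have "W I (s(i := j)) = W ?J s * w i j" for j
      proof -
        have "W I (s(i := j)) = (\<Prod>k\<in>insert i ?J. w k ((s(i := j)) k))"
          unfolding W_def using \<open>insert i ?J = I\<close> by simp
        also have "\<dots> = w i j * (\<Prod>k\<in>?J. w k ((s(i := j)) k))"
          using \<open>finite ?J\<close> by (subst prod.insert) auto
        also have "(\<Prod>k\<in>?J. w k ((s(i := j)) k)) = W ?J s"
          unfolding W_def by (intro prod.cong) auto
        finally show ?thesis by (simp only: mult.commute)
      qed
      thus "(\<Sum>j<n i. ennreal (W I (s(i := j))) * E i (s(i := j)))
          = ennreal (W ?J s) * (\<Sum>j<n i. ennreal (w i j) * E i (s(i := j)))"
        using W_nonneg[OF s] by (simp add: ennreal_mult' sum_distrib_left mult.assoc)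
    qed
    also have "\<dots> \<ge> (\<Sum>s\<in>P ?J. ennreal (W ?J s) * ?c)"
      by (intro sum_mono mult_left_mono inner) auto
    also have "(\<Sum>s\<in>P ?J. ennreal (W ?J s) * ?c) = ennreal (\<Sum>s\<in>P ?J. W ?J s) * ?c"
      unfolding sum_distrib_right[symmetric] by (subst sum_ennreal) (auto simp: W_nonneg)
    finally show ?thesis using \<open>finite ?J\<close> by (simp add: W_sum)
  qed
  have "ennreal (4 / 5 * (\<Sum>i\<in>I. (v i \<bullet> h i)\<^sup>2 / (1 + (norm (X *v h i) / \<sigma>)\<^sup>2)))
      = ennreal (\<Sum>i\<in>I. (v i \<bullet> h i)\<^sup>2 * (4 / 5 / (1 + (\<kappa> i)\<^sup>2)))"
    by (simp add: \<kappa>_def sum_distrib_left mult_ac)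
  also have "\<dots> = (\<Sum>i\<in>I. ennreal ((v i \<bullet> h i)\<^sup>2 * (4 / 5 / (1 + (\<kappa> i)\<^sup>2))))"
    by (rule sum_ennreal[symmetric]) (simp add: add_nonneg_nonneg)
  also have "\<dots> \<le> (\<Sum>i\<in>I. \<Sum>s\<in>P I. ennreal (W I s) * E i s)"
    by (intro sum_mono coord)
  also have "\<dots> = (\<Sum>s\<in>P I. ennreal (W I s) * (\<Sum>i\<in>I. E i s))"
    by (subst sum.swap) (simp add: sum_distrib_left)
  \<comment> \<open>All \<open>\<beta> s\<close> lie in the ball, so the average risk under the
    prior is at most the worst case risk.\<close>
  also have "\<dots> \<le> (\<Sum>s\<in>P I. ennreal (W I s) * risk_L SigT X \<sigma> r est)"
    by (intro sum_mono mult_left_mono order_trans[OF R_ge R_le]) auto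
  also have "\<dots> = ennreal (\<Sum>s\<in>P I. W I s) * risk_L SigT X \<sigma> r est"
    unfolding sum_distrib_right[symmetric] by (subst sum_ennreal) (auto simp: W_nonneg)
  also have "\<dots> = risk_L SigT X \<sigma> r est" by (simp add: W_sum[OF I])
  finally show ?thesis .
qed

section \<open>The commuting case\<close>

text \<open>Intermediate value theorem: at \<open>hi\<close> every term is cut off, and
  \<open>lo\<close> is chosen so that the term of \<open>b0\<close> alone equals
  \<open>y\<close>.\<close>

lemma waterfilling_level:
  fixes e w :: "'i \<Rightarrow> real"
  assumes B: "finite B" and e: "\<And>b. b \<in> B \<Longrightarrow> 0 < e b" and w: "\<And>b. b \<in> B \<Longrightarrow> 0 \<le> w b"
    and b0: "b0 \<in> B" "0 < w b0" and y: "0 < y"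
  obtains k where "0 < k" "(\<Sum>b\<in>B. e b * max 0 (w b / k - 1)) = y"
proof -
  define f where "f k = (\<Sum>b\<in>B. e b * max 0 (w b / k - 1))" for k
  define lo where "lo = w b0 / (1 + y / e b0)"
  define hi where "hi = (\<Sum>b\<in>B. w b)"
  have pos: "0 < 1 + y / e b0" "1 \<le> 1 + y / e b0"
    using y e[OF b0(1)] by (simp_all add: add_pos_pos)
  have lo: "0 < lo" using b0 pos by (simp add: lo_def)
  have w_le: "w b \<le> hi" if "b \<in> B" for b
    unfolding hi_def using that B w by (intro member_le_sum) auto
  have "lo \<le> w b0"
    unfolding lo_def using pos b0 by (simp add: divide_le_eq)
  hence lo_hi: "lo \<le> hi" using w_le[OF b0(1)] by linarith
  have "f hi = 0"
    unfolding f_def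
  proof (intro sum.neutral ballI)
    fix b assume "b \<in> B"
    hence "w b / hi \<le> 1" using w_le lo lo_hi by (simp add: divide_le_eq)
    thus "e b * max 0 (w b / hi - 1) = 0" by simp
  qed
  have "y = e b0 * (w b0 / lo - 1)"
    using e[OF b0(1)] b0 pos by (simp add: lo_def)
  also have "\<dots> \<le> e b0 * max 0 (w b0 / lo - 1)"
    using e[OF b0(1)] by (intro mult_left_mono) auto
  also have "\<dots> \<le> f lo"
  proof -
    have "0 \<le> e b * max 0 (w b / lo - 1)" if "b \<in> B" for b
      using e[OF that] by simp
    thus ?thesis unfolding f_def using B b0 by (intro member_le_sum) auto
  qed
  finally have "y \<le> f lo" .
  moreover have "continuous_on {lo..hi} f"
    unfolding f_def using lo by (intro continuous_intros) auto
  ultimately obtain k where "lo \<le> k" "f k = y"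
    using IVT2'[of f hi y lo] \<open>f hi = 0\<close> y lo_hi by auto
  thus ?thesis using that[of k] lo by (simp add: f_def)
qed

lemma sample_cov_eigenvalue_pos:
  fixes X :: "real^'d^'n"
  assumes inv: "invertible (sample_cov X)" and b: "sample_cov X *v b = s *\<^sub>R b" "norm b = 1"
  shows "0 < s" "(norm (X *v b))\<^sup>2 = real CARD('n) * s" "matrix_inv (sample_cov X) *v b = (1 / s) *\<^sub>R b"
proof -
  show norm: "(norm (X *v b))\<^sup>2 = real CARD('n) * s"
    using b by (simp add: norm_design_square dot_square_norm)
  have G: "s *\<^sub>R (matrix_inv (sample_cov X) *v b) = b"
  proof -
    have "s *\<^sub>R (matrix_inv (sample_cov X) *v b) = matrix_inv (sample_cov X) *v (sample_cov X *v b)"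
      by (simp add: b matrix_vector_mult_scaleR)
    thus ?thesis by (simp add: matrix_vector_mul_assoc matrix_inv_mult(2)[OF inv])
  qed
  have "s \<noteq> 0" using G b(2) by auto
  moreover have "0 \<le> real CARD('n) * s" unfolding norm[symmetric] by simp
  ultimately show "0 < s" by (simp add: zero_le_mult_iff)
  show "matrix_inv (sample_cov X) *v b = (1 / s) *\<^sub>R b"
    using G \<open>s \<noteq> 0\<close> by (metis divide_inverse_commute mult.right_neutral scaleR_one scaleR_scaleR left_inverse)
qed

text \<open>Pinsker's linear estimator shrinks the coordinate \<open>b\<close> by \<open>1 - k / w b\<close>. Its worst case risk is the
  linear minimax risk over a hyperrectangle inscribed in the ball, with half sides \<open>t b\<close>.\<close>

lemma commuting_minimax:
  fixes X :: "real^'d^'n" and SigT :: "real^'d^'d"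
  assumes \<sigma>: "0 < \<sigma>" and r: "0 < r" and inv: "invertible (sample_cov X)" and SigT: "psd SigT"
    and comm: "sample_cov X ** SigT = SigT ** sample_cov X"
  obtains C \<tau> where "mm_feasible SigT C \<tau>"
    and "\<And>est. est \<in> borel_measurable borel \<Longrightarrow> ennreal (4 / 5 * mm_objective SigT X \<sigma> r C \<tau>) \<le> risk_L SigT X \<sigma> r est"
proof -
  let ?S = "psd_sqrt SigT" and ?G = "matrix_inv (sample_cov X)"
  have tT: "transpose SigT = SigT" using SigT by (simp add: psd_def)
  obtain B s \<tau> where B: "orthonormal_basis B"
    and s: "\<And>b. b \<in> B \<Longrightarrow> sample_cov X *v b = s b *\<^sub>R b" and \<tau>: "\<And>b. b \<in> B \<Longrightarrow> SigT *v b = \<tau> b *\<^sub>R b"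
    using commuting_symmetric_eigenbasis[OF transpose_sample_cov tT comm] by metis
  have fin: "finite B" and unit: "\<And>b. b \<in> B \<Longrightarrow> norm b = 1" using B by (auto simp: orthonormal_basis_def)
  note cov = sample_cov_eigenvalue_pos[OF inv s unit]
  define w where "w b = sqrt (\<tau> b)" for b
  have \<tau>_nonneg: "0 \<le> \<tau> b" if "b \<in> B" for b using psd_eigenvalue_nonneg[OF SigT \<tau> unit] that by blast
  have w: "0 \<le> w b" "(w b)\<^sup>2 = \<tau> b" if "b \<in> B" for b using \<tau>_nonneg[OF that] by (auto simp: w_def)
  have S_b: "?S *v b = w b *\<^sub>R b" if "b \<in> B" for b
    using psd_sqrt_exists[OF SigT] \<tau>[OF that] w[OF that]
    by (intro psd_square_root_eigenvector) (auto simp: matrix_vector_mul_assoc)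
  \<comment> \<open>The variance of the least squares estimate of the coordinate along
    \<open>b\<close>.\<close>
  define e where "e b = \<sigma>\<^sup>2 / (norm (X *v b))\<^sup>2" for b
  have e_pos: "0 < e b" if "b \<in> B" for b
    using cov(1,2)[OF that that] \<sigma> by (simp add: e_def)
  have S_norm: "(norm (?S *v x))\<^sup>2 = (\<Sum>b\<in>B. (w b)\<^sup>2 * (x \<bullet> b)\<^sup>2)" for x
  proof -
    have "SigT = eigen_matrix B \<tau>" by (rule eq_eigen_matrix[OF B \<tau>])
    hence "x \<bullet> (SigT *v x) = (\<Sum>b\<in>B. \<tau> b * (x \<bullet> b)\<^sup>2)"
      using eigen_matrix_inner[OF B, of x \<tau>] by simp
    thus ?thesis unfolding norm_psd_sqrt_square[OF SigT] by (simp add: w)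
  qed
  have feasible: "mm_feasible SigT (eigen_matrix B c) k"
    if k: "\<And>b. b \<in> B \<Longrightarrow> (w b)\<^sup>2 * (1 - c b)\<^sup>2 \<le> k" for c k
    unfolding mm_feasible_iff[OF SigT]
  proof
    fix x
    have "((eigen_matrix B c - mat 1) *v x) \<bullet> b = (c b - 1) * (x \<bullet> b)" if "b \<in> B" for b
    proof -
      have "(eigen_matrix B c *v x) \<bullet> b = x \<bullet> (eigen_matrix B c *v b)"
        using sym_matrix_inner[OF transpose_eigen_matrix[OF B], of x c b] by simp
      thus ?thesis
        by (simp add: matrix_vector_mult_diff_rdistrib inner_diff_left eigen_matrix_basis[OF B that] left_diff_distrib)
    qed
    hence "(norm (?S *v ((eigen_matrix B c - mat 1) *v x)))\<^sup>2 = (\<Sum>b\<in>B. ((w b)\<^sup>2 * (1 - c b)\<^sup>2) * (x \<bullet> b)\<^sup>2)"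
      unfolding S_norm by (intro sum.cong) (auto simp: power_mult_distrib power2_commute)
    also have "\<dots> \<le> (\<Sum>b\<in>B. k * (x \<bullet> b)\<^sup>2)"
      by (intro sum_mono mult_right_mono k) auto
    also have "\<dots> = k * (norm x)\<^sup>2"
      by (simp add: orthonormal_basis_norm_square[OF B, of x] sum_distrib_left)
    finally show "(norm (?S *v ((eigen_matrix B c - mat 1) *v x)))\<^sup>2 \<le> k * (norm x)\<^sup>2" .
  qed
  have objective: "mm_objective SigT X \<sigma> r (eigen_matrix B c) k = r\<^sup>2 * k + (\<Sum>b\<in>B. (w b)\<^sup>2 * e b * (c b)\<^sup>2)" for c k
  proof -
    have "?S ** eigen_matrix B c ** ?G ** transpose (eigen_matrix B c) ** ?S
        = eigen_matrix B (\<lambda>b. (w b)\<^sup>2 * (c b)\<^sup>2 / s b)"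
      by (rule eq_eigen_matrix[OF B])
         (simp add: matrix_vector_mul_assoc[symmetric] transpose_eigen_matrix[OF B] S_b eigen_matrix_basis[OF B]
           matrix_vector_mult_scaleR cov(3) power2_eq_square mult_ac)
    moreover have "\<sigma>\<^sup>2 / real CARD('n) * (\<Sum>b\<in>B. (w b)\<^sup>2 * (c b)\<^sup>2 / s b) = (\<Sum>b\<in>B. (w b)\<^sup>2 * e b * (c b)\<^sup>2)"
      unfolding sum_distrib_left by (intro sum.cong) (auto simp: e_def cov(2))
    ultimately show ?thesis
      by (simp add: mm_objective_def trace_eigen_matrix[OF B])
  qed
  show ?thesis
  proof (cases "\<exists>b0\<in>B. 0 < w b0")
    \<comment> \<open>Here \<open>SigT\<close> vanishes and no water level exists; the zero
      estimator has no loss.\<close>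
    case False
    hence w0: "w b = 0" if "b \<in> B" for b using w(1) that by force
    show ?thesis
    proof (rule that[of "eigen_matrix B (\<lambda>_. 0)" 0])
      show "mm_feasible SigT (eigen_matrix B (\<lambda>_. 0)) 0" by (rule feasible) (simp add: w0)
      have "mm_objective SigT X \<sigma> r (eigen_matrix B (\<lambda>_. 0)) 0 = 0" by (simp add: objective)
      thus "ennreal (4 / 5 * mm_objective SigT X \<sigma> r (eigen_matrix B (\<lambda>_. 0)) 0) \<le> risk_L SigT X \<sigma> r est" for est
        by simp
    qed
  next
    case True
    then obtain b0 where b0: "b0 \<in> B" "0 < w b0" by blast
    \<comment> \<open>This is stationarity in \<open>k\<close> of \<open>r\<^sup>2 k\<^sup>2\<close>
      plus the sum of \<open>e (w - k)\<^sup>2\<close> over the coordinates with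
      \<open>w > k\<close>. It also says that the squares of the half sides \<open>t b\<close>
      defined below add up to \<open>r\<^sup>2\<close>, so the box is inscribed in the ball.\<close>
    obtain k where k: "0 < k" "(\<Sum>b\<in>B. e b * max 0 (w b / k - 1)) = r\<^sup>2"
      using waterfilling_level[where B=B and e=e and w=w, OF fin e_pos w(1) b0 zero_less_power[OF r, of 2]] by blast
    define I where "I = {b\<in>B. k < w b}"
    have I: "finite I" "I \<subseteq> B" using fin by (auto simp: I_def)
    have wI: "k < w b" if "b \<in> I" for b using that by (simp add: I_def)
    have sumI: "(\<Sum>b\<in>I. e b * (w b / k - 1)) = r\<^sup>2"
    proof -
      have "(\<Sum>b\<in>B. e b * max 0 (w b / k - 1)) = (\<Sum>b\<in>I. e b * max 0 (w b / k - 1))"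
      proof (rule sum.mono_neutral_right[OF fin I(2)], intro ballI)
        fix b assume "b \<in> B - I"
        hence "w b / k \<le> 1" using k(1) by (auto simp: I_def divide_le_eq)
        thus "e b * max 0 (w b / k - 1) = 0" by simp
      qed
      also have "\<dots> = (\<Sum>b\<in>I. e b * (w b / k - 1))"
      proof (intro sum.cong refl)
        fix b assume "b \<in> I"
        hence "1 < w b / k" using k(1) wI by (simp add: less_divide_eq)
        thus "e b * max 0 (w b / k - 1) = e b * (w b / k - 1)" by simp
      qed
      finally show ?thesis using k(2) by simp
    qed
    define c where "c b = (if k < w b then 1 - k / w b else 0)" for b
    define t where "t b = sqrt (e b * (w b / k - 1))" for b
    have t: "0 < t b" "(t b)\<^sup>2 = e b * (w b / k - 1)" if "b \<in> I" for b
    proof -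
      have "0 < e b * (w b / k - 1)"
        using that I(2) e_pos k(1) wI by (intro mult_pos_pos) (auto simp: less_divide_eq)
      thus "0 < t b" "(t b)\<^sup>2 = e b * (w b / k - 1)" by (simp_all add: t_def)
    qed
    \<comment> \<open>Replacing \<open>r\<^sup>2\<close> by means of \<open>sumI\<close> turns the
      objective into a sum over coordinates, which is matched with the linear minimax risk of the
      box term by term.\<close>
    have val: "mm_objective SigT X \<sigma> r (eigen_matrix B c) (k\<^sup>2) = (\<Sum>b\<in>I. e b * (w b * (w b - k)))"
    proof -
      have "(\<Sum>b\<in>B. (w b)\<^sup>2 * e b * (c b)\<^sup>2) = (\<Sum>b\<in>I. (w b)\<^sup>2 * e b * (c b)\<^sup>2)"
        by (rule sum.mono_neutral_right[OF fin I(2)]) (auto simp: I_def c_def)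
      also have "\<dots> = (\<Sum>b\<in>I. e b * (w b - k)\<^sup>2)"
      proof (intro sum.cong refl)
        fix b assume "b \<in> I"
        hence "c b = (w b - k) / w b" "w b \<noteq> 0"
          using wI[of b] k(1) by (auto simp: c_def diff_divide_distrib)
        thus "(w b)\<^sup>2 * e b * (c b)\<^sup>2 = e b * (w b - k)\<^sup>2" by (simp add: power_divide)
      qed
      finally have "mm_objective SigT X \<sigma> r (eigen_matrix B c) (k\<^sup>2)
          = (\<Sum>b\<in>I. e b * (w b / k - 1)) * k\<^sup>2 + (\<Sum>b\<in>I. e b * (w b - k)\<^sup>2)"
        unfolding objective by (simp add: sumI)
      also have "\<dots> = (\<Sum>b\<in>I. e b * (w b / k - 1) * k\<^sup>2 + e b * (w b - k)\<^sup>2)"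
        by (simp add: sum_distrib_right sum.distrib)
      also have "\<dots> = (\<Sum>b\<in>I. e b * (w b * (w b - k)))"
      proof (intro sum.cong refl)
        fix b
        have "(w b / k - 1) * k\<^sup>2 = k * (w b - k)"
          using k(1) by (simp add: power2_eq_square algebra_simps)
        hence "e b * (w b / k - 1) * k\<^sup>2 + e b * (w b - k)\<^sup>2 = e b * (k * (w b - k) + (w b - k)\<^sup>2)"
          by (simp only: mult.assoc distrib_left)
        thus "e b * (w b / k - 1) * k\<^sup>2 + e b * (w b - k)\<^sup>2 = e b * (w b * (w b - k))"
          by (simp add: power2_eq_square algebra_simps)
      qed
      finally show ?thesis .
    qed
    show ?thesis
    proof (rule that[of "eigen_matrix B c" "k\<^sup>2"])
      \<comment> \<open>The shrinkage equalises the bias: \<open>w b (1 - c b)\<close> is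
        \<open>k\<close> on \<open>I\<close>, and elsewhere it is \<open>w b\<close>, which is at
        most \<open>k\<close>.\<close>
      show "mm_feasible SigT (eigen_matrix B c) (k\<^sup>2)"
      proof (rule feasible)
        fix b assume "b \<in> B"
        show "(w b)\<^sup>2 * (1 - c b)\<^sup>2 \<le> k\<^sup>2"
          using w(1)[OF \<open>b \<in> B\<close>] k(1) by (auto simp: c_def power_divide power_mono)
      qed
      fix est :: "real^'n \<Rightarrow> real^'d" assume est: "est \<in> borel_measurable borel"
      have "(\<Sum>b\<in>I. e b * (w b * (w b - k)))
          = (\<Sum>b\<in>I. ((w b *\<^sub>R b) \<bullet> (t b *\<^sub>R b))\<^sup>2 / (1 + (norm (X *v (t b *\<^sub>R b)) / \<sigma>)\<^sup>2))"
      proof (intro sum.cong refl)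
        fix b assume b: "b \<in> I"
        hence bB: "b \<in> B" using I by auto
        have "(norm (X *v (t b *\<^sub>R b)) / \<sigma>)\<^sup>2 = (t b)\<^sup>2 / e b"
          by (simp add: e_def matrix_vector_mult_scaleR power_mult_distrib power_divide)
        also have "\<dots> = w b / k - 1" using t(2)[OF b] e_pos[OF bB] by simp
        finally have den: "1 + (norm (X *v (t b *\<^sub>R b)) / \<sigma>)\<^sup>2 = w b / k" by simp
        have num: "((w b *\<^sub>R b) \<bullet> (t b *\<^sub>R b))\<^sup>2 = (w b)\<^sup>2 * (e b * (w b / k - 1))"
          using t(2)[OF b] unit[OF bB] by (simp add: power_mult_distrib dot_square_norm)
        have "w b \<noteq> 0" using wI[OF b] k(1) by simp
        thus "e b * (w b * (w b - k))
            = ((w b *\<^sub>R b) \<bullet> (t b *\<^sub>R b))\<^sup>2 / (1 + (norm (X *v (t b *\<^sub>R b)) / \<sigma>)\<^sup>2)"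
          unfolding den num using k(1) by (simp add: power2_eq_square field_simps)
      qed
      also have "ennreal (4 / 5 * \<dots>) \<le> risk_L SigT X \<sigma> r est"
      proof (rule minimax_lower_bound[OF \<sigma> I(1) est])
        show "X *v (t b *\<^sub>R b) \<noteq> 0" if "b \<in> I" for b
        proof -
          have "0 < (norm (X *v b))\<^sup>2" using that I(2) cov(1,2)[of b] by auto
          thus ?thesis using t(1)[OF that] by (auto simp: matrix_vector_mult_scaleR)
        qed
        show "(w a *\<^sub>R a) \<bullet> (t b *\<^sub>R b) = 0" if "a \<in> I" "b \<in> I" "a \<noteq> b" for a b
          using orthonormal_basis_inner[OF B, of a b] that I(2) by (simp add: subset_iff)
        show "(\<Sum>b\<in>I. ((w b *\<^sub>R b) \<bullet> x)\<^sup>2) \<le> (norm (?S *v x))\<^sup>2" for x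
          unfolding S_norm using sum_mono2[OF fin I(2), of "\<lambda>b. (w b)\<^sup>2 * (x \<bullet> b)\<^sup>2"]
          by (simp add: power_mult_distrib inner_commute)
        fix a assume a: "\<And>b. b \<in> I \<Longrightarrow> \<bar>a b\<bar> \<le> (1::real)"
        let ?x = "\<Sum>b\<in>I. a b *\<^sub>R (t b *\<^sub>R b)"
        have coef: "?x \<bullet> b = (if b \<in> I then a b * t b else 0)" if "b \<in> B" for b
        proof -
          have "?x \<bullet> b = (\<Sum>c\<in>I. if c = b then a b * t b else 0)"
            unfolding inner_sum_left using that I(2)
            by (intro sum.cong) (auto simp: subset_iff orthonormal_basis_inner[OF B])
          thus ?thesis using I(1) by simp
        qed
        have "(norm ?x)\<^sup>2 = (\<Sum>b\<in>B. (if b \<in> I then a b * t b else 0)\<^sup>2)"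
          unfolding orthonormal_basis_norm_square[OF B, of ?x] by (intro sum.cong refl) (simp only: coef)
        also have "\<dots> = (\<Sum>b\<in>I. (a b * t b)\<^sup>2)"
          by (rule sum.mono_neutral_cong_right[OF fin I(2)]) auto
        also have "\<dots> \<le> (\<Sum>b\<in>I. e b * (w b / k - 1))"
        proof (rule sum_mono)
          fix b assume b: "b \<in> I"
          have "(a b)\<^sup>2 \<le> 1" using a[OF b] by (simp add: abs_square_le_1)
          hence "(a b)\<^sup>2 * (t b)\<^sup>2 \<le> 1 * (t b)\<^sup>2" by (intro mult_right_mono) auto
          thus "(a b * t b)\<^sup>2 \<le> e b * (w b / k - 1)" using t(2)[OF b] by (simp add: power_mult_distrib)
        qed
        also have "\<dots> = r\<^sup>2" by (rule sumI)
        finally show "norm ?x \<le> r" using r by (intro power2_le_imp_le[of "norm ?x" r]) auto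
      qed
      finally show "ennreal (4 / 5 * mm_objective SigT X \<sigma> r (eigen_matrix B c) (k\<^sup>2)) \<le> risk_L SigT X \<sigma> r est"
        unfolding val .
    qed
  qed
qed

section \<open>The rank one case\<close>

text \<open>The range is a line spanned by some \<open>e\<close>. Symmetry makes \<open>M x\<close>
  equal to \<open>a (e \<bullet> x) e\<close> for a constant \<open>a\<close>, positivity and rank
  give \<open>a > 0\<close>, and \<open>sqrt a\<close> is absorbed into \<open>e\<close>.\<close>

lemma psd_rank_one:
  fixes M :: "real^'d^'d"
  assumes M: "psd M" and rank: "rank M = 1"
  obtains v where "v \<noteq> 0" "\<And>x. M *v x = (v \<bullet> x) *\<^sub>R v"
proof -
  have tM: "transpose M = M" using M by (simp add: psd_def)
  have dim: "dim (range ((*v) M)) = 1" using rank by (simp add: rank_dim_range)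
  obtain e where e: "e \<in> range ((*v) M)" "e \<noteq> 0"
  proof -
    have "\<not> range ((*v) M) \<subseteq> {0}"
    proof
      assume "range ((*v) M) \<subseteq> {0}"
      hence "dim (range ((*v) M)) = 0" by (simp only: dim_eq_0)
      thus False using dim by simp
    qed
    thus ?thesis using that by blast
  qed
  have "{e} \<subseteq> range ((*v) M)" using e(1) by blast
  moreover have "dim (range ((*v) M)) \<le> dim {e}" unfolding dim using e(2) by simp
  ultimately have "span {e} = span (range ((*v) M))" by (rule dim_eq_span)
  hence range: "range ((*v) M) \<subseteq> span {e}" using span_superset[of "range ((*v) M)"] by (simp only:)
  have "\<exists>c. M *v x = c *\<^sub>R e" for x
    using subsetD[OF range rangeI[of "(*v) M" x]] unfolding span_singleton by blast
  then obtain f where f: "\<And>x. M *v x = f x *\<^sub>R e" by metis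
  define a where "a = f e / (e \<bullet> e)"
  have ee: "0 < e \<bullet> e" using e(2) by simp
  have f_eq: "f x = a * (e \<bullet> x)" for x
  proof -
    have "f x * (e \<bullet> e) = f e * (e \<bullet> x)"
      using sym_matrix_inner[OF tM, of e x] by (simp add: f inner_commute)
    thus ?thesis using ee by (simp add: a_def field_simps)
  qed
  have "0 \<le> e \<bullet> (M *v e)" using M by (simp add: psd_def)
  hence "0 \<le> a" using ee by (simp add: f f_eq zero_le_mult_iff)
  moreover have "a \<noteq> 0"
    using e by (auto simp: f f_eq)
  ultimately have "0 < a" by simp
  show ?thesis
  proof (rule that[of "sqrt a *\<^sub>R e"])
    show "sqrt a *\<^sub>R e \<noteq> 0" using \<open>0 < a\<close> e(2) by simp
    show "M *v x = ((sqrt a *\<^sub>R e) \<bullet> x) *\<^sub>R (sqrt a *\<^sub>R e)" for x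
      using \<open>0 < a\<close> by (simp add: f f_eq mult.assoc mult.left_commute[of "sqrt a"])
  qed
qed

lemma trace_rank_one:
  fixes M :: "real^'d^'d"
  assumes "\<And>x. M *v x = (a * (v \<bullet> x)) *\<^sub>R v"
  shows "trace M = a * (v \<bullet> v)"
proof -
  have "M $ i $ i = a * (v $ i * v $ i)" for i
  proof -
    have "M $ i $ i = (M *v axis i 1) $ i"
      by (simp add: matrix_vector_mult_basis column_def)
    thus ?thesis by (simp add: assms inner_axis)
  qed
  thus ?thesis by (simp add: trace_def inner_vec_def sum_distrib_left)
qed

text \<open>With \<open>G\<close> the covariance of the least squares estimator and \<open>(r\<^sup>2 I + G) q = v\<close>, the minimax linear
  estimator of \<open>v \<bullet> \<beta>\<close> has coefficients \<open>r\<^sup>2 q\<close>, and the hardest one-dimensional subfamily has direction \<open>G q\<close>.\<close>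

lemma rank_one_minimax:
  fixes X :: "real^'d^'n" and SigT :: "real^'d^'d"
  assumes \<sigma>: "0 < \<sigma>" and r: "0 < r" and inv: "invertible (sample_cov X)" and SigT: "psd SigT" and rank: "rank SigT = 1"
  obtains C \<tau> where "mm_feasible SigT C \<tau>"
    and "\<And>est. est \<in> borel_measurable borel \<Longrightarrow> ennreal (4 / 5 * mm_objective SigT X \<sigma> r C \<tau>) \<le> risk_L SigT X \<sigma> r est"
proof -
  let ?S = "psd_sqrt SigT" and ?Gi = "matrix_inv (sample_cov X)"
  obtain v where v: "v \<noteq> 0" "\<And>x. SigT *v x = (v \<bullet> x) *\<^sub>R v" using psd_rank_one[OF SigT rank] by blast
  have S_norm: "(norm (?S *v x))\<^sup>2 = (v \<bullet> x)\<^sup>2" for x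
    unfolding norm_psd_sqrt_square[OF SigT] v(2) by (simp add: power2_eq_square inner_commute)
  define G where "G = (\<sigma>\<^sup>2 / real CARD('n)) *\<^sub>R ?Gi"
  have tG: "transpose G = G"
    by (simp add: G_def transpose_scaleR transpose_matrix_inv[OF inv transpose_sample_cov])
  have cov_G: "sample_cov X *v (G *v x) = (\<sigma>\<^sup>2 / real CARD('n)) *\<^sub>R x" for x
    by (simp add: G_def scaleR_matrix_vector_assoc[symmetric] matrix_vector_mult_scaleR matrix_vector_mul_assoc
        matrix_inv_mult(1)[OF inv])
  have X_G: "(norm (X *v (G *v x)))\<^sup>2 = \<sigma>\<^sup>2 * (x \<bullet> (G *v x))" for x
    by (simp add: norm_design_square cov_G inner_commute)
  have G_nonneg: "0 \<le> x \<bullet> (G *v x)" for x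
  proof -
    have "0 \<le> \<sigma>\<^sup>2 * (x \<bullet> (G *v x))" unfolding X_G[symmetric] by simp
    thus ?thesis using \<sigma> by (simp add: zero_le_mult_iff)
  qed
  have G_0: "x = 0" if "G *v x = 0" for x
    using cov_G[of x] that \<sigma> by simp
  define M where "M = r\<^sup>2 *\<^sub>R mat 1 + G"
  have M: "M *v x = r\<^sup>2 *\<^sub>R x + G *v x" for x
    by (simp add: M_def matrix_vector_mult_add_rdistrib scaleR_matrix_vector_assoc[symmetric])
  have "inj ((*v) M)"
  proof (rule linear_injective_0[THEN iffD2, OF matrix_vector_mul_linear], intro allI impI)
    fix x assume "M *v x = 0"
    hence "0 = x \<bullet> (r\<^sup>2 *\<^sub>R x + G *v x)" by (simp add: M)
    hence "r\<^sup>2 * (x \<bullet> x) \<le> 0" using G_nonneg[of x] by (simp add: inner_add_right)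
    hence "x \<bullet> x \<le> 0" using r by (simp add: mult_le_0_iff)
    thus "x = 0" by (metis inner_eq_zero_iff inner_ge_zero order_antisym)
  qed
  hence "surj ((*v) M)" by (rule linear_injective_imp_surjective[OF matrix_vector_mul_linear]) (rule refl)
  then obtain q where "v = M *v q" by (metis surjD)
  hence q: "v = r\<^sup>2 *\<^sub>R q + G *v q" by (simp add: M)
  define h where "h = G *v q"
  define c where "c = r\<^sup>2 *\<^sub>R q"
  have vc: "v - c = h" by (simp add: q c_def h_def)
  have "q \<noteq> 0" using q v(1) by auto
  hence "h \<noteq> 0" using G_0 by (auto simp: h_def)
  hence hh: "0 < (norm h)\<^sup>2" by simp
  have vh: "v \<bullet> h = (norm h)\<^sup>2 + r\<^sup>2 * (q \<bullet> h)"
    by (subst q) (simp add: h_def inner_add_left dot_square_norm)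
  have qh: "0 \<le> q \<bullet> h" using G_nonneg by (simp add: h_def)
  have vh_pos: "0 < v \<bullet> h" unfolding vh using hh qh by (intro add_pos_nonneg) auto
  \<comment> \<open>Only \<open>v \<bullet> (C x)\<close> enters the loss, and it must equal
    \<open>c \<bullet> x\<close>; the rank one choice makes the trace explicit.\<close>
  define C :: "real^'d^'d" where "C = (\<chi> i j. v $ i * c $ j / (v \<bullet> v))"
  have vv: "0 < v \<bullet> v" using v(1) by simp
  have C: "C *v x = ((c \<bullet> x) / (v \<bullet> v)) *\<^sub>R v" for x
    by (simp add: C_def vec_eq_iff matrix_vector_mult_def inner_vec_def sum_divide_distrib sum_distrib_left mult_ac)
  have Ct: "transpose C *v x = ((v \<bullet> x) / (v \<bullet> v)) *\<^sub>R c" for x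
    unfolding C_def transpose_def
    by (simp add: vec_eq_iff matrix_vector_mult_def inner_vec_def sum_divide_distrib sum_distrib_left mult_ac)
  have feas: "mm_feasible SigT C ((norm h)\<^sup>2)"
    unfolding mm_feasible_iff[OF SigT]
  proof
    fix x
    have "v \<bullet> ((C - mat 1) *v x) = - (h \<bullet> x)"
      using vv by (simp add: matrix_vector_mult_diff_rdistrib C inner_diff_right vc[symmetric] inner_diff_left)
    hence "(norm (?S *v ((C - mat 1) *v x)))\<^sup>2 = (h \<bullet> x)\<^sup>2"
      by (simp add: S_norm)
    also have "\<dots> \<le> (norm h * norm x)\<^sup>2"
      using Cauchy_Schwarz_ineq2[of h x] by (metis abs_ge_zero power2_abs power_mono)
    finally show "(norm (?S *v ((C - mat 1) *v x)))\<^sup>2 \<le> (norm h)\<^sup>2 * (norm x)\<^sup>2"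
      by (simp add: power_mult_distrib)
  qed
  \<comment> \<open>Squared bias \<open>r\<^sup>2 (h \<bullet> h)\<close> and variance
    \<open>c \<bullet> (G c) = r\<^sup>2 (r\<^sup>2 (q \<bullet> h))\<close> add up to
    \<open>r\<^sup>2 (v \<bullet> h)\<close> by the decomposition \<open>vh\<close>.\<close>
  have obj: "mm_objective SigT X \<sigma> r C ((norm h)\<^sup>2) = r\<^sup>2 * (v \<bullet> h)"
  proof -
    have S: "psd ?S" "transpose ?S = ?S" using psd_sqrt_exists(1)[OF SigT] by (auto simp: psd_def)
    have Sv: "?S *v v = norm v *\<^sub>R v"
    proof (rule psd_square_root_eigenvector[OF S(1)])
      show "?S *v (?S *v v) = (norm v)\<^sup>2 *\<^sub>R v"
        by (simp add: matrix_vector_mul_assoc psd_sqrt_exists(2)[OF SigT] v(2) dot_square_norm)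
    qed simp
    have "trace (?S ** C ** ?Gi ** transpose C ** ?S) = (c \<bullet> (?Gi *v c)) / (v \<bullet> v) * (v \<bullet> v)"
    proof (rule trace_rank_one)
      fix x
      have "v \<bullet> (?S *v x) = norm v * (v \<bullet> x)"
        using sym_matrix_inner[OF S(2), of v x] by (simp add: Sv)
      hence "(?S ** C ** ?Gi ** transpose C ** ?S) *v x
          = ((norm v * (v \<bullet> x) / (v \<bullet> v) * (c \<bullet> (?Gi *v c)) / (v \<bullet> v)) * norm v) *\<^sub>R v"
        by (simp add: matrix_vector_mul_assoc[symmetric] Ct C matrix_vector_mult_scaleR Sv del: transpose_matrix_vector)
      also have "norm v * (v \<bullet> x) / (v \<bullet> v) * (c \<bullet> (?Gi *v c)) / (v \<bullet> v) * norm v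
          = c \<bullet> (?Gi *v c) / (v \<bullet> v) * (v \<bullet> x)"
        using v(1) by (simp add: dot_square_norm power2_eq_square)
      finally show "(?S ** C ** ?Gi ** transpose C ** ?S) *v x = (c \<bullet> (?Gi *v c) / (v \<bullet> v) * (v \<bullet> x)) *\<^sub>R v" .
    qed
    hence "\<sigma>\<^sup>2 / real CARD('n) * trace (?S ** C ** ?Gi ** transpose C ** ?S) = c \<bullet> (G *v c)"
      using vv by (simp add: G_def scaleR_matrix_vector_assoc[symmetric])
    also have "\<dots> = r\<^sup>2 * (r\<^sup>2 * (q \<bullet> h))"
      by (simp add: c_def h_def matrix_vector_mult_scaleR)
    finally show ?thesis
      by (simp add: mm_objective_def vh distrib_left)
  qed
  show ?thesis
  proof (rule that[OF feas])
    fix est :: "real^'n \<Rightarrow> real^'d" assume est: "est \<in> borel_measurable borel"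
    \<comment> \<open>The endpoint, on the sphere of radius \<open>r\<close>, of the hardest
      segment. The linear minimax risk over the segment from \<open>- g\<close> to \<open>g\<close>
      is again \<open>r\<^sup>2 (v \<bullet> h)\<close>.\<close>
    define g where "g = (r / norm h) *\<^sub>R h"
    have "norm g = r" using \<open>h \<noteq> 0\<close> r by (simp add: g_def)
    have Xg: "(norm (X *v g) / \<sigma>)\<^sup>2 = r\<^sup>2 * (q \<bullet> h) / (norm h)\<^sup>2"
      using \<sigma> X_G[of q] by (simp add: g_def h_def matrix_vector_mult_scaleR power_mult_distrib power_divide)
    have "1 + (norm (X *v g) / \<sigma>)\<^sup>2 = (v \<bullet> h) / (norm h)\<^sup>2"
      unfolding Xg vh using hh by (simp add: add_divide_distrib)
    hence "(v \<bullet> g)\<^sup>2 / (1 + (norm (X *v g) / \<sigma>)\<^sup>2) = r\<^sup>2 * (v \<bullet> h)"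
      using vh_pos hh by (simp add: g_def power_mult_distrib power_divide power2_eq_square[of "v \<bullet> h"])
    \<comment> \<open>The loss is the square of a single functional, so one bounded normal mean
      carries the whole problem and the index set is a singleton.\<close>
    moreover have "ennreal (4 / 5 * (\<Sum>i\<in>{()}. (v \<bullet> g)\<^sup>2 / (1 + (norm (X *v g) / \<sigma>)\<^sup>2))) \<le> risk_L SigT X \<sigma> r est"
    proof (rule minimax_lower_bound[OF \<sigma> _ est, where h="\<lambda>_. g" and v="\<lambda>_. v"])
      show "X *v g \<noteq> 0"
      proof
        assume "X *v g = 0"
        hence "X *v h = 0" using r \<open>h \<noteq> 0\<close> by (simp add: g_def matrix_vector_mult_scaleR)
        hence "sample_cov X *v (G *v q) = 0" by (simp add: sample_cov_mult h_def)
        thus False using \<open>q \<noteq> 0\<close> \<sigma> by (simp add: cov_G)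
      qed
      show "norm (\<Sum>i\<in>{()}. a i *\<^sub>R g) \<le> r" if "\<And>i. i \<in> {()} \<Longrightarrow> \<bar>a i\<bar> \<le> 1" for a
        using that r by (simp add: \<open>norm g = r\<close> mult_left_le_one_le)
    qed (auto simp: S_norm)
    ultimately show "ennreal (4 / 5 * mm_objective SigT X \<sigma> r C ((norm h)\<^sup>2)) \<le> risk_L SigT X \<sigma> r est"
      by (simp add: obj)
  qed
qed

theorem theorem2:
  fixes X :: "real^'d^'n" and SigT Cs :: "real^'d^'d" and \<sigma> r \<tau>s :: real
  assumes "\<sigma> > 0" and "r > 0"
    and "invertible (sample_cov X)"
    and "psd SigT"
    and "mm_feasible SigT Cs \<tau>s"
    and "\<And>C \<tau>. mm_feasible SigT C \<tau> \<Longrightarrow>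
            mm_objective SigT X \<sigma> r Cs \<tau>s \<le> mm_objective SigT X \<sigma> r C \<tau>"
  shows "risk_L SigT X \<sigma> r (\<lambda>y. Cs *v beta_SS X y) = R_L SigT X \<sigma> r
       \<and> ((sample_cov X ** SigT = SigT ** sample_cov X \<or> rank SigT = 1) \<longrightarrow>
            risk_L SigT X \<sigma> r (\<lambda>y. Cs *v beta_SS X y) \<le> ennreal (5/4) * R_N SigT X \<sigma> r)"
proof (intro conjI impI)
  show "risk_L SigT X \<sigma> r (\<lambda>y. Cs *v beta_SS X y) = R_L SigT X \<sigma> r"
    by (rule linear_minimax(2)[OF assms])
  assume "sample_cov X ** SigT = SigT ** sample_cov X \<or> rank SigT = 1"
  then obtain C \<tau> where feas: "mm_feasible SigT C \<tau>"
    and lower: "\<And>est. est \<in> borel_measurable borel \<Longrightarrow> ennreal (4 / 5 * mm_objective SigT X \<sigma> r C \<tau>) \<le> risk_L SigT X \<sigma> r est"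
    using commuting_minimax[OF assms(1-4)] rank_one_minimax[OF assms(1-4)] by metis
  have "risk_L SigT X \<sigma> r (\<lambda>y. Cs *v beta_SS X y) \<le> ennreal (mm_objective SigT X \<sigma> r Cs \<tau>s)"
    by (rule linear_minimax(1)[OF assms])
  also have "\<dots> \<le> ennreal (5 / 4 * (4 / 5 * mm_objective SigT X \<sigma> r C \<tau>))"
    using assms(6)[OF feas] by (intro ennreal_leI) simp
  also have "\<dots> = ennreal (5 / 4) * ennreal (4 / 5 * mm_objective SigT X \<sigma> r C \<tau>)"
    by (rule ennreal_mult') simp
  also have "\<dots> \<le> ennreal (5 / 4) * R_N SigT X \<sigma> r"
    unfolding R_N_def using lower by (intro mult_left_mono INF_greatest) auto
  finally show "risk_L SigT X \<sigma> r (\<lambda>y. Cs *v beta_SS X y) \<le> ennreal (5 / 4) * R_N SigT X \<sigma> r" .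
qed

end
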